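(* Let $k$ be an algebraically closed field of characteristic zero, $R=k[x_1,\ldots,x_n]$ with $n\ge3$, $d\ge2$, and let $J\subseteq R$ be an ideal of codimension $2$ with minimal graded free resolution $$0\to R(-\delta_1-\delta_2-\delta_3)\to R(-d-\delta_1)\oplus R(-d-\delta_2)\oplus R(-d-\delta_3)\to R(-d)^3\to J\to0,$$ where $\delta_1\le\delta_2\le\delta_3\le d$ and $\delta_i+\delta_j\ge d+1$ for every $1\le i<j\le3$. Then $$\mathrm{Bour}(J)=(d-\delta_1-\delta_2)(d-\delta_1-\delta_3).$$
   Context: Here $J=(f_1,f_2,f_3)$ is minimally generated by three forms of degree $d$. $\mathrm{Syz}(J)=\{(a_1,a_2,a_3)\in R^3:\sum a_if_i=0\}$ is graded as a submodule of $R^3$ (standard grading), $e=\mathrm{indeg}(\mathrm{Syz}(J))$ is the least degree of a nonzero homogeneous syzygy (so $e=\delta_1$), and $\deg(R/J)$ is the multiplicity of $R/J$. Bourbaki degree: let $\nu$ be a minimal generator of $\mathrm{Syz}(J)$ of degree $e$. If $J$ is perfect of height two (i.e. $\mathrm{ht}(J)=2$ and $R/J$ is Cohen--Macaulay), put $\mathrm{Bour}(J)=0$. Otherwise $\mathrm{Syz}(J)/R\nu$ is isomorphic, up to shift, to an unmixed homogeneous ideal $I_\nu\subseteq R$ of height $2$, and $\mathrm{Bour}(J)=\deg(R/I_\nu)$. This is independent of $\nu$, and in all cases $\mathrm{Bour}(J)=d^2-ed+e^2-\deg(R/J)$. *)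

theory Defs
  imports
    "HOL-Analysis.Cartesian_Space"
    "HOL-Library.Poly_Mapping"
    "HOL-Library.Extended_Nat"
    "HOL-Computational_Algebra.Polynomial"
begin

section \<open>Ideals, height, Cohen--Macaulay quotients\<close>

abbreviation is_ideal :: "'a::comm_ring_1 set \<Rightarrow> bool" where
  "is_ideal \<equiv> module.subspace (*)"

abbreviation ideal_gen :: "'a::comm_ring_1 set \<Rightarrow> 'a set" where
  "ideal_gen \<equiv> module.span (*)"

definition is_prime :: "'a::comm_ring_1 set \<Rightarrow> bool" where
  "is_prime P \<longleftrightarrow> is_ideal P \<and> P \<noteq> UNIV \<and> (\<forall>a b. a * b \<in> P \<longrightarrow> a \<in> P \<or> b \<in> P)"

definition is_maximal :: "'a::comm_ring_1 set \<Rightarrow> bool" where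
  "is_maximal M \<longleftrightarrow> is_ideal M \<and> M \<noteq> UNIV \<and> (\<forall>I. is_ideal I \<and> M \<subseteq> I \<longrightarrow> I = M \<or> I = UNIV)"

text \<open>For a prime \<open>P\<close> containing the ideal \<open>J\<close> this is the height of \<open>P/J\<close> in \<open>R/J\<close>.\<close>

definition prime_height_over :: "'a::comm_ring_1 set \<Rightarrow> 'a set \<Rightarrow> enat" where
  "prime_height_over J P =
     Sup {enat m | m. \<exists>c. (\<forall>i\<le>m. is_prime (c i)) \<and> (\<forall>i<m. c i \<subset> c (Suc i)) \<and> J \<subseteq> c 0 \<and> c m = P}"

definition height :: "'a::comm_ring_1 set \<Rightarrow> enat" where
  "height I = Inf {prime_height_over {0} P | P. is_prime P \<and> I \<subseteq> P}"

definition associated_primes :: "'a::comm_ring_1 set \<Rightarrow> 'a set set" where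
  "associated_primes I = {P. is_prime P \<and> (\<exists>g. P = {r. r * g \<in> I})}"

definition unmixed :: "'a::comm_ring_1 set \<Rightarrow> bool" where
  "unmixed I \<longleftrightarrow> (\<forall>P\<in>associated_primes I. height P = height I)"

definition regular_sequence_mod :: "'a::comm_ring_1 set \<Rightarrow> 'a list \<Rightarrow> bool" where
  "regular_sequence_mod J ys \<longleftrightarrow>
     (\<forall>i<length ys. \<forall>g. ys ! i * g \<in> ideal_gen (J \<union> set (take i ys)) \<longrightarrow>
        g \<in> ideal_gen (J \<union> set (take i ys))) \<and>
     ideal_gen (J \<union> set ys) \<noteq> UNIV"

definition grade_mod :: "'a::comm_ring_1 set \<Rightarrow> 'a set \<Rightarrow> enat" where
  "grade_mod J M = Sup {enat (length ys) | ys. set ys \<subseteq> M \<and> regular_sequence_mod J ys}"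

text \<open>\<open>R/J\<close> is Cohen--Macaulay, in the form that avoids localisation: the grade of each maximal
  ideal on \<open>R/J\<close> (which is the depth of the localisation there) equals its height in \<open>R/J\<close>.\<close>

definition cohen_macaulay_quotient :: "'a::comm_ring_1 set \<Rightarrow> bool" where
  "cohen_macaulay_quotient J \<longleftrightarrow>
     (\<forall>M. is_maximal M \<and> J \<subseteq> M \<longrightarrow> grade_mod J M = prime_height_over J M)"

definition perfect_height_two :: "'a::comm_ring_1 set \<Rightarrow> bool" where
  "perfect_height_two J \<longleftrightarrow> height J = 2 \<and> cohen_macaulay_quotient J"

section \<open>The standard graded polynomial ring\<close>

text \<open>\<open>k[x\<^sub>1,\<dots>,x\<^sub>n]\<close>, with variables indexed by a finite type \<open>'n\<close> (so \<open>n = CARD('n)\<close>):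
  finitely supported functions from exponent vectors to coefficients, with convolution as product.\<close>

type_synonym ('n, 'k) pring = "('n \<Rightarrow>\<^sub>0 nat) \<Rightarrow>\<^sub>0 'k"

text \<open>Degrees are integers so that shifts can be written as they are; the forms of
  negative degree are just \<open>0\<close>.\<close>

definition forms :: "int \<Rightarrow> ('n::finite, 'k::field) pring set" where
  "forms t = {p. \<forall>m\<in>Poly_Mapping.keys p. int (\<Sum>i\<in>UNIV. Poly_Mapping.lookup m i) = t}"

definition irrelevant :: "('n::finite, 'k::field) pring set" where
  "irrelevant = {p. Poly_Mapping.lookup p 0 = 0}"

definition homogeneous_ideal :: "('n::finite, 'k::field) pring set \<Rightarrow> bool" where
  "homogeneous_ideal I \<longleftrightarrow> (\<exists>G \<subseteq> (\<Union>t. forms t). I = ideal_gen G)"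

definition pscale :: "'k::field \<Rightarrow> ('n::finite, 'k) pring \<Rightarrow> ('n, 'k) pring" where
  "pscale c p = Poly_Mapping.single 0 c * p"

definition hilbert_function :: "('n::finite, 'k::field) pring set \<Rightarrow> nat \<Rightarrow> nat" where
  "hilbert_function I t =
     vector_space.dim pscale (forms (int t) :: ('n, 'k) pring set)
     - vector_space.dim pscale (I \<inter> forms (int t))"

definition hilbert_polynomial :: "('n::finite, 'k::field) pring set \<Rightarrow> rat poly" where
  "hilbert_polynomial I =
     (THE P. \<exists>t0. \<forall>t\<ge>t0. of_nat (hilbert_function I t) = poly P (of_nat t))"

text \<open>\<open>deg(R/I)\<close> for a homogeneous ideal \<open>I\<close>; the second case is the length of \<open>R/I\<close>, when that
  is finite.\<close>

definition multiplicity_quotient :: "('n::finite, 'k::field) pring set \<Rightarrow> rat" where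
  "multiplicity_quotient I =
     (let P = hilbert_polynomial I in
      if P \<noteq> 0 then fact (degree P) * lead_coeff P
      else (\<Sum>t | hilbert_function I t \<noteq> 0. of_nat (hilbert_function I t)))"

section \<open>Syzygies of three forms and the Bourbaki degree\<close>

text \<open>The grading on \<open>R\<^sup>3\<close> is the standard one, all basis vectors having degree \<open>0\<close>.\<close>

definition vforms :: "int \<Rightarrow> (('n::finite, 'k::field) pring ^ 3) set" where
  "vforms t = {a. \<forall>i. a $ i \<in> forms t}"

abbreviation submodule_gen :: "('a::comm_ring_1 ^ 3) set \<Rightarrow> ('a ^ 3) set" where
  "submodule_gen \<equiv> module.span (*s)"

definition ideal_of :: "'a::comm_ring_1 ^ 3 \<Rightarrow> 'a set" where
  "ideal_of f = ideal_gen (range (($) f))"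

definition syz :: "'a::comm_ring_1 ^ 3 \<Rightarrow> ('a ^ 3) set" where
  "syz f = {a. (\<Sum>i\<in>UNIV. a $ i * f $ i) = 0}"

definition indeg_syz :: "('n::finite, 'k::field) pring ^ 3 \<Rightarrow> nat" where
  "indeg_syz f = (LEAST t. \<exists>a \<in> syz f \<inter> vforms (int t). a \<noteq> 0)"

definition minimal_generator ::
  "(('n::finite, 'k::field) pring ^ 3) set \<Rightarrow> ('n, 'k) pring ^ 3 \<Rightarrow> bool" where
  "minimal_generator S \<nu> \<longleftrightarrow>
     (\<exists>G \<subseteq> (\<Union>t. vforms t). submodule_gen G = S \<and> (\<forall>g\<in>G. submodule_gen (G - {g}) \<noteq> S) \<and> \<nu> \<in> G)"

text \<open>A graded isomorphism \<open>Syz(f)/R\<nu> \<cong> I\<close> up to a shift \<open>s\<close> is given as a surjective \<open>R\<close>-linear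
  map \<open>\<phi> : Syz(f) \<rightarrow> I\<close> with kernel \<open>R\<nu>\<close> that raises degrees by \<open>s\<close>.\<close>

definition quotient_iso_up_to_shift ::
  "('n::finite, 'k::field) pring ^ 3 \<Rightarrow> ('n, 'k) pring ^ 3 \<Rightarrow> ('n, 'k) pring set \<Rightarrow> bool" where
  "quotient_iso_up_to_shift f \<nu> I \<longleftrightarrow>
     (\<exists>\<phi> s.
        (\<forall>a\<in>syz f. \<forall>b\<in>syz f. \<phi> (a + b) = \<phi> a + \<phi> b) \<and>
        (\<forall>r. \<forall>a\<in>syz f. \<phi> (r *s a) = r * \<phi> a) \<and>
        \<phi> ` syz f = I \<and>
        {a \<in> syz f. \<phi> a = 0} = range (\<lambda>r. r *s \<nu>) \<and>
        (\<forall>t. \<forall>a \<in> syz f \<inter> vforms t. \<phi> a \<in> forms (t + s)))"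

definition bourbaki_ideal ::
  "('n::finite, 'k::field) pring ^ 3 \<Rightarrow> ('n, 'k) pring ^ 3 \<Rightarrow> ('n, 'k) pring set \<Rightarrow> bool" where
  "bourbaki_ideal f \<nu> I \<longleftrightarrow>
     homogeneous_ideal I \<and> unmixed I \<and> height I = 2 \<and> quotient_iso_up_to_shift f \<nu> I"

text \<open>The Bourbaki degree of \<open>J = (f\<^sub>1,f\<^sub>2,f\<^sub>3)\<close>. The description is well-defined because
  \<open>deg(R/I\<^sub>\<nu>)\<close> depends neither on \<open>\<nu>\<close> nor on the choice of \<open>I\<^sub>\<nu>\<close>.\<close>

definition bour :: "('n::finite, 'k::field) pring ^ 3 \<Rightarrow> rat" where
  "bour f =
     (if perfect_height_two (ideal_of f) then 0
      else (THE b. \<exists>\<nu> I. minimal_generator (syz f) \<nu> \<and> \<nu> \<in> vforms (int (indeg_syz f)) \<and>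
                     bourbaki_ideal f \<nu> I \<and> b = multiplicity_quotient I))"

section \<open>Minimal graded free resolutions of length two\<close>

text \<open>The maps \<open>f\<close> (a row), \<open>A\<close> and \<open>p\<close> (a column) form a minimal graded free resolution
    \<open>0 \<rightarrow> R(-c) \<rightarrow> R(-b\<^sub>1) \<oplus> R(-b\<^sub>2) \<oplus> R(-b\<^sub>3) \<rightarrow> R(-d)\<^sup>3 \<rightarrow> J \<rightarrow> 0\<close>.
  Matrix entries \<open>R(-b) \<rightarrow> R(-a)\<close> of degree-preserving maps are forms of degree \<open>b - a\<close>; minimality
  says that the entries of the maps between the free modules lie in the irrelevant ideal.\<close>

definition minimal_resolution ::
  "int \<Rightarrow> int ^ 3 \<Rightarrow> int \<Rightarrow> ('n::finite, 'k::field) pring set \<Rightarrow>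
   ('n, 'k) pring ^ 3 \<Rightarrow> ('n, 'k) pring ^ 3 ^ 3 \<Rightarrow> ('n, 'k) pring ^ 3 \<Rightarrow> bool" where
  "minimal_resolution d b c J f A p \<longleftrightarrow>
     (\<forall>i. f $ i \<in> forms d) \<and>
     (\<forall>i j. A $ i $ j \<in> forms (b $ j - d) \<inter> irrelevant) \<and>
     (\<forall>j. p $ j \<in> forms (c - b $ j) \<inter> irrelevant) \<and>
     ideal_of f = J \<and>
     syz f = range (\<lambda>x. A *v x) \<and>
     {x. A *v x = 0} = range (\<lambda>r. r *s p) \<and>
     (\<forall>r. r *s p = 0 \<longrightarrow> r = 0)"

end

theory Submission
  imports Defs "HOL-Computational_Algebra.Primes"
begin

text \<open>
  Let \<open>p\<close> be the last map of the resolution. Tensoring the resolution with the Koszul complex of \<open>p\<close> shows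
  that this Koszul complex is exact in positive degrees, so \<open>p\<^sub>2, p\<^sub>3, p\<^sub>1\<close> is a regular sequence. If \<open>\<nu>\<close> is
  the first column of the middle matrix, then \<open>Syz(f)/R\<nu>\<close> is \<open>R\<^sup>2/R(p\<^sub>2,p\<^sub>3)\<close>, that is, the complete
  intersection ideal \<open>(p\<^sub>2,p\<^sub>3)\<close>, whose degree is the product in the theorem. An ideal isomorphic to it is
  \<open>h(p\<^sub>2,p\<^sub>3)\<close>, and height two forces \<open>h\<close> to be a unit; every other choice of \<open>\<nu>\<close> is the first
  column of another minimal resolution with the same degrees.

  \<open>R/J\<close> is not Cohen--Macaulay: some \<open>h\<close> satisfies \<open>J : h = (p\<^sub>1,p\<^sub>2,p\<^sub>3)\<close>, so \<open>J\<close> has an associated prime of height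
  at least three, which bounds the depth at the irrelevant ideal by \<open>n - 3\<close>, while \<open>J\<close> has height two and
  hence \<open>R/J\<close> has dimension at least \<open>n - 2\<close>.

  Dimension theory is replaced by counting: a chain of \<open>m + 1\<close> primes whose top member contains
  no nonzero polynomial in \<open>b\<close> of the variables satisfies \<open>m + b \<le> n\<close>. Heights are then computed by
  making generators monic through linear changes of coordinates.
\<close>

section \<open>Ideals and prime chains\<close>

text \<open>Dimension is estimated in two opposite directions. Upper bounds for chains come from
  counting polynomials in boxes of exponents; this needs no grading and applies to every prime. A
  lower bound for the dimension of R/J must give a chain ending at the irrelevant ideal, where the
  depth is tested, and a prime of small height over J need not lie in that ideal. The growth of the
  Hilbert function is therefore used to pass to homogeneous primes.

  Monic generators link both to algebra: modulo a polynomial monic in one variable the ring is free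
  over the other variables, so annihilators of nonzero classes contain no nonzero polynomial in
  those variables. Characteristic zero provides the coordinate change, through a point whose
  coordinates are equal powers of distinct primes; values of monomials at these points are powers of
  distinct numbers, and a Vandermonde argument applies.

  That a vanishing first Koszul homology yields a regular sequence is a graded fact: it depends on
  the entries of \<open>p\<close> being forms without constant term.\<close>

interpretation idl: module "(*) :: 'a::comm_ring_1 \<Rightarrow> 'a \<Rightarrow> 'a"
  by unfold_locales (auto simp: algebra_simps)

declare idl.scale_scale [simp del]

lemma ideal_mult_right: "is_ideal I \<Longrightarrow> x \<in> I \<Longrightarrow> x * r \<in> I" for I :: "'a::comm_ring_1 set"
  using idl.subspace_scale[of I x r] by (simp add: mult.commute)

lemma ideal_eq_UNIV_iff: "is_ideal I \<Longrightarrow> I = UNIV \<longleftrightarrow> 1 \<in> I" for I :: "'a::comm_ring_1 set"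
  using idl.subspace_scale[of I 1] by auto

section \<open>Colon ideals and sums with a principal ideal\<close>

definition colon :: "'a::comm_ring_1 set \<Rightarrow> 'a \<Rightarrow> 'a set" where
  "colon I g = {r. r * g \<in> I}"

lemma in_colon_iff [simp]: "r \<in> colon I g \<longleftrightarrow> r * g \<in> I"
  by (simp add: colon_def)

lemma ideal_colon: assumes "is_ideal I" shows "is_ideal (colon I g)"
  by (rule idl.subspaceI)
    (simp_all add: idl.subspace_0[OF assms] idl.subspace_add[OF assms] idl.subspace_scale[OF assms]
      distrib_right mult.assoc)

lemma subset_colon: assumes "is_ideal I" shows "I \<subseteq> colon I g"
  by (rule subsetI) (simp add: ideal_mult_right[OF assms])

lemma colon_mono_mult: assumes "is_ideal I" shows "colon I g \<subseteq> colon I (r * g)"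
  by (rule subsetI) (simp add: mult.left_commute[of _ r] idl.subspace_scale[OF assms])

text \<open>The ideal \<open>I\<close> + (\<open>y\<close>), encoded through the multiplier of
  \<open>y\<close>. Iterated from \<open>{0}\<close>, it presents a finitely generated ideal by
  coefficients and matches the steps of a regular sequence.\<close>

definition adjoin :: "'a::comm_ring_1 set \<Rightarrow> 'a \<Rightarrow> 'a set" where
  "adjoin I y = {x. \<exists>k. x - k * y \<in> I}"

lemma adjoinI: "x - k * y \<in> I \<Longrightarrow> x \<in> adjoin I y"
  by (auto simp: adjoin_def)

lemma adjoinE:
  assumes "x \<in> adjoin I y" obtains k where "x - k * y \<in> I"
  using assms by (auto simp: adjoin_def)

lemma ideal_adjoin: assumes "is_ideal I" shows "is_ideal (adjoin I y)"
proof (rule idl.subspaceI)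
  show "0 \<in> adjoin I y" using idl.subspace_0[OF assms] by (auto intro: adjoinI[of _ 0])
next
  fix a b assume "a \<in> adjoin I y" "b \<in> adjoin I y"
  then obtain k l where "a - k * y \<in> I" "b - l * y \<in> I" by (auto simp: adjoin_def)
  then have "(a - k * y) + (b - l * y) \<in> I" using assms by (rule idl.subspace_add[rotated])
  then show "a + b \<in> adjoin I y" by (intro adjoinI[of _ "k + l"]) (simp add: algebra_simps)
next
  fix c a assume "a \<in> adjoin I y"
  then obtain k where "a - k * y \<in> I" by (auto simp: adjoin_def)
  then have "c * (a - k * y) \<in> I" using assms by (rule idl.subspace_scale[rotated])
  then show "c * a \<in> adjoin I y" by (intro adjoinI[of _ "c * k"]) (simp add: algebra_simps)
qed

lemma subset_adjoin: "I \<subseteq> adjoin I y"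
  by (auto intro: adjoinI[of _ 0])

lemma in_adjoin: "is_ideal I \<Longrightarrow> k * y \<in> adjoin I y"
  by (rule adjoinI[of _ k]) (simp add: idl.subspace_0)

lemma self_in_adjoin: "is_ideal I \<Longrightarrow> y \<in> adjoin I y"
  using in_adjoin[of I 1 y] by simp

lemma adjoin_least:
  assumes "is_ideal K" "I \<subseteq> K" "y \<in> K" shows "adjoin I y \<subseteq> K"
proof
  fix x assume "x \<in> adjoin I y"
  then obtain k where "x - k * y \<in> I" by (rule adjoinE)
  then have "(x - k * y) + k * y \<in> K"
    using assms by (intro idl.subspace_add idl.subspace_scale) auto
  then show "x \<in> K" by simp
qed

lemma ideal_gen_insert: "ideal_gen (insert y S) = adjoin (ideal_gen S) y"
  by (auto simp: adjoin_def idl.span_breakdown_eq)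

lemma prime_ideal: "is_prime P \<Longrightarrow> is_ideal P"
  and prime_proper: "is_prime P \<Longrightarrow> 1 \<notin> P"
  and primeD: "is_prime P \<Longrightarrow> a * b \<in> P \<Longrightarrow> a \<in> P \<or> b \<in> P"
  using ideal_eq_UNIV_iff[of P] by (auto simp: is_prime_def)

text \<open>The maximal condition, carried as a hypothesis so that the arguments about primes and
  colons run in any commutative ring; \<open>noetherian_pring\<close> supplies it.\<close>

definition noetherian :: "'a::comm_ring_1 itself \<Rightarrow> bool" where
  "noetherian _ \<longleftrightarrow> (\<forall>F :: 'a set set. F \<noteq> {} \<longrightarrow> (\<forall>I\<in>F. is_ideal I) \<longrightarrow>
     (\<exists>I\<in>F. \<forall>K\<in>F. I \<subseteq> K \<longrightarrow> K = I))"

lemma noetherian_max: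
  assumes "noetherian TYPE('a::comm_ring_1)" "I0 \<in> F" "\<And>I :: 'a set. I \<in> F \<Longrightarrow> is_ideal I"
  shows "\<exists>I\<in>F. \<forall>K\<in>F. I \<subseteq> K \<longrightarrow> K = I"
  using assms unfolding noetherian_def by blast

text \<open>Maximality is taken among the colons contained in \<open>M\<close>, not among the proper
  ones. The resulting associated prime then stays inside \<open>M\<close>, which replaces localising
  at \<open>M\<close>.\<close>

lemma exists_prime_colon:
  fixes I M :: "'a::comm_ring_1 set"
  assumes N: "noetherian TYPE('a)" and I: "is_ideal I" and M: "is_prime M" and w: "colon I w \<subseteq> M"
  shows "\<exists>r. is_prime (colon I (r * w)) \<and> colon I (r * w) \<subseteq> M"
proof -
  let ?F = "{colon I (r * w) | r. colon I (r * w) \<subseteq> M}"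
  have "colon I (1 * w) \<in> ?F" using w by (intro CollectI exI[of _ 1]) simp
  moreover have "\<And>K. K \<in> ?F \<Longrightarrow> is_ideal K" using ideal_colon[OF I] by blast
  ultimately have "\<exists>K\<in>?F. \<forall>K'\<in>?F. K \<subseteq> K' \<longrightarrow> K' = K" by (rule noetherian_max[OF N])
  then obtain K where K: "K \<in> ?F" and maxK: "\<forall>K'\<in>?F. K \<subseteq> K' \<longrightarrow> K' = K" ..
  note max = maxK[rule_format]
  from K obtain r where r: "K = colon I (r * w)" "K \<subseteq> M" by blast
  have "is_prime K" unfolding is_prime_def
  proof (intro conjI allI impI)
    show "is_ideal K" using r ideal_colon[OF I] by simp
    show "K \<noteq> UNIV" using r M prime_proper by blast
    fix a b assume ab: "a * b \<in> K"
    show "a \<in> K \<or> b \<in> K"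
    proof (rule ccontr)
      assume nab: "\<not> (a \<in> K \<or> b \<in> K)"
      let ?K = "colon I ((a * r) * w)"
      have "K \<subseteq> ?K" using colon_mono_mult[OF I, of "r * w" a] r by (simp add: mult.assoc)
      moreover have "b \<in> ?K" using ab r by (simp add: mult_ac)
      ultimately have "\<not> ?K \<subseteq> M" using max nab by blast
      then obtain s where s: "s \<in> ?K" "s \<notin> M" by blast
      \<comment> \<open>As \<open>s\<close> lies outside the prime \<open>M\<close>, multiplying by
        it keeps the colon inside \<open>M\<close>, while \<open>a\<close> now belongs to
        it.\<close>
      let ?L = "colon I ((s * r) * w)"
      have "?L \<subseteq> M"
      proof
        fix t assume "t \<in> ?L"
        then have "t * s \<in> K" using r by (simp add: mult_ac)
        then show "t \<in> M" using s r primeD[OF M, of t s] by blast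
      qed
      moreover have "K \<subseteq> ?L" using colon_mono_mult[OF I, of "r * w" s] r by (simp add: mult.assoc)
      moreover have "a \<in> ?L" using s by (simp add: mult_ac)
      ultimately show False using max nab by blast
    qed
  qed
  with r(2) show ?thesis unfolding r(1) by (intro exI[of _ r] conjI)
qed

section \<open>Chains of primes and heights\<close>

definition prime_chain :: "(nat \<Rightarrow> 'a::comm_ring_1 set) \<Rightarrow> nat \<Rightarrow> bool" where
  "prime_chain c m \<longleftrightarrow> (\<forall>i\<le>m. is_prime (c i)) \<and> (\<forall>i<m. c i \<subset> c (Suc i))"

lemma prime_chain_Suc:
  assumes "prime_chain c m" "is_prime Q" "c m \<subset> Q"
  shows "prime_chain (c(Suc m := Q)) (Suc m)"
  unfolding prime_chain_def
proof (intro conjI allI impI)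
  fix i assume "i \<le> Suc m"
  then show "is_prime ((c(Suc m := Q)) i)" using assms by (cases "i = Suc m") (simp_all add: prime_chain_def)
next
  fix i assume "i < Suc m"
  then show "(c(Suc m := Q)) i \<subset> (c(Suc m := Q)) (Suc i)"
    using assms by (cases "i = m") (simp_all add: prime_chain_def)
qed

lemma prime_chain_append:
  assumes c: "prime_chain c m" and e: "prime_chain e k" and eq: "c m = e 0"
  shows "prime_chain (\<lambda>i. if i \<le> m then c i else e (i - m)) (m + k)"
  unfolding prime_chain_def
proof (intro conjI allI impI)
  fix i assume "i \<le> m + k"
  then show "is_prime (if i \<le> m then c i else e (i - m))"
    using c e by (auto simp: prime_chain_def)
next
  fix i assume i: "i < m + k"
  have e': "e j \<subset> e (Suc j)" if "j < k" for j using e that by (simp add: prime_chain_def)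
  have c': "c j \<subset> c (Suc j)" if "j < m" for j using c that by (simp add: prime_chain_def)
  consider "i < m" | "i = m" | "i > m" by linarith
  then show "(if i \<le> m then c i else e (i - m)) \<subset> (if Suc i \<le> m then c (Suc i) else e (Suc i - m))"
  proof cases
    case 1 then show ?thesis using c' by simp
  next
    case 2 then show ?thesis using e'[of 0] eq i by simp
  next
    case 3 then show ?thesis using e'[of "i - m"] i by (simp add: Suc_diff_le less_diff_conv2)
  qed
qed

lemma prime_height_over_eq:
  "prime_height_over J P = Sup {enat m | m. \<exists>c. prime_chain c m \<and> J \<subseteq> c 0 \<and> c m = P}"
  unfolding prime_height_over_def prime_chain_def by (simp only: conj_assoc)

lemma prime_height_over_ge: "prime_chain c m \<Longrightarrow> J \<subseteq> c 0 \<Longrightarrow> enat m \<le> prime_height_over J (c m)"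
  unfolding prime_height_over_eq by (intro Sup_upper) blast

lemma prime_height_over_le:
  "(\<And>c m. prime_chain c m \<Longrightarrow> J \<subseteq> c 0 \<Longrightarrow> c m = P \<Longrightarrow> m \<le> k) \<Longrightarrow> prime_height_over J P \<le> enat k"
  unfolding prime_height_over_eq by (intro Sup_least) auto

lemma prime_contains_zero: "is_prime P \<Longrightarrow> {0} \<subseteq> P"
  using idl.subspace_0[OF prime_ideal] by blast

lemma height_le: "is_prime P \<Longrightarrow> I \<subseteq> P \<Longrightarrow> height I \<le> prime_height_over {0} P"
  unfolding height_def by (intro Inf_lower) blast

lemma height_ge:
  assumes "\<And>P. is_prime P \<Longrightarrow> I \<subseteq> P \<Longrightarrow> \<exists>c. prime_chain c k \<and> c k = P"
  shows "enat k \<le> height I"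
  unfolding height_def
proof (intro Inf_greatest, clarify)
  fix P assume "is_prime P" "I \<subseteq> P"
  then obtain c where "prime_chain c k" "c k = P" using assms by blast
  moreover then have "{0} \<subseteq> c 0" by (intro prime_contains_zero) (simp add: prime_chain_def)
  ultimately show "enat k \<le> prime_height_over {0} P" using prime_height_over_ge by blast
qed

section \<open>Primes avoiding a multiplicative set, and chains below a prime\<close>

lemma exists_prime_disjoint:
  fixes I S :: "'a::comm_ring_1 set"
  assumes N: "noetherian TYPE('a)" and I: "is_ideal I" and dis: "I \<inter> S = {}"
    and S: "1 \<in> S" "\<And>a b. a \<in> S \<Longrightarrow> b \<in> S \<Longrightarrow> a * b \<in> S"
  shows "\<exists>P. is_prime P \<and> I \<subseteq> P \<and> P \<inter> S = {}"
proof -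
  let ?F = "{K. is_ideal K \<and> I \<subseteq> K \<and> K \<inter> S = {}}"
  have "I \<in> ?F" using I dis by blast
  moreover have "\<And>K. K \<in> ?F \<Longrightarrow> is_ideal K" by blast
  ultimately have "\<exists>K\<in>?F. \<forall>K'\<in>?F. K \<subseteq> K' \<longrightarrow> K' = K" by (rule noetherian_max[OF N])
  then obtain K where K: "K \<in> ?F" and maxK: "\<forall>K'\<in>?F. K \<subseteq> K' \<longrightarrow> K' = K" ..
  note max = maxK[rule_format]
  have iK: "is_ideal K" using K by blast
  have "is_prime K" unfolding is_prime_def
  proof (intro conjI allI impI)
    show "is_ideal K" "K \<noteq> UNIV" using K S by auto
    fix a b assume ab: "a * b \<in> K"
    have meet: "\<exists>k j. k \<in> K \<and> k + j * x \<in> S" if "x \<notin> K" for x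
    proof -
      have "adjoin K x \<notin> ?F" using max[of "adjoin K x"] self_in_adjoin[OF iK, of x] that
          subset_adjoin[of K x] by blast
      then obtain y where "y \<in> adjoin K x" "y \<in> S"
        using ideal_adjoin[OF iK, of x] K subset_adjoin[of K x] by blast
      then show ?thesis by (metis adjoinE diff_add_cancel)
    qed
    show "a \<in> K \<or> b \<in> K"
    proof (rule ccontr)
      assume "\<not> (a \<in> K \<or> b \<in> K)"
      then obtain k j k' j' where kj: "k \<in> K" "k + j * a \<in> S" "k' \<in> K" "k' + j' * b \<in> S"
        using meet by blast
      have "(k + j * a) * (k' + j' * b) = (k' + j' * b) * k + (j * a) * k' + (j * j') * (a * b)"
        by (simp add: algebra_simps)
      also have "\<dots> \<in> K" 
        by (rule idl.subspace_add[OF iK idl.subspace_add[OF iK]]; rule idl.subspace_scale[OF iK]; fact)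
      finally show False using S(2)[OF kj(2,4)] K by blast
    qed
  qed
  then show ?thesis using K by blast
qed

text \<open>No product of a power of \<open>w\<close> with an element outside \<open>P\<close> lies
  in \<open>I\<close>. A prime over \<open>I\<close> avoiding all these products is contained in
  \<open>P\<close> and misses \<open>w\<close>. This turns regular sequences into chains of
  primes.\<close>

lemma prime_below_regular:
  fixes I P :: "'a::comm_ring_1 set"
  assumes N: "noetherian TYPE('a)" and I: "is_ideal I" and P: "is_prime P" "I \<subseteq> P" "w \<in> P"
    and reg: "\<And>g. w * g \<in> I \<Longrightarrow> g \<in> I"
  shows "\<exists>P'. is_prime P' \<and> I \<subseteq> P' \<and> P' \<subset> P"
proof -
  let ?S = "{s * w ^ k | s k. s \<notin> P}"
  have reg': "g \<in> I" if "w ^ k * g \<in> I" for k g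
    using that by (induction k) (auto intro: reg simp: mult.assoc)
  have "I \<inter> ?S = {}" using reg' P by (auto simp: mult.commute)
  moreover have "1 \<in> ?S" using prime_proper[OF P(1)] by (intro CollectI exI[of _ 1] exI[of _ 0]) simp
  moreover have "a * b \<in> ?S" if ab: "a \<in> ?S" "b \<in> ?S" for a b
  proof -
    obtain s k t l where "a = s * w ^ k" "b = t * w ^ l" "s \<notin> P" "t \<notin> P" using ab by blast
    then have "a * b = (s * t) * w ^ (k + l)" "s * t \<notin> P"
      using primeD[OF P(1)] by (auto simp: power_add mult_ac)
    then show ?thesis by blast
  qed
  ultimately obtain Q where Q: "is_prime Q" "I \<subseteq> Q" "Q \<inter> ?S = {}"
    using exists_prime_disjoint[OF N I, of ?S] by auto
  have "Q \<subseteq> P"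
  proof
    fix q assume "q \<in> Q"
    then have "q * w ^ 0 \<notin> ?S" using Q by auto
    then show "q \<in> P" by blast
  qed
  moreover have "1 * w ^ 1 \<in> ?S" using prime_proper[OF P(1)] by blast
  then have "w \<notin> Q" using Q by auto
  ultimately show ?thesis using Q P by blast
qed

lemma ideal_zero: "is_ideal {0 :: 'a::comm_ring_1}"
  by simp

lemma prime_chain_below_nonzero:
  fixes P :: "'a::comm_ring_1 set"
  assumes N: "noetherian TYPE('a)" and P: "is_prime P" "u \<in> P"
    and reg: "\<And>g. u * g = 0 \<Longrightarrow> g = 0"
  shows "\<exists>c. prime_chain c 1 \<and> c 1 = P"
proof -
  obtain P' where "is_prime P'" "P' \<subset> P"
    using prime_below_regular[OF N ideal_zero P(1) prime_contains_zero[OF P(1)] P(2)] reg by auto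
  then show ?thesis using P
    by (intro exI[of _ "\<lambda>i. if i = 0 then P' else P"]) (auto simp: prime_chain_def le_Suc_eq)
qed

lemma prime_chain_extend:
  assumes "is_prime P'" "P' \<subset> P" "is_prime P" "\<exists>c. prime_chain c k \<and> c k = P'"
  shows "\<exists>c. prime_chain c (Suc k) \<and> c (Suc k) = P"
  using assms prime_chain_Suc[of _ k P] by (metis fun_upd_same)

text \<open>The last element of the sequence is spent on a strictly smaller prime that still
  contains the earlier ones; repeating this gives one step of the chain per element.\<close>

lemma prime_chain_regular_pair:
  fixes P :: "'a::comm_ring_1 set"
  assumes N: "noetherian TYPE('a)" and P: "is_prime P" "u \<in> P" "v \<in> P"
    and u: "\<And>g. u * g = 0 \<Longrightarrow> g = 0"
    and v: "\<And>g. v * g \<in> adjoin {0} u \<Longrightarrow> g \<in> adjoin {0} u"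
  shows "\<exists>c. prime_chain c 2 \<and> c 2 = P"
proof -
  have i: "is_ideal (adjoin {0} u)" "adjoin {0} u \<subseteq> P"
    using P prime_contains_zero[OF P(1)] prime_ideal[OF P(1)]
    by (intro ideal_adjoin adjoin_least ideal_zero; simp)+
  obtain P' where P': "is_prime P'" "adjoin {0} u \<subseteq> P'" "P' \<subset> P"
    using prime_below_regular[OF N i(1) P(1) i(2) P(3) v] by auto
  have "u \<in> P'" using P' self_in_adjoin[OF ideal_zero] by blast
  from prime_chain_extend[OF P'(1,3) P(1) prime_chain_below_nonzero[OF N P'(1) this u]]
  show ?thesis by (simp add: numeral_2_eq_2)
qed

lemma prime_chain_regular_triple:
  fixes P :: "'a::comm_ring_1 set"
  assumes N: "noetherian TYPE('a)" and P: "is_prime P" "u \<in> P" "v \<in> P" "w \<in> P"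
    and u: "\<And>g. u * g = 0 \<Longrightarrow> g = 0"
    and v: "\<And>g. v * g \<in> adjoin {0} u \<Longrightarrow> g \<in> adjoin {0} u"
    and w: "\<And>g. w * g \<in> adjoin (adjoin {0} u) v \<Longrightarrow> g \<in> adjoin (adjoin {0} u) v"
  shows "\<exists>c. prime_chain c 3 \<and> c 3 = P"
proof -
  let ?I = "adjoin (adjoin {0} u) v"
  have i: "is_ideal ?I" "?I \<subseteq> P"
    using P prime_contains_zero[OF P(1)] prime_ideal[OF P(1)]
    by (intro ideal_adjoin adjoin_least ideal_zero; simp)+
  obtain P' where P': "is_prime P'" "?I \<subseteq> P'" "P' \<subset> P"
    using prime_below_regular[OF N i(1) P(1) i(2) P(4) w] by auto
  have "u \<in> P'" "v \<in> P'"
    using P' self_in_adjoin[OF ideal_zero] self_in_adjoin[OF ideal_adjoin[OF ideal_zero]]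
      subset_adjoin by blast+
  from prime_chain_extend[OF P'(1,3) P(1) prime_chain_regular_pair[OF N P'(1) this u v]]
  show ?thesis by (simp add: numeral_3_eq_3 numeral_2_eq_2)
qed

section \<open>Associated primes along a regular sequence\<close>

text \<open>In the localisation at \<open>M\<close>, some element with annihilator
  \<open>colon J g\<close> modulo \<open>J\<close> is not divisible by the regular element
  \<open>y\<close>, since repeated division would give an ascending chain of submodules. Its class
  modulo \<open>y\<close> is nonzero and is killed by both \<open>colon J g\<close> and
  \<open>y\<close>, so an associated prime above it is strictly larger.\<close>

lemma colon_prime_lift:
  fixes J M :: "'a::comm_ring_1 set"
  assumes N: "noetherian TYPE('a)" and J: "is_ideal J" and M: "is_prime M"
    and P: "is_prime (colon J g)" "colon J g \<subseteq> M"
    and y: "y \<in> M" "\<And>h. y * h \<in> J \<Longrightarrow> h \<in> J"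
  shows "\<exists>g'. is_prime (colon (adjoin J y) g') \<and> colon J g \<subset> colon (adjoin J y) g' \<and>
    colon (adjoin J y) g' \<subseteq> M"
proof -
  let ?P = "colon J g"
  let ?I = "adjoin J y"
  \<comment> \<open>\<open>L v\<close> is the contraction of the localisation at \<open>M\<close> of
    \<open>J\<close> + (\<open>v\<close>); its maximality stops the division by
    \<open>y\<close>.\<close>
  define L where "L = (\<lambda>v. {u. \<exists>s. s \<notin> M \<and> s * u \<in> adjoin J v})"
  have iI: "is_ideal ?I" by (rule ideal_adjoin[OF J])
  have idL: "is_ideal (L v)" for v
  proof (rule idl.subspaceI)
    note iv = ideal_adjoin[OF J, of v]
    show "0 \<in> L v" using idl.subspace_0[OF iv] prime_proper[OF M] by (auto simp: L_def)
    fix a b assume "a \<in> L v" "b \<in> L v"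
    then obtain s t where st: "s \<notin> M" "s * a \<in> adjoin J v" "t \<notin> M" "t * b \<in> adjoin J v"
      by (auto simp: L_def)
    have "(s * t) * (a + b) = t * (s * a) + s * (t * b)" by (simp add: algebra_simps)
    also have "\<dots> \<in> adjoin J v"
      by (rule idl.subspace_add[OF iv]; rule idl.subspace_scale[OF iv]; fact)
    finally show "a + b \<in> L v" using st primeD[OF M, of s t] unfolding L_def by blast
  next
    fix c a assume "a \<in> L v"
    then obtain s where s: "s \<notin> M" "s * a \<in> adjoin J v" by (auto simp: L_def)
    have "c * (s * a) \<in> adjoin J v" using s idl.subspace_scale[OF ideal_adjoin[OF J]] by blast
    then show "c * a \<in> L v" using s unfolding L_def by (auto simp: mult.left_commute)
  qed
  let ?F = "{L v | v. colon J v = ?P}"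
  have "L g \<in> ?F" by blast
  moreover have "\<And>K. K \<in> ?F \<Longrightarrow> is_ideal K" using idL by blast
  ultimately have "\<exists>K\<in>?F. \<forall>K'\<in>?F. K \<subseteq> K' \<longrightarrow> K' = K" by (rule noetherian_max[OF N])
  then obtain K where K: "K \<in> ?F" and maxK: "\<forall>K'\<in>?F. K \<subseteq> K' \<longrightarrow> K' = K" ..
  note max = maxK[rule_format]
  from K obtain v where v: "K = L v" "colon J v = ?P" by blast
  have "colon ?I v \<subseteq> M"
  proof
    fix s assume "s \<in> colon ?I v"
    then obtain k where k: "s * v - k * y \<in> J" by (auto elim: adjoinE)
    show "s \<in> M"
    proof (rule ccontr)
      assume s: "s \<notin> M"
      have Jr: "a - b \<in> J \<Longrightarrow> b \<in> J \<longleftrightarrow> a \<in> J" for a b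
        using idl.subspace_add[OF J, of "a - b" b] idl.subspace_diff[OF J, of a "a - b"] by auto
      \<comment> \<open>Dividing by \<open>y\<close> does not change the annihilator:
        \<open>y\<close> is regular modulo \<open>J\<close>, and \<open>s\<close> lies outside the
        prime.\<close>
      have ck: "colon J k = ?P"
      proof (intro set_eqI)
        fix r
        have "r * (s * v - k * y) \<in> J" using k J by (rule idl.subspace_scale[rotated])
        then have "r * s * v \<in> J \<longleftrightarrow> y * (r * k) \<in> J"
          using Jr[of "r * s * v" "y * (r * k)"] by (simp add: algebra_simps)
        also have "\<dots> \<longleftrightarrow> r * k \<in> J" using y(2) idl.subspace_scale[OF J, of "r * k" y] by blast
        finally have "r \<in> colon J k \<longleftrightarrow> r * s \<in> ?P" using v(2) by auto
        also have "\<dots> \<longleftrightarrow> r \<in> ?P"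
          using primeD[OF P(1), of r s] s P(2) ideal_mult_right[OF prime_ideal[OF P(1)], of r s] by blast
        finally show "r \<in> colon J k \<longleftrightarrow> r \<in> ?P" .
      qed
      have "L v \<subseteq> L k"
      proof
        fix u assume "u \<in> L v"
        then obtain t a where t: "t \<notin> M" "t * u - a * v \<in> J" by (auto simp: L_def elim!: adjoinE)
        have "s * (t * u - a * v) + a * (s * v - k * y) \<in> J"
          by (rule idl.subspace_add[OF J]; rule idl.subspace_scale[OF J]; fact)
        then have "(s * t) * u \<in> adjoin J k"
          by (intro adjoinI[of _ "a * y"]) (simp add: algebra_simps)
        then show "u \<in> L k" using s t primeD[OF M, of s t] unfolding L_def by blast
      qed
      then have "L k = L v" using max[of "L k"] ck v by blast
      \<comment> \<open>By maximality \<open>k\<close> is, up to a factor \<open>t\<close> outside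
        \<open>M\<close>, a multiple of \<open>v\<close>. Substituting gives
        (\<open>t * s - a * y\<close>) \<open>v\<close> in \<open>J\<close>, which forces
        \<open>t * s\<close> into \<open>M\<close>, as in Nakayama's lemma.\<close>
      moreover have "k \<in> L k" using self_in_adjoin[OF J, of k] prime_proper[OF M]
        unfolding L_def by (auto intro!: exI[of _ 1])
      ultimately obtain t a where t: "t \<notin> M" "t * k - a * v \<in> J" by (auto simp: L_def elim!: adjoinE)
      have "t * (s * v - k * y) + y * (t * k - a * v) \<in> J"
        by (rule idl.subspace_add[OF J]; rule idl.subspace_scale[OF J]; fact)
      then have "t * s - a * y \<in> colon J v" by (simp add: algebra_simps)
      then have "t * s - a * y \<in> M" using v P by blast
      moreover have "a * y \<in> M" using y prime_ideal[OF M] idl.subspace_scale by blast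
      ultimately have "t * s \<in> M"
        using idl.subspace_add[OF prime_ideal[OF M]] by fastforce
      then show False using primeD[OF M, of t s] s t by blast
    qed
  qed
  then obtain r where r: "is_prime (colon ?I (r * v))" "colon ?I (r * v) \<subseteq> M"
    using exists_prime_colon[OF N iI M] by blast
  have "?P \<subseteq> colon ?I (r * v)"
    using v(2) colon_mono_mult[OF J, of v r] subset_adjoin[of J y] by (auto simp: colon_def)
  moreover have "y \<in> colon ?I (r * v)"
    using in_adjoin[OF J, of "r * v" y] by (simp add: mult.commute)
  moreover have "y \<notin> ?P" using y(2)[of g] prime_proper[OF P(1)] by auto
  ultimately have "?P \<subset> colon ?I (r * v)" by blast
  with r show ?thesis by (intro exI[of _ "r * v"] conjI)
qed

text \<open>This is the bound of depth by the dimension of R/P for each associated prime P: every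
  member of the sequence lifts the current associated prime to a strictly larger one inside
  \<open>M\<close>.\<close>

lemma regular_sequence_prime_chain:
  fixes J M :: "'a::comm_ring_1 set"
  assumes N: "noetherian TYPE('a)" and J: "is_ideal J" and M: "is_prime M"
    and P: "is_prime (colon J g)" "colon J g \<subseteq> M"
    and ys: "set ys \<subseteq> M" "regular_sequence_mod J ys"
  shows "\<exists>c. prime_chain c (length ys) \<and> c 0 = colon J g"
proof -
  have "i \<le> length ys \<Longrightarrow> \<exists>c g'. prime_chain c i \<and> c 0 = colon J g \<and> c i \<subseteq> M \<and>
     c i = colon (ideal_gen (J \<union> set (take i ys))) g'" for i
  proof (induction i)
    case 0
    have "ideal_gen J = J" using J by (simp only: idl.span_eq_iff)
    then show ?case using P
      by (intro exI[of _ "\<lambda>_. colon J g"] exI[of _ g]) (simp add: prime_chain_def del: in_colon_iff idl.span_eq_iff)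
  next
    case (Suc i)
    let ?J = "ideal_gen (J \<union> set (take i ys))"
    obtain c g' where c: "prime_chain c i" "c 0 = colon J g" "c i \<subseteq> M" "c i = colon ?J g'"
      using Suc by auto
    have i: "i < length ys" using Suc by simp
    have eq: "ideal_gen (J \<union> set (take (Suc i) ys)) = adjoin ?J (ys ! i)"
      using i by (simp add: take_Suc_conv_app_nth ideal_gen_insert)
    have "is_prime (colon ?J g')" using c by (auto simp: prime_chain_def)
    moreover have "ys ! i \<in> M" using ys i by auto
    moreover have "h \<in> ?J" if "ys ! i * h \<in> ?J" for h
      using ys(2) i that by (auto simp: regular_sequence_mod_def)
    ultimately obtain g'' where g'': "is_prime (colon (adjoin ?J (ys ! i)) g'')"
      "colon ?J g' \<subset> colon (adjoin ?J (ys ! i)) g''" "colon (adjoin ?J (ys ! i)) g'' \<subseteq> M"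
      using colon_prime_lift[OF N _ M, of ?J g' "ys ! i"] c by auto
    define Q where "Q = colon (adjoin ?J (ys ! i)) g''"
    define e where "e = c(Suc i := Q)"
    have "prime_chain e (Suc i)" unfolding e_def
      using g'' c by (intro prime_chain_Suc) (simp_all add: Q_def)
    moreover have "e 0 = c 0" "e (Suc i) = Q" by (simp_all add: e_def)
    moreover have "Q = colon (ideal_gen (J \<union> set (take (Suc i) ys))) g''" "Q \<subseteq> M"
      using g'' by (simp_all add: Q_def eq)
    ultimately show ?case using c(2)
      by (intro exI[of _ e] exI[of _ g''] conjI) simp_all
  qed
  from this[of "length ys"] show ?thesis by auto
qed

section \<open>Polynomials: coefficients, components, Noetherianity\<close>

abbreviation coef :: "('a \<Rightarrow>\<^sub>0 'b::zero) \<Rightarrow> 'a \<Rightarrow> 'b" where "coef \<equiv> Poly_Mapping.lookup"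
abbreviation mono_keys :: "('a \<Rightarrow>\<^sub>0 'b::zero) \<Rightarrow> 'a set" where "mono_keys \<equiv> Poly_Mapping.keys"
abbreviation mon :: "'a \<Rightarrow> 'b::zero \<Rightarrow> 'a \<Rightarrow>\<^sub>0 'b" where "mon \<equiv> Poly_Mapping.single"

lemma coef_notin_keys: "m \<notin> mono_keys p \<Longrightarrow> coef p m = 0"
  by (simp add: in_keys_iff)

lemma poly_as_sum:
  fixes p :: "'a \<Rightarrow>\<^sub>0 'b::comm_monoid_add"
  assumes "finite K" "mono_keys p \<subseteq> K" shows "p = (\<Sum>m\<in>K. mon m (coef p m))"
proof (rule poly_mapping_eqI)
  fix k
  have "coef (\<Sum>m\<in>K. mon m (coef p m)) k = (\<Sum>m\<in>K. if m = k then coef p k else 0)"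
    by (auto simp: lookup_sum lookup_single when_def intro!: sum.cong)
  also have "\<dots> = coef p k" using assms coef_notin_keys[of k p] by (auto simp: sum.delta')
  finally show "coef p k = coef (\<Sum>m\<in>K. mon m (coef p m)) k" by simp
qed

lemma coef_mult:
  fixes p q :: "'a::comm_monoid_add \<Rightarrow>\<^sub>0 'b::comm_ring_1"
  assumes "finite A" "mono_keys p \<subseteq> A" "finite B" "mono_keys q \<subseteq> B"
  shows "coef (p * q) k = (\<Sum>l\<in>A. \<Sum>r\<in>B. if l + r = k then coef p l * coef q r else 0)"
proof -
  have "p * q = (\<Sum>l\<in>A. mon l (coef p l)) * (\<Sum>r\<in>B. mon r (coef q r))"
    using poly_as_sum[OF assms(1,2)] poly_as_sum[OF assms(3,4)] by simp
  also have "\<dots> = (\<Sum>l\<in>A. \<Sum>r\<in>B. mon (l + r) (coef p l * coef q r))"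
    by (simp add: sum_product mult_single)
  finally show ?thesis by (simp add: lookup_sum lookup_single when_def)
qed

text \<open>If only one pair of exponents contributes, nothing can cancel. Leading terms, constant
  terms and pure powers of a variable are all treated through this case.\<close>

lemma coef_mult_unique:
  fixes p q :: "'a::comm_monoid_add \<Rightarrow>\<^sub>0 'b::comm_ring_1"
  assumes "\<And>l r. l \<in> mono_keys p \<Longrightarrow> r \<in> mono_keys q \<Longrightarrow> l + r = a + b \<Longrightarrow> l = a \<and> r = b"
  shows "coef (p * q) (a + b) = coef p a * coef q b"
proof -
  have "coef (p * q) (a + b) =
      (\<Sum>l\<in>mono_keys p. \<Sum>r\<in>mono_keys q. if l + r = a + b then coef p l * coef q r else 0)"
    by (rule coef_mult) auto
  also have "\<dots> = (\<Sum>l\<in>mono_keys p. \<Sum>r\<in>mono_keys q. if l = a then if r = b then coef p a * coef q b else 0 else 0)"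
    using assms by (intro sum.cong refl) auto
  also have "\<dots> = (\<Sum>l\<in>mono_keys p. if l = a then (\<Sum>r\<in>mono_keys q. if r = b then coef p a * coef q b else 0) else 0)"
    by (intro sum.cong refl) auto
  also have "\<dots> = coef p a * coef q b" by (auto simp: sum.delta' coef_notin_keys)
  finally show ?thesis .
qed

lemma coef_mono_mult:
  fixes q :: "'a::cancel_comm_monoid_add \<Rightarrow>\<^sub>0 'b::comm_ring_1"
  shows "coef (mon m c * q) (m + k) = c * coef q k"
  by (rule trans[OF coef_mult_unique]) (auto split: if_splits)

lemma keys_multE:
  assumes "m \<in> mono_keys (p * q)"
  obtains a b where "m = a + b" "a \<in> mono_keys p" "b \<in> mono_keys q"
  using assms keys_mult[of p q] by blast

lemma keys_diff': "mono_keys (p - q) \<subseteq> mono_keys p \<union> mono_keys q"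
  for p q :: "'a \<Rightarrow>\<^sub>0 'b::ab_group_add"
  by (auto simp: in_keys_iff lookup_minus)

lemma keys_uminus': "mono_keys (- p) = mono_keys p" for p :: "'a \<Rightarrow>\<^sub>0 'b::ab_group_add"
  by (auto simp: in_keys_iff)

section \<open>A monomial order and Noetherianity\<close>

definition prime_var :: "'n::finite \<Rightarrow> nat" where
  "prime_var = (SOME f. inj f \<and> (\<forall>i. prime (f i)))"

lemma prime_var: "inj (prime_var :: 'n::finite \<Rightarrow> nat)" "prime (prime_var (i :: 'n))"
proof -
  obtain A :: "nat set" where A: "A \<subseteq> {p. prime p}" "finite A" "card A = CARD('n)"
    using infinite_arbitrarily_large[OF primes_infinite] by blast
  then obtain f :: "'n \<Rightarrow> nat" where f: "bij_betw f UNIV A"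
    using finite_same_card_bij[of "UNIV :: 'n set" A] by auto
  have "\<exists>f :: 'n \<Rightarrow> nat. inj f \<and> (\<forall>i. prime (f i))"
    using f A by (intro exI[of _ f]) (auto simp: bij_betw_def)
  from someI_ex[OF this] show "inj (prime_var :: 'n \<Rightarrow> nat)" "prime (prime_var i)"
    by (auto simp: prime_var_def)
qed

text \<open>Unique factorisation makes \<open>mval\<close> an additive total order on the exponent vectors, of order
  type \<open>\<omega>\<close>, without any order on the index type.\<close>

definition mval :: "('n::finite \<Rightarrow>\<^sub>0 nat) \<Rightarrow> nat" where
  "mval m = (\<Prod>i\<in>UNIV. prime_var i ^ coef m i)"

lemma mval_pos: "mval m > 0"
  using prime_var(2) by (auto simp: mval_def intro!: prod_pos dest: prime_gt_0_nat)

lemma mval_add: "mval (a + b) = mval a * mval b"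
  by (simp add: mval_def lookup_add power_add prod.distrib)

lemma mval_inj: "mval a = mval b \<longleftrightarrow> a = b" for a b :: "'n::finite \<Rightarrow>\<^sub>0 nat"
proof
  assume eq: "mval a = mval b"
  have val: "multiplicity (prime_var j) (mval m) = coef m j" for m :: "'n \<Rightarrow>\<^sub>0 nat" and j
  proof -
    have "mval m = (\<Prod>p\<in>range (prime_var :: 'n \<Rightarrow> nat). p ^ coef m (inv prime_var p))"
      by (simp add: mval_def prod.reindex prime_var(1) inv_f_f[OF prime_var(1)])
    also have "multiplicity (prime_var j) \<dots> = coef m (inv prime_var (prime_var j))"
      by (subst multiplicity_prod_prime_powers) (auto simp: prime_var(2))
    finally show ?thesis by (simp add: inv_f_f[OF prime_var(1)])
  qed
  show "a = b" by (rule poly_mapping_eqI) (metis val eq)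
qed auto

definition lead :: "('n::finite, 'k::field) pring \<Rightarrow> ('n \<Rightarrow>\<^sub>0 nat) \<Rightarrow> bool" where
  "lead p m \<longleftrightarrow> m \<in> mono_keys p \<and> (\<forall>l\<in>mono_keys p. mval l \<le> mval m)"

lemma exists_lead: assumes "p \<noteq> 0" shows "\<exists>m. lead p m"
proof -
  have "mono_keys p \<noteq> {}" using assms by simp
  then have "Max (mval ` mono_keys p) \<in> mval ` mono_keys p" by (intro Max_in) auto
  then obtain m where "m \<in> mono_keys p" "mval m = Max (mval ` mono_keys p)" by auto
  then show ?thesis by (auto simp: lead_def intro!: exI[of _ m])
qed

lemma lead_mult:
  assumes "lead p a" "lead q b" shows "coef (p * q) (a + b) = coef p a * coef q b" "lead (p * q) (a + b)"
proof -
  have "l = a \<and> r = b" if "l \<in> mono_keys p" "r \<in> mono_keys q" "l + r = a + b" for l r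
  proof -
    have le: "mval l \<le> mval a" "mval r \<le> mval b" using assms that by (auto simp: lead_def)
    have "mval l * mval r = mval a * mval b" using that by (metis mval_add)
    then have "mval l = mval a \<and> mval r = mval b"
      using le mval_pos[of l] mval_pos[of r] mval_pos[of a] mval_pos[of b]
      by (metis mult_le_less_imp_less mult_less_le_imp_less less_le not_less_iff_gr_or_eq)
    then show ?thesis by (simp add: mval_inj)
  qed
  then show c: "coef (p * q) (a + b) = coef p a * coef q b" by (rule coef_mult_unique)
  show "lead (p * q) (a + b)" unfolding lead_def
  proof (intro conjI ballI)
    show "a + b \<in> mono_keys (p * q)" using c assms by (simp add: in_keys_iff lead_def)
    fix l assume "l \<in> mono_keys (p * q)"
    then show "mval l \<le> mval (a + b)"
      using assms by (elim keys_multE) (auto simp: mval_add lead_def intro!: mult_mono)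
  qed
qed

lemma pring_mult_eq_0_iff: "p * q = 0 \<longleftrightarrow> p = 0 \<or> q = 0" for p q :: "('n::finite, 'k::field) pring"
proof
  assume pq: "p * q = 0"
  show "p = 0 \<or> q = 0"
  proof (rule ccontr)
    assume "\<not> (p = 0 \<or> q = 0)"
    then obtain a b where "lead p a" "lead q b" using exists_lead by meson
    then show False using lead_mult(2)[of p a q b] pq by (auto simp: lead_def)
  qed
qed auto

lemma pring_mult_left_cancel: "p \<noteq> 0 \<Longrightarrow> p * q = p * r \<longleftrightarrow> q = r" for p q r :: "('n::finite, 'k::field) pring"
  using pring_mult_eq_0_iff[of p "q - r"] by (auto simp: right_diff_distrib)

lemma prime_zero_ideal: "is_prime ({0} :: ('n::finite, 'k::field) pring set)"
proof -
  have "{0 :: ('n, 'k) pring} \<noteq> UNIV" by (metis UNIV_I singletonD zero_neq_one)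
  then show ?thesis by (simp add: is_prime_def pring_mult_eq_0_iff)
qed

lemma nat_mono_subseq: "\<exists>r :: nat \<Rightarrow> nat. strict_mono r \<and> (\<forall>m n. m \<le> n \<longrightarrow> g (r m) \<le> g (r n))" for g :: "nat \<Rightarrow> nat"
proof -
  obtain r where r: "strict_mono r" "monoseq (\<lambda>n. g (r n))" using seq_monosub by blast
  from r(2) consider "\<forall>m n. m \<le> n \<longrightarrow> g (r m) \<le> g (r n)" | "\<forall>m n. m \<le> n \<longrightarrow> g (r n) \<le> g (r m)"
    unfolding monoseq_def by blast
  then show ?thesis
  proof cases
    case 1 then show ?thesis using r by blast
  next
    case 2
    have "\<exists>N. \<forall>n. g (r N) \<le> g (r n)"
      using ex_has_least_nat[of "\<lambda>_. True" undefined "\<lambda>n. g (r n)"] by auto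
    then obtain N where N: "\<And>n. g (r N) \<le> g (r n)" by blast
    have "g (r (N + n)) = g (r N)" for n using 2 N[of "N + n"] by (simp add: antisym)
    then show ?thesis using r(1)
      by (intro exI[of _ "\<lambda>n. r (N + n)"]) (auto simp: strict_mono_def)
  qed
qed

text \<open>Pass to a subsequence on which one coordinate is monotone, then repeat for each of the
  finitely many variables; the first two terms that remain are comparable.\<close>

lemma dickson:
  fixes s :: "nat \<Rightarrow> 'n::finite \<Rightarrow>\<^sub>0 nat"
  shows "\<exists>i j l. i < j \<and> s j = s i + l"
proof -
  have "\<exists>r :: nat \<Rightarrow> nat. strict_mono r \<and> (\<forall>x\<in>A. \<forall>m n. m \<le> n \<longrightarrow> coef (s (r m)) x \<le> coef (s (r n)) x)"
    if "finite A" for A :: "'n set"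
    using that
  proof (induction A)
    case empty then show ?case by (intro exI[of _ id]) (simp add: strict_mono_def)
  next
    case (insert x A)
    then obtain r :: "nat \<Rightarrow> nat" where r: "strict_mono r" "\<And>x m n. x \<in> A \<Longrightarrow> m \<le> n \<Longrightarrow> coef (s (r m)) x \<le> coef (s (r n)) x"
      by blast
    obtain r' :: "nat \<Rightarrow> nat" where r': "strict_mono r'" "\<And>m n. m \<le> n \<Longrightarrow> coef (s (r (r' m))) x \<le> coef (s (r (r' n))) x"
      using nat_mono_subseq[of "\<lambda>n. coef (s (r n)) x"] by blast
    have "r' m \<le> r' n" if "m \<le> n" for m n using r'(1) that by (simp add: strict_mono_less_eq)
    then have "coef (s (r (r' m))) y \<le> coef (s (r (r' n))) y" if "y \<in> insert x A" "m \<le> n" for y m n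
      using r(2) r'(2) that by blast
    moreover have "strict_mono (\<lambda>n. r (r' n))" using r(1) r'(1) by (simp add: strict_mono_def)
    ultimately show ?case by (intro exI[of _ "\<lambda>n. r (r' n)"]) blast
  qed
  from this[of UNIV] obtain r :: "nat \<Rightarrow> nat" where r: "strict_mono r" "\<And>x m n. m \<le> n \<Longrightarrow> coef (s (r m)) x \<le> coef (s (r n)) x"
    by auto
  have "s (r 1) = s (r 0) + (s (r 1) - s (r 0))"
    using r(2)[of 0 1] by (intro poly_mapping_eqI) (simp add: lookup_add lookup_minus)
  moreover have "r 0 < r 1" using r(1) by (simp add: strict_mono_def)
  ultimately show ?thesis by blast
qed

definition leads :: "('n::finite, 'k::field) pring set \<Rightarrow> ('n \<Rightarrow>\<^sub>0 nat) set" where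
  "leads I = {m. \<exists>p\<in>I. lead p m}"

lemma leads_add: assumes "is_ideal I" "m \<in> leads I" shows "m + l \<in> leads I"
proof -
  obtain p where p: "p \<in> I" "lead p m" using assms by (auto simp: leads_def)
  have "lead (mon l 1 :: ('a, 'b) pring) l" by (simp add: lead_def)
  from lead_mult(2)[OF p(2) this] show ?thesis
    using ideal_mult_right[OF assms(1) p(1)] by (auto simp: leads_def)
qed

text \<open>If no new leading exponent appeared, leading terms of elements of \<open>K\<close> could
  be cancelled by elements of \<open>I\<close>. The process ends because \<open>mval\<close> takes
  values in the natural numbers.\<close>

lemma leads_strict:
  fixes I K :: "('n::finite, 'k::field) pring set"
  assumes I: "is_ideal I" and K: "is_ideal K" and sub: "I \<subset> K"
  shows "\<exists>m. m \<in> leads K \<and> m \<notin> leads I"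
proof (rule ccontr)
  assume no: "\<not> ?thesis"
  have "lead p m \<Longrightarrow> p \<in> K \<Longrightarrow> p \<in> I" for p m
  proof (induction "mval m" arbitrary: p m rule: less_induct)
    case less
    then obtain q where q: "q \<in> I" "lead q m" using no by (auto simp: leads_def)
    define c where "c = coef p m / coef q m"
    define p' where "p' = p - mon 0 c * q"
    have cq: "mon 0 c * q \<in> I" using q(1) I idl.subspace_scale by blast
    have c0: "coef (mon 0 c * q) l = c * coef q l" for l
      using coef_mono_mult[of 0 c q l] by simp
    have "coef q m \<noteq> 0" using q by (simp add: lead_def in_keys_iff)
    then have "c * coef q m = coef p m" by (simp add: c_def)
    then have m0: "coef p' m = 0" by (simp add: p'_def lookup_minus c0)
    have p'K: "p' \<in> K" using less.prems cq sub idl.subspace_diff[OF K] by (auto simp: p'_def)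
    have "p' \<in> I"
    proof (cases "p' = 0")
      case True then show ?thesis using idl.subspace_0[OF I] by simp
    next
      case False
      then obtain l where l: "lead p' l" using exists_lead by blast
      then have "l \<in> mono_keys p'" by (simp add: lead_def)
      then have "l \<noteq> m" "coef p l \<noteq> 0 \<or> coef q l \<noteq> 0"
        using m0 by (auto simp: p'_def in_keys_iff lookup_minus c0)
      then have "mval l \<le> mval m" using less.prems q by (auto simp: lead_def in_keys_iff)
      then have "mval l < mval m" using \<open>l \<noteq> m\<close> mval_inj[of l m] by linarith
      then show ?thesis using less.hyps l p'K by blast
    qed
    then have "p' + mon 0 c * q \<in> I" using cq idl.subspace_add[OF I] by blast
    then show ?case by (simp add: p'_def)
  qed
  then have "K \<subseteq> I" using exists_lead idl.subspace_0[OF I] by (metis subsetI)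
  then show False using sub by blast
qed

text \<open>Each strict step of an ascending chain contributes an exponent that is leading in the
  next ideal but not in the present one. By Dickson's lemma a later exponent is a multiple of an
  earlier one, hence was already leading.\<close>

lemma noetherian_pring: "noetherian TYPE(('n::finite, 'k::field) pring)"
  unfolding noetherian_def
proof (intro allI impI, rule ccontr)
  fix F :: "('n, 'k) pring set set"
  assume F: "F \<noteq> {}" "\<forall>I\<in>F. is_ideal I" and no: "\<not> (\<exists>I\<in>F. \<forall>K\<in>F. I \<subseteq> K \<longrightarrow> K = I)"
  have "\<exists>c. \<forall>n. c n \<in> F \<and> c n \<subset> c (Suc n)"
  proof (rule dependent_nat_choice)
    show "\<exists>I. I \<in> F" using F(1) by blast
    fix I n assume "I \<in> F"
    then show "\<exists>K. K \<in> F \<and> I \<subset> K" using no by blast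
  qed
  then obtain c where c: "\<And>n. c n \<in> F" "\<And>n. c n \<subset> c (Suc n)" by blast
  have "\<exists>m. m \<in> leads (c (Suc n)) \<and> m \<notin> leads (c n)" for n
    by (rule leads_strict) (use c F in auto)
  then obtain s where s: "\<And>n. s n \<in> leads (c (Suc n))" "\<And>n. s n \<notin> leads (c n)" by metis
  obtain i j l where ij: "i < j" "s j = s i + l" using dickson by blast
  have "c (Suc i) \<subseteq> c j" 
    by (rule lift_Suc_mono_le[of c, OF psubset_imp_subset[OF c(2)]]) (use ij(1) in simp)
  then have "s i \<in> leads (c j)" using s(1)[of i] unfolding leads_def by blast
  moreover have "is_ideal (c j)" using c(1) F(2) by blast
  ultimately have "s j \<in> leads (c j)" using leads_add ij(2) by simp
  then show False using s(2)[of j] by simp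
qed

section \<open>The grading\<close>

definition mdeg :: "('n::finite \<Rightarrow>\<^sub>0 nat) \<Rightarrow> nat" where
  "mdeg m = (\<Sum>i\<in>UNIV. coef m i)"

lemma mdeg_add: "mdeg (a + b) = mdeg a + mdeg b"
  by (simp add: mdeg_def lookup_add sum.distrib)

lemma mdeg_single [simp]: "mdeg (mon i a) = a"
  by (simp add: mdeg_def lookup_single when_def)

lemma mdeg_zero [simp]: "mdeg 0 = 0"
  by (simp add: mdeg_def)

lemma coef_le_mdeg: "coef m i \<le> mdeg m"
  unfolding mdeg_def by (rule member_le_sum) auto

lemma mdeg_eq_0_iff: "mdeg m = 0 \<longleftrightarrow> m = 0"
  by (auto simp: mdeg_def intro: poly_mapping_eqI)

lemma mdeg_eq_coef: assumes "mdeg m \<le> coef m i" shows "m = mon i (mdeg m)"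
proof (rule poly_mapping_eqI)
  fix j
  have eq: "mdeg m = coef m i + (\<Sum>j\<in>UNIV - {i}. coef m j)"
    unfolding mdeg_def by (rule sum.remove) auto
  then have "(\<Sum>j\<in>UNIV - {i}. coef m j) = 0" "coef m i = mdeg m" using assms by auto
  then show "coef m j = coef (mon i (mdeg m)) j"
    by (auto simp: lookup_single when_def)
qed

lemma forms_iff: "p \<in> forms t \<longleftrightarrow> (\<forall>m\<in>mono_keys p. int (mdeg m) = t)"
  by (simp add: forms_def mdeg_def)

definition hcomp :: "int \<Rightarrow> ('n::finite, 'k::field) pring \<Rightarrow> ('n, 'k) pring" where
  "hcomp t p = (\<Sum>m\<in>{m\<in>mono_keys p. int (mdeg m) = t}. mon m (coef p m))"

lemma coef_hcomp: "coef (hcomp t p) m = (if int (mdeg m) = t then coef p m else 0)"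
proof -
  let ?K = "{m\<in>mono_keys p. int (mdeg m) = t}"
  have "coef (hcomp t p) m = (\<Sum>l\<in>?K. if l = m then coef p m else 0)"
    by (auto simp: hcomp_def lookup_sum lookup_single when_def intro!: sum.cong)
  then show ?thesis by (auto simp: sum.delta' coef_notin_keys)
qed

lemma hcomp_in_forms: "hcomp t p \<in> forms t"
  by (auto simp: forms_iff in_keys_iff coef_hcomp split: if_splits)

lemma hcomp_add: "hcomp t (p + q) = hcomp t p + hcomp t q"
  and hcomp_diff: "hcomp t (p - q) = hcomp t p - hcomp t q"
  and hcomp_zero [simp]: "hcomp t 0 = 0"
  by (auto intro!: poly_mapping_eqI simp: coef_hcomp lookup_add lookup_minus)

lemma hcomp_sum: "hcomp t (\<Sum>i\<in>A. f i) = (\<Sum>i\<in>A. hcomp t (f i))"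
  by (induction A rule: infinite_finite_induct) (auto simp: hcomp_add)

lemma hcomp_form: "p \<in> forms s \<Longrightarrow> hcomp t p = (if s = t then p else 0)"
  by (auto intro!: poly_mapping_eqI simp: coef_hcomp forms_iff in_keys_iff)

lemma form_iff_hcomp: "p \<in> forms t \<longleftrightarrow> hcomp t p = p"
  using hcomp_form[of p t t] hcomp_in_forms[of t p] by auto

lemma hcomp_sum_self:
  assumes "finite T" "\<And>m. m \<in> mono_keys p \<Longrightarrow> int (mdeg m) \<in> T"
  shows "p = (\<Sum>t\<in>T. hcomp t p)"
proof (rule poly_mapping_eqI)
  fix m
  have "coef (\<Sum>t\<in>T. hcomp t p) m = (\<Sum>t\<in>T. if t = int (mdeg m) then coef p m else 0)"
    by (auto simp: lookup_sum coef_hcomp intro!: sum.cong)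
  also have "\<dots> = coef p m" using assms coef_notin_keys[of m p] by (auto simp: sum.delta')
  finally show "coef p m = coef (\<Sum>t\<in>T. hcomp t p) m" by simp
qed

lemma hcomp_mult_form:
  assumes "p \<in> forms s" shows "hcomp t (p * q) = p * hcomp (t - s) q"
proof (rule poly_mapping_eqI)
  fix k
  have k: "mono_keys (hcomp (t - s) q) \<subseteq> mono_keys q" by (auto simp: in_keys_iff coef_hcomp split: if_splits)
  have "coef (p * hcomp (t - s) q) k = (\<Sum>l\<in>mono_keys p. \<Sum>r\<in>mono_keys q.
      if l + r = k then coef p l * coef (hcomp (t - s) q) r else 0)"
    by (rule coef_mult) (use k in auto)
  also have "\<dots> = (\<Sum>l\<in>mono_keys p. \<Sum>r\<in>mono_keys q.
      if int (mdeg k) = t then if l + r = k then coef p l * coef q r else 0 else 0)"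
    using assms by (intro sum.cong refl) (auto simp: coef_hcomp mdeg_add forms_iff)
  also have "\<dots> = coef (hcomp t (p * q)) k"
    using coef_mult[of "mono_keys p" p "mono_keys q" q k] by (simp add: coef_hcomp)
  finally show "coef (hcomp t (p * q)) k = coef (p * hcomp (t - s) q) k" by simp
qed

lemma forms_zero [simp]: "0 \<in> forms t"
  and forms_add: "p \<in> forms t \<Longrightarrow> q \<in> forms t \<Longrightarrow> p + q \<in> forms t"
  and forms_diff: "p \<in> forms t \<Longrightarrow> q \<in> forms t \<Longrightarrow> p - q \<in> forms t"
  by (auto simp: forms_iff in_keys_iff lookup_add lookup_minus)

lemma forms_mult: "p \<in> forms s \<Longrightarrow> q \<in> forms t \<Longrightarrow> p * q \<in> forms (s + t)"
  using hcomp_mult_form[of p s "s + t" q] by (simp add: form_iff_hcomp)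

lemma forms_negative: "p \<in> forms t \<Longrightarrow> t < 0 \<Longrightarrow> p = 0"
  by (metis forms_iff keys_eq_empty of_nat_0_le_iff not_less ex_in_conv)

lemma const_form: "mon 0 c \<in> forms 0"
  by (auto simp: forms_iff split: if_splits)

lemma forms_0E: assumes "p \<in> forms 0" obtains c where "p = mon 0 c"
proof
  show "p = mon 0 (coef p 0)"
    using assms by (intro poly_mapping_eqI)
      (auto simp: forms_iff in_keys_iff mdeg_eq_0_iff lookup_single when_def)
qed

lemma coef_0_mult: "coef (p * q) 0 = coef p 0 * coef q 0" for p q :: "('n::finite, 'k::field) pring"
proof -
  have z: "l = 0 \<and> r = 0" if "l + r = 0 + 0" for l r :: "'n \<Rightarrow>\<^sub>0 nat"
    using that mdeg_add[of l r] by (simp add: mdeg_eq_0_iff)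
  have "coef (p * q) (0 + 0) = coef p 0 * coef q 0" by (rule coef_mult_unique) (rule z)
  then show ?thesis by simp
qed

lemma ideal_irrelevant: "is_ideal irrelevant"
  by (rule idl.subspaceI) (auto simp: irrelevant_def lookup_add coef_0_mult)

lemma one_notin_irrelevant: "1 \<notin> irrelevant"
  by (simp add: irrelevant_def)

lemma prime_irrelevant: "is_prime irrelevant"
  unfolding is_prime_def
proof (intro conjI allI impI ideal_irrelevant)
  show "irrelevant \<noteq> UNIV" using one_notin_irrelevant by blast
qed (simp add: irrelevant_def coef_0_mult)

lemma forms_pos_irrelevant: "p \<in> forms t \<Longrightarrow> t \<noteq> 0 \<Longrightarrow> p \<in> irrelevant"
  by (force simp: forms_iff irrelevant_def in_keys_iff)

lemma maximal_irrelevant: "is_maximal (irrelevant :: ('n::finite, 'k::field) pring set)"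
  unfolding is_maximal_def
proof (intro conjI allI impI)
  show "is_ideal (irrelevant :: ('n, 'k) pring set)" by (rule ideal_irrelevant)
  show "(irrelevant :: ('n, 'k) pring set) \<noteq> UNIV" using one_notin_irrelevant by blast
  fix I :: "('n, 'k) pring set" assume I: "is_ideal I \<and> irrelevant \<subseteq> I"
  show "I = irrelevant \<or> I = UNIV"
  proof (cases "I \<subseteq> irrelevant")
    case False
    then obtain p where p: "p \<in> I" "coef p 0 \<noteq> 0" unfolding irrelevant_def by blast
    let ?c = "coef p 0"
    have iI: "is_ideal I" using I by blast
    have "p - mon 0 ?c \<in> irrelevant" by (simp add: irrelevant_def lookup_minus)
    then have "p - mon 0 ?c \<in> I" using I by blast
    from idl.subspace_diff[OF iI p(1) this] have "mon 0 ?c \<in> I" by simp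
    from idl.subspace_scale[OF iI this, of "mon 0 (inverse ?c)"] have "1 \<in> I"
      using p(2) by (simp add: mult_single)
    then show ?thesis using ideal_eq_UNIV_iff[OF iI] by blast
  qed (use I in blast)
qed

text \<open>Closure under homogeneous components, instead of generation by forms, because it passes
  directly to sums with and colons by a form.\<close>

definition graded :: "('n::finite, 'k::field) pring set \<Rightarrow> bool" where
  "graded I \<longleftrightarrow> is_ideal I \<and> (\<forall>t. \<forall>p\<in>I. hcomp t p \<in> I)"

lemma gradedD: "graded I \<Longrightarrow> is_ideal I" "graded I \<Longrightarrow> p \<in> I \<Longrightarrow> hcomp t p \<in> I"
  by (auto simp: graded_def)

lemma graded_zero: "graded {0}"
  by (simp add: graded_def)

lemma graded_mem_iff: assumes "graded I" shows "p \<in> I \<longleftrightarrow> (\<forall>t. hcomp t p \<in> I)"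
proof
  assume *: "\<forall>t. hcomp t p \<in> I"
  have "p = (\<Sum>t\<in>(\<lambda>m. int (mdeg m)) ` mono_keys p. hcomp t p)" by (rule hcomp_sum_self) auto
  also have "\<dots> \<in> I" using assms * by (intro idl.subspace_sum) (auto simp: graded_def)
  finally show "p \<in> I" .
qed (use assms in \<open>auto simp: graded_def\<close>)

lemma graded_adjoin: assumes "graded I" "a \<in> forms s" shows "graded (adjoin I a)"
  unfolding graded_def
proof (intro conjI allI ballI)
  show "is_ideal (adjoin I a)" using assms ideal_adjoin gradedD by blast
  fix t p assume "p \<in> adjoin I a"
  then obtain k where "p - k * a \<in> I" by (rule adjoinE)
  then have "hcomp t (p - a * k) \<in> I" using assms gradedD by (simp add: mult.commute)
  then have "hcomp t p - hcomp (t - s) k * a \<in> I"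
    using assms by (simp add: hcomp_diff hcomp_mult_form mult.commute)
  then show "hcomp t p \<in> adjoin I a" by (rule adjoinI)
qed

lemma graded_colon: assumes "graded I" "a \<in> forms s" shows "graded (colon I a)"
  unfolding graded_def
proof (intro conjI allI ballI)
  show "is_ideal (colon I a)" using assms ideal_colon gradedD by blast
  fix t p assume "p \<in> colon I a"
  then have "hcomp (t + s) (a * p) \<in> I" using assms gradedD by (simp add: mult.commute)
  then show "hcomp t p \<in> colon I a" using assms by (simp add: hcomp_mult_form mult.commute)
qed

lemma graded_proper_subset: assumes "graded I" "1 \<notin> I" shows "I \<subseteq> irrelevant"
proof
  fix p assume p: "p \<in> I"
  show "p \<in> irrelevant"
  proof (rule ccontr)
    assume "p \<notin> irrelevant"
    then have c: "coef p 0 \<noteq> 0" by (simp add: irrelevant_def)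
    have "hcomp 0 p = mon 0 (coef p 0)"
      by (intro poly_mapping_eqI) (auto simp: coef_hcomp mdeg_eq_0_iff lookup_single when_def)
    then have "mon 0 (inverse (coef p 0)) * mon 0 (coef p 0) \<in> I"
      using idl.subspace_scale[OF gradedD(1)[OF assms(1)] gradedD(2)[OF assms(1) p, of 0]] by simp
    then show False using c assms by (simp add: mult_single)
  qed
qed

section \<open>Division by monic polynomials\<close>

definition polys_in :: "'n set \<Rightarrow> ('n::finite, 'k::field) pring set" where
  "polys_in B = {p. \<forall>m\<in>mono_keys p. \<forall>j. j \<notin> B \<longrightarrow> coef m j = 0}"

text \<open>Up to a nonzero scalar, \<open>u\<close> is monic of degree \<open>a\<close> in the
  variable \<open>i\<close> over the polynomials in the other variables.\<close>

definition monic_in :: "'n \<Rightarrow> nat \<Rightarrow> ('n::finite, 'k::field) pring \<Rightarrow> bool" where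
  "monic_in i a u \<longleftrightarrow> coef u (mon i a) \<noteq> 0 \<and>
     (\<forall>m\<in>mono_keys u. coef m i \<le> a \<and> (coef m i = a \<longrightarrow> m = mon i a))"

definition below :: "'n \<Rightarrow> nat \<Rightarrow> ('n::finite, 'k::field) pring \<Rightarrow> bool" where
  "below i a p \<longleftrightarrow> (\<forall>m\<in>mono_keys p. coef m i < a)"

lemma below_diff: "below i a p \<Longrightarrow> below i a q \<Longrightarrow> below i a (p - q)"
  using keys_diff'[of p q] by (auto simp: below_def)

lemma below_mult_free: "s \<in> polys_in (- {i}) \<Longrightarrow> below i a r \<Longrightarrow> below i a (s * r)"
  by (auto simp: below_def polys_in_def lookup_add elim!: keys_multE)

lemma polys_in_mono: "A \<subseteq> B \<Longrightarrow> polys_in A \<subseteq> polys_in B"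
  by (auto simp: polys_in_def)

lemma monic_nonzero: "monic_in i a u \<Longrightarrow> u \<noteq> 0"
  by (auto simp: monic_in_def)

lemma monic_div:
  assumes u: "monic_in i a u" shows "\<exists>q r. g = u * q + r \<and> below i a r"
proof -
  have step: "\<exists>q r. g = u * q + r \<and> below i a r"
    if mono: "\<And>m. m \<in> mono_keys g \<Longrightarrow> \<exists>q r. mon m (coef g m) = u * q + r \<and> below i a r"
    for g :: "('a, 'b) pring"
  proof -
    obtain q r where qr: "\<And>m. m \<in> mono_keys g \<Longrightarrow> mon m (coef g m) = u * q m + r m \<and> below i a (r m)"
      using mono by metis
    have "g = (\<Sum>m\<in>mono_keys g. mon m (coef g m))" by (rule poly_as_sum) auto
    also have "\<dots> = u * (\<Sum>m\<in>mono_keys g. q m) + (\<Sum>m\<in>mono_keys g. r m)"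
      using qr by (simp add: sum.distrib sum_distrib_left)
    finally have "g = \<dots>" .
    moreover have "below i a (\<Sum>m\<in>mono_keys g. r m)"
      using qr keys_sum[of r "mono_keys g"] by (fastforce simp: below_def)
    ultimately show ?thesis by blast
  qed
  have "below i N g \<Longrightarrow> \<exists>q r. g = u * q + r \<and> below i a r" for N g
  proof (induction N arbitrary: g)
    case 0
    then have "below i a g" by (auto simp: below_def)
    then show ?case by (intro exI[of _ 0] exI[of _ g]) simp
  next
    case (Suc N)
    show ?case
    proof (rule step)
      fix m assume m: "m \<in> mono_keys g"
      let ?c = "coef g m"
      show "\<exists>q r. mon m ?c = u * q + r \<and> below i a r"
      proof (cases "coef m i < N")
        case True
        then show ?thesis using Suc.IH[of "mon m ?c"] by (auto simp: below_def split: if_splits)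
      next
        case False
        then have mi: "coef m i = N" using Suc.prems m by (force simp: below_def)
        show ?thesis
        proof (cases "N < a")
          case True
          then have "below i a (mon m ?c)" using mi by (auto simp: below_def split: if_splits)
          then show ?thesis by (intro exI[of _ 0] exI[of _ "mon m ?c"]) simp
        next
          case False
          define l where "l = m - mon i a"
          have ml: "m = l + mon i a"
            using False mi by (intro poly_mapping_eqI) (auto simp: l_def lookup_add lookup_minus lookup_single when_def)
          have u0: "coef u (mon i a) \<noteq> 0" using u by (simp add: monic_in_def)
          \<comment> \<open>This multiple of \<open>u\<close> reproduces the monomial
            \<open>m\<close>; all its other monomials have smaller degree in
            \<open>i\<close>.\<close>
          define q where "q = mon l (?c / coef u (mon i a))"
          define r where "r = mon m ?c - q * u"
          have "coef (q * u) m = ?c"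
            using u0 coef_mono_mult[of l _ u "mon i a"] by (simp add: q_def ml)
          then have rm: "m \<notin> mono_keys r" by (simp add: r_def in_keys_iff lookup_minus)
          have "below i N r" unfolding below_def
          proof
            fix m' assume m': "m' \<in> mono_keys r"
            then have "m' \<noteq> m" using rm by auto
            then have "m' \<in> mono_keys (q * u)"
              using m' keys_diff'[of "mon m ?c" "q * u"] by (auto simp: r_def split: if_splits)
            then obtain b where b: "m' = l + b" "b \<in> mono_keys u"
              by (auto simp: q_def elim!: keys_multE split: if_splits)
            then have "coef b i < a" using u \<open>m' \<noteq> m\<close> ml by (force simp: monic_in_def)
            then show "coef m' i < N" using b mi ml by (simp add: lookup_add)
          qed
          then obtain q' r' where "r = u * q' + r'" "below i a r'" using Suc.IH by blast
          then show ?thesis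
            by (intro exI[of _ "q + q'"] exI[of _ r']) (simp add: r_def algebra_simps)
        qed
      qed
    qed
  qed
  moreover have "below i (Suc (Max (insert 0 ((\<lambda>m. coef m i) ` mono_keys g)))) g"
    by (auto simp: below_def less_Suc_eq_le)
  ultimately show ?thesis by blast
qed

lemma monic_mult_below:
  assumes u: "monic_in i a u" and b: "below i a (u * q)" shows "q = 0"
proof (rule ccontr)
  assume "q \<noteq> 0"
  then have ne: "mono_keys q \<noteq> {}" by simp
  define N where "N = Max ((\<lambda>m. coef m i) ` mono_keys q)"
  have "N \<in> (\<lambda>m. coef m i) ` mono_keys q" unfolding N_def using ne by (intro Max_in) auto
  then obtain m where m: "m \<in> mono_keys q" "coef m i = N" by blast
  have le: "coef r i \<le> N" if "r \<in> mono_keys q" for r using that by (simp add: N_def)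
  have "coef (u * q) (mon i a + m) = coef u (mon i a) * coef q m"
  proof (rule coef_mult_unique)
    fix l r assume lr: "l \<in> mono_keys u" "r \<in> mono_keys q" "l + r = mon i a + m"
    have "coef l i + coef r i = a + N" using lr(3) m(2) by (metis lookup_add lookup_single_eq)
    moreover have "coef l i \<le> a" using lr u by (auto simp: monic_in_def)
    ultimately have "coef l i = a" using le[OF lr(2)] by linarith
    then have "l = mon i a" using lr u by (auto simp: monic_in_def)
    then show "l = mon i a \<and> r = m" using lr(3) by simp
  qed
  then have "mon i a + m \<in> mono_keys (u * q)"
    using m u by (simp add: in_keys_iff monic_in_def)
  then show False using b by (force simp: below_def lookup_add)
qed

lemma in_adjoin_zero: "x \<in> adjoin {0} u \<longleftrightarrow> (\<exists>k. x = u * k)"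
  by (auto simp: adjoin_def mult.commute)

lemma in_adjoin_pair: "x \<in> adjoin (adjoin {0} u) v \<longleftrightarrow> (\<exists>k l. x = u * k + v * l)"
proof -
  have "x - l * v = u * k \<longleftrightarrow> x = u * k + v * l" for k l by (auto simp: algebra_simps)
  then show ?thesis unfolding adjoin_def[of _ v] mem_Collect_eq in_adjoin_zero by blast
qed

text \<open>Modulo \<open>u\<close> the ring is free over the polynomials without the variable
  \<open>i\<close>, on the powers of that variable below \<open>a\<close>. A nonzero
  \<open>s\<close> from that coefficient ring therefore acts injectively.\<close>

lemma monic_torsion_free:
  assumes u: "monic_in i a u" and s: "s \<in> polys_in (- {i})" "s \<noteq> 0" and g: "s * g = u * k"
  shows "\<exists>q. g = u * q"
proof -
  obtain q r where qr: "g = u * q + r" "below i a r" using monic_div[OF u] by blast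
  have "s * r = u * (k - s * q)" using g by (simp add: qr(1) algebra_simps)
  moreover have "below i a (s * r)" using below_mult_free s qr by blast
  ultimately have "s * r = 0" using monic_mult_below[OF u, of "k - s * q"] by simp
  then show ?thesis using s qr by (auto simp: pring_mult_eq_0_iff)
qed

text \<open>Neither \<open>s\<close> nor \<open>D\<close> involves \<open>i\<close>, so both commute
  with taking remainders by \<open>u\<close>. On remainders the claim is the torsion-freeness modulo
  \<open>D\<close>, with respect to the variable \<open>j\<close>.\<close>

lemma monic_pair_torsion_free:
  assumes u: "monic_in i a u" and D: "monic_in j b D" "D \<in> polys_in (- {i})"
    and s: "s \<in> polys_in (- {i, j})" "s \<noteq> 0" and g: "s * g = u * k + D * l"
  shows "\<exists>k l. g = u * k + D * l"
proof -
  obtain q r where qr: "g = u * q + r" "below i a r" using monic_div[OF u] by blast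
  obtain q' l' where l: "l = u * q' + l'" "below i a l'" using monic_div[OF u] by blast
  have si: "s \<in> polys_in (- {i})" "s \<in> polys_in (- {j})"
    using s(1) by (simp_all add: polys_in_def)
  have "s * r - D * l' = u * (k + D * q' - s * q)"
    using g by (simp add: qr(1) l(1) algebra_simps)
  moreover have "below i a (s * r - D * l')"
    by (intro below_diff below_mult_free si D qr l)
  ultimately have "s * r - D * l' = 0" using monic_mult_below[OF u, of "k + D * q' - s * q"] by simp
  then have "s * r = D * l'" by simp
  then obtain z where "r = D * z" using monic_torsion_free[OF D(1) si(2) s(2)] by blast
  then show ?thesis using qr by blast
qed

section \<open>Dimension counts and chains of primes\<close>

text \<open>A separate locale, because inside \<open>vector_space\<close> itself the names of new constants are captured by
  the interpretation for real vector spaces.\<close>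

locale vspace = vector_space scale for scale :: "'a::field \<Rightarrow> 'b::ab_group_add \<Rightarrow> 'b"
begin

abbreviation indep :: "'b set \<Rightarrow> bool" where "indep B \<equiv> \<not> local.dependent B"

definition fin_span :: "'b set \<Rightarrow> bool" where
  "fin_span V \<longleftrightarrow> (\<exists>W. finite W \<and> V \<subseteq> local.span W)"

lemma fin_span_subset: "U \<subseteq> V \<Longrightarrow> fin_span V \<Longrightarrow> fin_span U"
  by (auto simp: fin_span_def)

lemma fin_span_basis:
  assumes "fin_span V"
  obtains B where "B \<subseteq> V" "indep B" "V \<subseteq> local.span B" "finite B" "card B = local.dim V"
proof -
  obtain B where B: "B \<subseteq> V" "indep B" "V \<subseteq> local.span B" "card B = local.dim V" using basis_exists by blast
  obtain W where W: "finite W" "V \<subseteq> local.span W" using assms by (auto simp: fin_span_def)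
  have "finite B" using independent_span_bound[OF W(1) B(2)] B W by blast
  then show ?thesis using B that by blast
qed

lemma fin_span_independent_card:
  assumes "fin_span V" "B \<subseteq> V" "indep B" shows "finite B" "card B \<le> local.dim V"
proof -
  obtain C where C: "V \<subseteq> local.span C" "finite C" "card C = local.dim V" using fin_span_basis[OF assms(1)] by metis
  show "finite B" "card B \<le> local.dim V"
    using independent_span_bound[OF C(2) assms(3)] assms C by auto
qed

lemma fin_span_dim_mono: assumes "U \<subseteq> V" "fin_span V" shows "local.dim U \<le> local.dim V"
proof -
  obtain B where B: "B \<subseteq> U" "indep B" "card B = local.dim U" using basis_exists[of U] by metis
  have "B \<subseteq> V" using B(1) assms(1) by (rule subset_trans)
  from fin_span_independent_card(2)[OF assms(2) this B(2)] show ?thesis using B(3) by simp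
qed

text \<open>Only the two subspaces are finite-dimensional, not the ambient space. A basis
  \<open>B\<close> of the intersection is extended to bases \<open>C\<close> and \<open>D\<close>,
  and the vectors of \<open>D - B\<close> are added to \<open>C\<close> one at a time.\<close>

lemma fin_span_dim_sum_Int:
  assumes S: "local.subspace S" and T: "local.subspace T" and fS: "fin_span S" and fT: "fin_span T"
  shows "local.dim {x + y |x y. x \<in> S \<and> y \<in> T} + local.dim (S \<inter> T) = local.dim S + local.dim T"
proof -
  obtain B where B: "B \<subseteq> S \<inter> T" "indep B" "S \<inter> T \<subseteq> local.span B" "finite B" "card B = local.dim (S \<inter> T)"
    by (rule fin_span_basis[OF fin_span_subset[OF Int_lower1 fS]])
  obtain C where C: "B \<subseteq> C" "C \<subseteq> S" "indep C" "S \<subseteq> local.span C"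
    using maximal_independent_subset_extend[of B S] B(1,2) by (metis le_inf_iff)
  obtain D where D: "B \<subseteq> D" "D \<subseteq> T" "indep D" "T \<subseteq> local.span D"
    using maximal_independent_subset_extend[of B T] B(1,2) by (metis le_inf_iff)
  have fin: "finite C" "finite D"
    using fin_span_independent_card(1)[OF fS C(2,3)] fin_span_independent_card(1)[OF fT D(2,3)] by auto
  have cards: "card C = local.dim S" "card D = local.dim T"
    using basis_card_eq_dim[OF C(2,4,3)] basis_card_eq_dim[OF D(2,4,3)] by auto
  have ind: "indep (C \<union> E) \<and> C \<inter> E = {}" if "finite E" "E \<subseteq> D - B" for E
    using that
  proof (induction E)
    case (insert e E)
    have "e \<notin> local.span (C \<union> E)"
    proof
      assume "e \<in> local.span (C \<union> E)"
      then obtain x y where xy: "e = x + y" "x \<in> local.span C" "y \<in> local.span E" by (auto simp: span_Un)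
      have "x \<in> S" using xy(2) span_minimal[OF C(2) S] by blast
      moreover have "e - y \<in> T"
        using insert.prems D(2) xy(3) span_minimal[of E T] T by (intro subspace_diff) auto
      ultimately have "x \<in> local.span B" using xy(1) B(3) by auto
      then have "x \<in> local.span (D - {e})" "y \<in> local.span (D - {e})"
        using span_mono[of B "D - {e}"] span_mono[of E "D - {e}"] xy(3) insert D(1) by auto
      then have "e \<in> local.span (D - {e})" using xy(1) span_add by blast
      then show False using D(3) insert.prems by (auto simp: dependent_def)
    qed
    moreover then have "e \<notin> C" using span_base by blast
    ultimately show ?case using insert independent_insertI by auto
  qed (use C in auto)
  let ?E = "D - B"
  have E: "indep (C \<union> ?E)" "C \<inter> ?E = {}" using ind[of ?E] fin by auto
  have sub: "local.subspace {x + y |x y. x \<in> S \<and> y \<in> T}" by (rule subspace_sums[OF S T])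
  have "C \<union> ?E \<subseteq> {x + y |x y. x \<in> S \<and> y \<in> T}"
  proof
    fix z assume "z \<in> C \<union> ?E"
    then have "(z \<in> S \<and> 0 \<in> T) \<or> (0 \<in> S \<and> z \<in> T)"
      using C(2) D(2) subspace_0 S T by blast
    then show "z \<in> {x + y |x y. x \<in> S \<and> y \<in> T}" by force
  qed
  moreover have "{x + y |x y. x \<in> S \<and> y \<in> T} \<subseteq> local.span (C \<union> ?E)"
  proof clarify
    fix x y assume "x \<in> S" "y \<in> T"
    then have "x \<in> local.span (C \<union> ?E)" "y \<in> local.span (C \<union> ?E)"
      using C(1,4) D(4) span_mono[of C "C \<union> ?E"] span_mono[of D "C \<union> ?E"] by blast+
    then show "x + y \<in> local.span (C \<union> ?E)" by (rule span_add)
  qed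
  ultimately have "card (C \<union> ?E) = local.dim {x + y |x y. x \<in> S \<and> y \<in> T}"
    using E(1) by (rule basis_card_eq_dim)
  moreover have "card (C \<union> ?E) = card C + (card D - card B)"
    using E(2) fin D(1) B(4) by (simp add: card_Un_disjoint card_Diff_subset)
  ultimately show ?thesis using cards B(5) card_mono[OF fin(2) D(1)] by simp
qed

lemma dim_injective_image:
  assumes f: "Vector_Spaces.linear scale scale f" and U: "local.subspace U" and inj: "inj_on f U"
  shows "local.dim (f ` U) = local.dim U"
proof -
  interpret f: Vector_Spaces.linear scale scale f by fact
  obtain B where B: "B \<subseteq> U" "indep B" "U \<subseteq> local.span B" "card B = local.dim U" using basis_exists by blast
  have sp: "local.span B = U" using span_subspace B U by blast
  have ind: "indep (f ` B)" using f.independent_injective_image[OF B(2)] inj sp by simp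
  have sub: "f ` B \<subseteq> f ` U" using B(1) by (rule image_mono)
  have sup: "f ` U \<subseteq> local.span (f ` B)" using f.span_image[of B] sp by simp
  have "local.dim (f ` U) = card (f ` B)" using basis_card_eq_dim[OF sub sup ind] by simp
  also have "\<dots> = card B" using inj B(1) by (meson card_image inj_on_subset)
  finally show ?thesis using B by simp
qed

end

lemma coef_pscale: "coef (pscale c p) m = c * coef p m"
  using coef_mono_mult[of 0 c p m] by (simp add: pscale_def)

interpretation psc: vspace "pscale :: 'k::field \<Rightarrow> ('n::finite, 'k) pring \<Rightarrow> _"
  by unfold_locales (auto intro!: poly_mapping_eqI simp: coef_pscale lookup_add algebra_simps)

lemma pscale_mult: "pscale c (a * p) = a * pscale c p"
  by (simp add: pscale_def mult.left_commute)

lemma linear_pscaleI: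
  assumes "\<And>x y. f (x + y) = f x + f y" "\<And>c x. f (pscale c x) = pscale c (f x)"
  shows "Vector_Spaces.linear pscale pscale f"
  using assms by (simp add: Vector_Spaces.linear_iff psc.vector_space_axioms)

lemma linear_times: "Vector_Spaces.linear pscale pscale (\<lambda>x. a * x)"
  by (rule linear_pscaleI) (auto simp: distrib_left pscale_mult)

lemma subspace_times_image: "psc.subspace U \<Longrightarrow> psc.subspace ((\<lambda>x. a * x) ` U)"
proof -
  interpret f: Vector_Spaces.linear pscale pscale "\<lambda>x. a * x" by (rule linear_times)
  show "psc.subspace U \<Longrightarrow> psc.subspace ((\<lambda>x. a * x) ` U)" by (rule f.subspace_image)
qed

lemma ideal_psc: "is_ideal I \<Longrightarrow> psc.subspace I"
  by (rule psc.subspaceI)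
    (auto simp: pscale_def idl.subspace_0 idl.subspace_add idl.subspace_scale)

definition supported :: "('n::finite \<Rightarrow>\<^sub>0 nat) set \<Rightarrow> ('n, 'k::field) pring set" where
  "supported X = {p. mono_keys p \<subseteq> X}"

lemma subspace_supported: "psc.subspace (supported X)"
  by (rule psc.subspaceI) (auto simp: supported_def in_keys_iff lookup_add coef_pscale subset_iff, metis add_0)

lemma supported_spanned:
  assumes "finite X" shows "supported X \<subseteq> psc.span ((\<lambda>m. mon m 1) ` X)"
proof
  fix p :: "('a, 'b) pring" assume "p \<in> supported X"
  then have "p = (\<Sum>m\<in>X. mon m (coef p m))" using assms by (intro poly_as_sum) (auto simp: supported_def)
  also have "\<dots> = (\<Sum>m\<in>X. pscale (coef p m) (mon m 1))" by (simp add: pscale_def mult_single)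
  also have "\<dots> \<in> psc.span ((\<lambda>m. mon m 1) ` X)"
    by (intro psc.span_sum psc.span_scale psc.span_base) auto
  finally show "p \<in> psc.span ((\<lambda>m. mon m 1) ` X)" .
qed

lemma fin_span_supported: "finite X \<Longrightarrow> psc.fin_span (supported X)"
  unfolding psc.fin_span_def using supported_spanned by blast

lemma dim_supported:
  assumes X: "finite X" shows "psc.dim (supported X :: ('n::finite, 'k::field) pring set) = card X"
proof -
  let ?B = "(\<lambda>m. mon m 1) ` X :: ('n, 'k) pring set"
  have inj: "inj_on (\<lambda>m. mon m 1 :: ('n, 'k) pring) X"
    by (rule inj_onI, drule arg_cong[of _ _ mono_keys]) simp
  have "\<not> psc.dependent ?B"
  proof (rule psc.independent_if_scalars_zero)
    show "finite ?B" using X by simp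
    fix f x assume s: "(\<Sum>x\<in>?B. pscale (f x) x) = 0" and x: "x \<in> ?B"
    obtain m where m: "m \<in> X" "x = mon m 1" using x by blast
    have "(\<Sum>x\<in>?B. pscale (f x) x) = (\<Sum>m\<in>X. mon m (f (mon m 1)))"
      by (simp add: sum.reindex[OF inj] pscale_def mult_single)
    then have "coef (\<Sum>m\<in>X. mon m (f (mon m 1))) m = 0" using s by simp
    then show "f x = 0" using m X by (simp add: lookup_sum lookup_single when_def sum.delta')
  qed
  moreover have "?B \<subseteq> supported X" by (auto simp: supported_def)
  ultimately have "card ?B = psc.dim (supported X :: ('n, 'k) pring set)"
    using psc.basis_card_eq_dim[OF _ supported_spanned[OF X]] by blast
  then show ?thesis using card_image[OF inj] by simp
qed

section \<open>Counting in boxes of exponents\<close>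

lemma finite_card_exponents:
  fixes F :: "'n::finite \<Rightarrow> nat set"
  assumes "\<And>i. finite (F i)"
  shows "finite {m :: 'n \<Rightarrow>\<^sub>0 nat. \<forall>i. coef m i \<in> F i}" (is "finite ?X")
    and "card {m :: 'n \<Rightarrow>\<^sub>0 nat. \<forall>i. coef m i \<in> F i} = (\<Prod>i\<in>UNIV. card (F i))"
proof -
  have "bij_betw (coef :: ('n \<Rightarrow>\<^sub>0 nat) \<Rightarrow> _) ?X (PiE UNIV F)"
  proof (rule bij_betwI')
    fix m m' :: "'n \<Rightarrow>\<^sub>0 nat"
    show "coef m = coef m' \<longleftrightarrow> m = m'" by (simp only: poly_mapping_eq_iff)
  next
    fix m :: "'n \<Rightarrow>\<^sub>0 nat" assume "m \<in> ?X"
    then show "coef m \<in> PiE UNIV F" by (simp add: PiE_iff)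
  next
    fix f assume f: "f \<in> PiE UNIV F"
    have "coef (Abs_poly_mapping f) = f" by (rule lookup_Abs_poly_mapping) simp
    moreover have "f i \<in> F i" for i using f by (rule PiE_mem) simp
    ultimately show "\<exists>m\<in>?X. f = coef m" by (intro bexI[of _ "Abs_poly_mapping f"]) simp_all
  qed
  note bij = this
  have fin: "finite (PiE UNIV F)" by (rule finite_PiE) (simp_all add: assms)
  show "finite ?X" using bij_betw_finite[OF bij] fin by blast
  have "card ?X = card (PiE UNIV F)" by (rule bij_betw_same_card[OF bij])
  then show "card ?X = (\<Prod>i\<in>UNIV. card (F i))" by (simp add: card_PiE)
qed

text \<open>Bounding every exponent separately, not the total degree, makes the counts exact powers
  of \<open>t + 1\<close>.\<close>

definition box :: "nat \<Rightarrow> ('n::finite \<Rightarrow>\<^sub>0 nat) set" where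
  "box t = {m. \<forall>i. coef m i \<in> {..t}}"

lemma finite_box: "finite (box t)"
  unfolding box_def by (rule finite_card_exponents) simp

lemma card_box: "card (box t :: ('n::finite \<Rightarrow>\<^sub>0 nat) set) = (t + 1) ^ CARD('n)"
  unfolding box_def by (subst finite_card_exponents) auto

lemma card_box_sub:
  "card {m :: 'n::finite \<Rightarrow>\<^sub>0 nat. m \<in> box t \<and> (\<forall>j. j \<notin> B \<longrightarrow> coef m j = 0)} = (t + 1) ^ card B"
proof -
  let ?F = "\<lambda>j. if j \<in> B then {..t} else {0}"
  have eq: "{m :: 'n \<Rightarrow>\<^sub>0 nat. m \<in> box t \<and> (\<forall>j. j \<notin> B \<longrightarrow> coef m j = 0)} =
      {m. \<forall>j. coef m j \<in> ?F j}"
  proof (intro set_eqI iffI; unfold mem_Collect_eq)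
    fix m :: "'n \<Rightarrow>\<^sub>0 nat" assume *: "\<forall>j. coef m j \<in> ?F j"
    have "coef m j \<le> t" for j using *[rule_format, of j] by (cases "j \<in> B") auto
    moreover have "coef m j = 0" if "j \<notin> B" for j using *[rule_format, of j] that by simp
    ultimately show "m \<in> box t \<and> (\<forall>j. j \<notin> B \<longrightarrow> coef m j = 0)" by (simp add: box_def)
  qed (simp add: box_def)
  have "(\<Prod>j\<in>UNIV. card (?F j)) = (\<Prod>j\<in>UNIV. if j \<in> B then t + 1 else 1)"
    by (intro prod.cong) auto
  also have "\<dots> = (t + 1) ^ card B" by (simp add: prod.If_cases)
  finally show ?thesis unfolding eq by (subst finite_card_exponents(2)) auto
qed

text \<open>For finite-dimensional \<open>W\<close> this is the dimension of the image of
  \<open>W\<close> in R/\<open>I\<close>; integers avoid truncated subtraction.\<close>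

definition codim_in :: "('n::finite, 'k::field) pring set \<Rightarrow> ('n, 'k) pring set \<Rightarrow> int" where
  "codim_in W I = int (psc.dim W) - int (psc.dim (W \<inter> I))"

lemma codim_in_nonneg: "psc.fin_span W \<Longrightarrow> codim_in W I \<ge> 0"
  using psc.fin_span_dim_mono[of "W \<inter> I" W] by (auto simp: codim_in_def)

lemma codim_in_ge:
  fixes S W I :: "('n::finite, 'k::field) pring set"
  assumes S: "psc.subspace S" "S \<subseteq> W" "S \<inter> I \<subseteq> {0}" and W: "psc.fin_span W" "psc.subspace W" and I: "psc.subspace I"
  shows "codim_in W I \<ge> int (psc.dim S)"
proof -
  let ?U = "{x + y |x y. x \<in> S \<and> y \<in> W \<inter> I}"
  have sI: "psc.subspace (W \<inter> I)" by (rule psc.subspace_inter[OF W(2) I])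
  have "S \<inter> (W \<inter> I) = {0}" 
    using S(3) psc.subspace_0[OF S(1)] psc.subspace_0[OF sI] by (intro equalityI subsetI) auto
  moreover have "psc.dim {0 :: ('n, 'k) pring} = 0"
    using psc.basis_card_eq_dim[of "{}" "{0}"] psc.independent_empty by simp
  moreover have "psc.dim ?U + psc.dim (S \<inter> (W \<inter> I)) = psc.dim S + psc.dim (W \<inter> I)"
    by (rule psc.fin_span_dim_sum_Int[OF S(1) sI psc.fin_span_subset[OF S(2) W(1)]
        psc.fin_span_subset[OF Int_lower1 W(1)]])
  moreover have "?U \<subseteq> W"
  proof clarify
    fix x y assume "x \<in> S" "y \<in> W"
    then show "x + y \<in> W" using S(2) by (intro psc.subspace_add[OF W(2)]) auto
  qed
  then have "psc.dim ?U \<le> psc.dim W" using W(1) by (rule psc.fin_span_dim_mono)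
  ultimately show ?thesis by (simp add: codim_in_def)
qed

text \<open>The count behind the exact sequence 0 \<rightarrow>
  R/(\<open>K\<close>:\<open>a\<close>) \<rightarrow> R/\<open>K\<close> \<rightarrow>
  R/(\<open>K\<close> + (\<open>a\<close>)) \<rightarrow> 0, cut down to finite-dimensional pieces.
  Multiplication by \<open>a\<close> is injective and carries \<open>W \<inter> colon K a\<close>
  onto the intersection of the two summands.\<close>

lemma dim_sum_times:
  fixes W W' K :: "('n::finite, 'k::field) pring set"
  assumes a: "a \<noteq> 0" and K: "is_ideal K" and W: "psc.subspace W" and W': "psc.subspace W'" "psc.fin_span W'"
    and aW: "\<And>x. x \<in> W \<Longrightarrow> a * x \<in> W'"
  shows "psc.dim {x + y |x y. x \<in> (\<lambda>x. a * x) ` W \<and> y \<in> W' \<inter> K} + psc.dim (W \<inter> colon K a) =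
    psc.dim W + psc.dim (W' \<inter> K)"
proof -
  let ?S = "(\<lambda>x. a * x) ` W" and ?T = "W' \<inter> K"
  have inj: "inj_on (\<lambda>x. a * x) A" for A using a by (auto simp: inj_on_def pring_mult_left_cancel)
  have sS: "psc.subspace ?S" by (rule subspace_times_image[OF W])
  have sT: "psc.subspace ?T" by (rule psc.subspace_inter[OF W'(1) ideal_psc[OF K]])
  have SW: "?S \<subseteq> W'" using aW by auto
  have ST: "?S \<inter> ?T = (\<lambda>x. a * x) ` (W \<inter> colon K a)"
    using aW by (auto simp: mult.commute)
  have "psc.dim {x + y |x y. x \<in> ?S \<and> y \<in> ?T} + psc.dim (?S \<inter> ?T) = psc.dim ?S + psc.dim ?T"
    by (rule psc.fin_span_dim_sum_Int[OF sS sT psc.fin_span_subset[OF SW W'(2)]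
        psc.fin_span_subset[OF Int_lower1 W'(2)]])
  moreover have "psc.dim ?S = psc.dim W"
    by (rule psc.dim_injective_image[OF linear_times W inj])
  moreover have "psc.dim ((\<lambda>x. a * x) ` (W \<inter> colon K a)) = psc.dim (W \<inter> colon K a)"
    by (rule psc.dim_injective_image[OF linear_times
        psc.subspace_inter[OF W ideal_psc[OF ideal_colon[OF K]]] inj])
  ultimately show ?thesis unfolding ST by simp
qed

text \<open>Multiplication by \<open>f\<close> is injective on R/\<open>P\<close> and lands in
  \<open>Q\<close>/\<open>P\<close>. Thus R/\<open>P\<close> exceeds R/\<open>Q\<close> by at least
  a copy of itself, shifted by \<open>e\<close>.\<close>

lemma codim_in_prime_step:
  fixes P Q :: "('n::finite, 'k::field) pring set"
  assumes P: "is_prime P" and Q: "is_ideal Q" "P \<subseteq> Q" and f: "f \<in> Q" "f \<notin> P" "f \<in> supported (box e)"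
  shows "codim_in (supported (box (t + e))) P \<ge>
    codim_in (supported (box (t + e))) Q + codim_in (supported (box t)) P"
proof -
  let ?W = "supported (box t) :: ('n, 'k) pring set" and ?W' = "supported (box (t + e)) :: ('n, 'k) pring set"
  let ?U = "{x + y |x y. x \<in> (\<lambda>x. f * x) ` ?W \<and> y \<in> ?W' \<inter> P}"
  have f0: "f \<noteq> 0" using f prime_contains_zero[OF P] by auto
  have fW: "f * x \<in> ?W'" if x: "x \<in> ?W" for x
  proof -
    have "m \<in> box (t + e)" if m: "m \<in> mono_keys (f * x)" for m
    proof -
      obtain a b where ab: "m = a + b" "a \<in> mono_keys f" "b \<in> mono_keys x" using m by (rule keys_multE)
      have "a \<in> box e" "b \<in> box t" using ab(2,3) f(3) x by (auto simp: supported_def)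
      then show ?thesis unfolding ab(1) box_def by (simp add: lookup_add add_mono add.commute[of t])
    qed
    then show ?thesis by (auto simp: supported_def)
  qed
  have fin: "psc.fin_span ?W'" by (rule fin_span_supported[OF finite_box])
  have "colon P f \<subseteq> P" using primeD[OF P, of _ f] f(2) by auto
  then have colon: "colon P f = P" using subset_colon[OF prime_ideal[OF P], of f] by blast
  have "?U \<subseteq> ?W' \<inter> Q"
  proof clarify
    fix x y assume x: "x \<in> ?W" and y: "y \<in> ?W'" "y \<in> P"
    have "f * x \<in> Q" using ideal_mult_right[OF Q(1) f(1)] .
    moreover have "y \<in> Q" using y Q(2) by blast
    ultimately show "f * x + y \<in> ?W' \<inter> Q"
      by (intro IntI idl.subspace_add[OF Q(1)] psc.subspace_add[OF subspace_supported] fW[OF x] y)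
  qed
  then have "psc.dim ?U \<le> psc.dim (?W' \<inter> Q)"
    by (rule psc.fin_span_dim_mono) (rule psc.fin_span_subset[OF Int_lower1 fin])
  moreover have "psc.dim ?U + psc.dim (?W \<inter> colon P f) = psc.dim ?W + psc.dim (?W' \<inter> P)"
    by (rule dim_sum_times[OF f0 prime_ideal[OF P] subspace_supported subspace_supported fin fW])
  ultimately show ?thesis by (simp add: codim_in_def colon)
qed

section \<open>Polynomial growth along a chain of primes\<close>

definition grows :: "nat \<Rightarrow> (nat \<Rightarrow> int) \<Rightarrow> bool" where
  "grows b G \<longleftrightarrow> (\<exists>c>0. \<exists>t0. \<forall>t\<ge>t0. real_of_int (G t) \<ge> c * real t ^ b)"

text \<open>Summing a lower bound of order \<open>b\<close> over a number of steps proportional to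
  \<open>t\<close> gains one power of \<open>t\<close>.\<close>

lemma grows_step:
  assumes g: "grows b g" and G: "\<And>t. G (t + e) \<ge> g (t + e) + G t" "\<And>t. G t \<ge> 0" and e: "e > 0"
  shows "grows (Suc b) G"
proof -
  obtain c t0 where c: "c > 0" "\<And>t. t \<ge> t0 \<Longrightarrow> real_of_int (g t) \<ge> c * real t ^ b"
    using g by (auto simp: grows_def)
  have lin: "real_of_int (G (u + k * e)) \<ge> real k * (c * real u ^ b)" if u: "u \<ge> t0" for u k
  proof (induction k)
    case 0 then show ?case using G(2)[of u] by simp
  next
    case (Suc k)
    have "c * real u ^ b \<le> c * real (u + Suc k * e) ^ b"
      using c(1) by (intro mult_left_mono power_mono) auto
    also have "\<dots> \<le> real_of_int (g (u + Suc k * e))" using u by (intro c(2)) simp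
    finally have "real (Suc k) * (c * real u ^ b) \<le>
        real_of_int (g (u + Suc k * e)) + real_of_int (G (u + k * e))"
      using Suc by (simp add: algebra_simps)
    also have "\<dots> \<le> real_of_int (G (u + k * e + e))"
      using G(1)[of "u + k * e"] by (simp add: algebra_simps flip: of_int_add)
    finally show ?case by (simp add: algebra_simps)
  qed
  \<comment> \<open>The factor \<open>4 * real e\<close> comes from the number of steps, and
    \<open>2 ^ b\<close> from evaluating each step at an argument of at least
    \<open>t / 2\<close>.\<close>
  define c' where "c' = c / (4 * real e * 2 ^ b)"
  have "real_of_int (G t) \<ge> c' * real t ^ Suc b" if t: "t \<ge> max (2 * t0) (4 * e)" for t
  proof -
    \<comment> \<open>Only half of \<open>t\<close> is used up by steps of length \<open>e\<close>,
      so the start \<open>u\<close> stays at or above both \<open>t / 2\<close> and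
      \<open>t0\<close>.\<close>
    define k where "k = t div (2 * e)"
    define u where "u = t - k * e"
    have ke: "2 * (k * e) \<le> t" 
      using div_times_less_eq_dividend[of t "2 * e"] by (simp add: k_def mult_ac)
    have tu: "t = u + k * e" and u2: "2 * u \<ge> t" using ke by (simp_all add: u_def)
    have "t < 2 * e * (k + 1)" using e dividend_less_times_div[of "2 * e" t] by (simp add: k_def)
    then have "real t < real (2 * e * (k + 1))" by (simp only: of_nat_less_iff)
    then have "real t < 2 * real e * (real k + 1)" by (simp add: algebra_simps)
    moreover have "4 * real e \<le> real t" using t by simp
    ultimately have "real t \<le> 4 * real e * real k" by (simp add: algebra_simps)
    then have k: "real k \<ge> real t / (4 * real e)" using e by (simp add: field_simps)
    have "real u \<ge> real t / 2" using u2 by linarith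
    then have "real u ^ b \<ge> (real t / 2) ^ b" by (intro power_mono) auto
    then have "c * (real t / 2) ^ b \<le> c * real u ^ b" using c by simp
    then have "real t / (4 * real e) * (c * (real t / 2) ^ b) \<le> real k * (c * real u ^ b)"
      using k c e by (intro mult_mono) auto
    also have "\<dots> \<le> real_of_int (G t)" using lin[of u k] tu u2 t by simp
    finally show ?thesis by (simp add: c'_def power_divide field_simps)
  qed
  moreover have "c' > 0" using c e by (simp add: c'_def)
  ultimately show ?thesis unfolding grows_def by blast
qed

lemma grows_bounded:
  assumes "grows b G" and le: "\<And>t. G t \<le> (int t + 1) ^ n" shows "b \<le> n"
proof (rule ccontr)
  assume "\<not> b \<le> n"
  obtain c t0 where c: "c > 0" "\<And>t. t \<ge> t0 \<Longrightarrow> real_of_int (G t) \<ge> c * real t ^ b"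
    using assms by (auto simp: grows_def)
  obtain T :: nat where T: "real T > 2 ^ n / c" using reals_Archimedean2 by blast
  define t where "t = max (max T t0) 1"
  have t1: "t \<ge> 1" "t \<ge> T" "t \<ge> t0" by (auto simp: t_def)
  have "real_of_int (G t) \<le> real_of_int ((int t + 1) ^ n)" using le of_int_le_iff by blast
  also have "\<dots> = (real t + 1) ^ n" by simp
  also have "\<dots> \<le> (2 * real t) ^ n" using t1 by (intro power_mono) auto
  finally have *: "c * real t ^ b \<le> 2 ^ n * real t ^ n" using c(2)[OF t1(3)] by (simp add: power_mult_distrib)
  have "real t ^ Suc n \<le> real t ^ b" using \<open>\<not> b \<le> n\<close> t1 by (intro power_increasing) auto
  then have "c * real t * real t ^ n \<le> c * real t ^ b" using c(1) by simp
  then have "c * real t * real t ^ n \<le> 2 ^ n * real t ^ n" using * by linarith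
  then have "c * real t \<le> 2 ^ n" using t1 by simp
  moreover have "2 ^ n < c * real T" using T c by (simp add: field_simps)
  moreover have "c * real T \<le> c * real t" using t1(2) c(1) by (intro mult_left_mono) auto
  ultimately show False by linarith
qed

text \<open>Modulo the top prime the polynomials in \<open>B\<close> stay independent, which gives
  growth of order \<open>card B\<close>. Each step down the chain raises the order by one, while the
  whole ring allows at most the number of variables.\<close>

lemma prime_chain_bound:
  fixes c :: "nat \<Rightarrow> ('n::finite, 'k::field) pring set"
  assumes c: "prime_chain c m" and B: "c m \<inter> polys_in B \<subseteq> {0}"
  shows "m + card B \<le> CARD('n)"
proof -
  let ?W = "\<lambda>t. supported (box t) :: ('n, 'k) pring set"
  let ?G = "\<lambda>I t. codim_in (?W t) I"
  have fin: "psc.fin_span (?W t)" for t by (rule fin_span_supported[OF finite_box])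
  have pr: "is_prime (c i)" if "i \<le> m" for i using c that by (simp add: prime_chain_def)
  have "grows (card B + j) (?G (c (m - j)))" if "j \<le> m" for j
    using that
  proof (induction j)
    case 0
    have "real_of_int (?G (c m) t) \<ge> 1 * real t ^ card B" for t
    proof -
      let ?X = "{a :: 'n \<Rightarrow>\<^sub>0 nat. a \<in> box t \<and> (\<forall>j. j \<notin> B \<longrightarrow> coef a j = 0)}"
      have X: "finite ?X" using finite_box[of t] by (rule finite_subset[rotated]) auto
      have "?G (c m) t \<ge> int (psc.dim (supported ?X :: ('n, 'k) pring set))"
      proof (rule codim_in_ge)
        have "supported ?X \<subseteq> (polys_in B :: ('n, 'k) pring set)"
          by (auto simp: supported_def polys_in_def)
        then show "supported ?X \<inter> c m \<subseteq> {0}" using B by blast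
        show "psc.subspace (c m)" using pr ideal_psc prime_ideal by blast
      qed (use fin subspace_supported in \<open>auto simp: supported_def\<close>)
      also have "int (psc.dim (supported ?X :: ('n, 'k) pring set)) = (int t + 1) ^ card B"
        by (simp only: dim_supported[OF X] card_box_sub of_nat_power of_nat_add of_nat_1)
      finally have "real_of_int ((int t + 1) ^ card B) \<le> real_of_int (?G (c m) t)"
        by (simp only: of_int_le_iff)
      moreover have "real_of_int ((int t + 1) ^ card B) = (real t + 1) ^ card B" by simp
      moreover have "real t ^ card B \<le> (real t + 1) ^ card B" by (intro power_mono) auto
      ultimately show ?thesis by linarith
    qed
    then have "\<forall>t\<ge>0. real_of_int (?G (c m) t) \<ge> 1 * real t ^ card B" by blast
    then show ?case unfolding grows_def by (intro exI[of _ 1] conjI exI[of _ 0]) simp_all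
  next
    case (Suc j)
    let ?P = "c (m - Suc j)" and ?Q = "c (m - j)"
    have "m - Suc j < m" "m - j = Suc (m - Suc j)" using Suc.prems by auto
    then have "?P \<subset> ?Q" using c unfolding prime_chain_def by metis
    then obtain f where f: "f \<in> ?Q" "f \<notin> ?P" by blast
    \<comment> \<open>The total degree bounds every exponent of \<open>f\<close>; the successor
      makes \<open>e\<close> positive, as \<open>grows_step\<close> requires.\<close>
    define e where "e = Suc (Max (insert 0 (mdeg ` mono_keys f)))"
    have "coef a i \<le> e" if "a \<in> mono_keys f" for a i
    proof -
      have "mdeg a \<le> Max (insert 0 (mdeg ` mono_keys f))" using that by (intro Max_ge) auto
      then show ?thesis using coef_le_mdeg[of a i] by (simp add: e_def)
    qed
    then have fe: "f \<in> supported (box e)" by (auto simp: supported_def box_def)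
    have "grows (Suc (card B + j)) (?G ?P)"
    proof (rule grows_step)
      show "grows (card B + j) (?G ?Q)" using Suc by simp
      show "?G ?P (t + e) \<ge> ?G ?Q (t + e) + ?G ?P t" for t
        by (rule codim_in_prime_step[OF pr prime_ideal[OF pr] psubset_imp_subset[OF \<open>?P \<subset> ?Q\<close>] f fe])
          simp_all
      show "?G ?P t \<ge> 0" for t by (rule codim_in_nonneg[OF fin])
    qed (simp add: e_def)
    then show ?case by simp
  qed
  from this[of m] have "grows (card B + m) (?G (c 0))" by simp
  moreover have "?G (c 0) t \<le> (int t + 1) ^ CARD('n)" for t
  proof -
    have "int (psc.dim (?W t)) = (int t + 1) ^ CARD('n)"
      by (simp only: dim_supported[OF finite_box] card_box of_nat_power of_nat_add of_nat_1)
    then show ?thesis by (simp add: codim_in_def)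
  qed
  ultimately have "card B + m \<le> CARD('n)" by (rule grows_bounded)
  then show ?thesis by simp
qed

section \<open>Linear changes of coordinates\<close>

definition subst :: "('n \<Rightarrow> ('n, 'k) pring) \<Rightarrow> ('n::finite, 'k::field) pring \<Rightarrow> ('n, 'k) pring" where
  "subst y p = (\<Sum>m\<in>mono_keys p. mon 0 (coef p m) * (\<Prod>i\<in>UNIV. y i ^ coef m i))"

definition var :: "'n \<Rightarrow> ('n::finite, 'k::field) pring" where
  "var i = mon (mon i 1) 1"

lemma subst_superset:
  assumes "finite K" "mono_keys p \<subseteq> K"
  shows "subst y p = (\<Sum>m\<in>K. mon 0 (coef p m) * (\<Prod>i\<in>UNIV. y i ^ coef m i))"
  unfolding subst_def using assms
  by (intro sum.mono_neutral_left) (auto simp: coef_notin_keys)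

lemma subst_mon: "subst y (mon m c) = mon 0 c * (\<Prod>i\<in>UNIV. y i ^ coef m i)"
  by (subst subst_superset[of "{m}"]) auto

lemma subst_const [simp]: "subst y (mon 0 c) = mon 0 c"
  by (simp add: subst_mon)

lemma subst_zero [simp]: "subst y 0 = 0"
  by (simp add: subst_def)

lemma subst_one [simp]: "subst y 1 = 1"
  using subst_const[of y 1] by simp

lemma subst_add: "subst y (p + q) = subst y p + subst y q"
proof -
  let ?K = "mono_keys p \<union> mono_keys q"
  have K: "finite ?K" "mono_keys p \<subseteq> ?K" "mono_keys q \<subseteq> ?K" "mono_keys (p + q) \<subseteq> ?K"
    using keys_add[of p q] by auto
  show ?thesis
    unfolding subst_superset[OF K(1,2)] subst_superset[OF K(1,3)] subst_superset[OF K(1,4)]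
    by (simp add: lookup_add single_add distrib_right sum.distrib)
qed

lemma subst_sum: "subst y (\<Sum>i\<in>A. f i) = (\<Sum>i\<in>A. subst y (f i))"
  by (induction A rule: infinite_finite_induct) (auto simp: subst_add)

lemma subst_mult: "subst y (p * q) = subst y p * subst y q"
proof -
  have mm: "subst y (mon a c * mon b d) = subst y (mon a c) * subst y (mon b d)" for a b c d
  proof -
    let ?A = "\<Prod>i\<in>UNIV. y i ^ coef a i" and ?B = "\<Prod>i\<in>UNIV. y i ^ coef b i"
    have e: "(mon 0 (c * d) :: ('a, 'b) pring) = mon 0 c * mon 0 d" by (simp add: mult_single)
    have "subst y (mon a c * mon b d) = mon 0 (c * d) * (?A * ?B)"
      by (simp add: mult_single subst_mon lookup_add power_add prod.distrib)
    also have "\<dots> = (mon 0 c * ?A) * (mon 0 d * ?B)" unfolding e by (simp only: mult_ac)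
    finally show ?thesis by (simp only: subst_mon)
  qed
  have p: "p = (\<Sum>m\<in>mono_keys p. mon m (coef p m))" and q: "q = (\<Sum>m\<in>mono_keys q. mon m (coef q m))"
    by (rule poly_as_sum; simp)+
  have "subst y (p * q) = subst y ((\<Sum>m\<in>mono_keys p. mon m (coef p m)) * (\<Sum>m\<in>mono_keys q. mon m (coef q m)))"
    using p q by simp
  also have "\<dots> = subst y (\<Sum>m\<in>mono_keys p. mon m (coef p m)) * subst y (\<Sum>m\<in>mono_keys q. mon m (coef q m))"
    by (simp only: sum_product subst_sum mm)
  finally show ?thesis using p q by simp
qed

lemma subst_power: "subst y (p ^ k) = subst y p ^ k"
  by (induction k) (auto simp: subst_mult)

lemma subst_prod: "subst y (\<Prod>i\<in>A. f i) = (\<Prod>i\<in>A. subst y (f i))"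
  by (induction A rule: infinite_finite_induct) (auto simp: subst_mult)

lemma subst_var [simp]: "subst y (var i) = y i"
proof -
  have "(\<Prod>j\<in>UNIV. y j ^ coef (mon i 1) j) = (\<Prod>j\<in>UNIV. if j = i then y j else 1)"
    by (intro prod.cong) (auto simp: lookup_single when_def)
  then show ?thesis by (simp add: var_def subst_mon)
qed

lemma subst_subst: "subst y (subst z p) = subst (\<lambda>i. subst y (z i)) p"
  unfolding subst_def[of z p] subst_def[of "\<lambda>i. subst y (z i)" p]
  by (simp add: subst_sum subst_mult subst_prod subst_power)

lemma var_power: "var i ^ a = mon (mon i a) 1"
  by (induction a) (auto simp: var_def mult_single single_add[symmetric])

lemma prod_mon: "(\<Prod>i\<in>A. mon (f i) 1) = (mon (\<Sum>i\<in>A. f i) 1 :: ('n::finite, 'k::field) pring)"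
  by (induction A rule: infinite_finite_induct) (auto simp: mult_single)

lemma prod_var: "(\<Prod>i\<in>UNIV. var i ^ coef m i) = mon m 1"
  using poly_as_sum[of UNIV m] by (simp add: var_power prod_mon)

lemma subst_id: "subst var p = p"
proof -
  have "subst var p = (\<Sum>m\<in>mono_keys p. mon m (coef p m))"
    by (simp add: subst_def prod_var mult_single)
  also have "\<dots> = p" by (rule poly_as_sum[symmetric]) auto
  finally show ?thesis .
qed

lemma var_form: "var i \<in> forms 1"
  by (simp add: var_def forms_iff)

lemma forms_power: "p \<in> forms t \<Longrightarrow> p ^ k \<in> forms (int k * t)"
  by (induction k) (auto simp: forms_mult distrib_right const_form[of 1, simplified])

lemma forms_sum: "(\<And>i. i \<in> A \<Longrightarrow> f i \<in> forms t) \<Longrightarrow> (\<Sum>i\<in>A. f i) \<in> forms t"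
  by (induction A rule: infinite_finite_induct) (auto simp: forms_add)

lemma forms_prod: "(\<And>i. i \<in> A \<Longrightarrow> f i \<in> forms (t i)) \<Longrightarrow> (\<Prod>i\<in>A. f i) \<in> forms (\<Sum>i\<in>A. t i)"
  by (induction A rule: infinite_finite_induct) (auto simp: forms_mult const_form[of 1, simplified])

lemma subst_mon_form:
  assumes "\<And>i. y i \<in> forms 1" shows "subst y (mon m c) \<in> forms (int (mdeg m))"
proof -
  have "(\<Prod>i\<in>UNIV. y i ^ coef m i) \<in> forms (\<Sum>i\<in>UNIV. int (coef m i) * 1)"
    by (intro forms_prod forms_power assms)
  from forms_mult[OF const_form[of c] this] show ?thesis by (simp add: subst_mon mdeg_def)
qed

lemma subst_as_sum: "subst y p = (\<Sum>m\<in>mono_keys p. subst y (mon m (coef p m)))"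
  by (simp only: subst_mon) (rule subst_def)

text \<open>Graded \<open>k\<close>-algebra endomorphisms, described by behaviour and not by a
  matrix, so that composites and inverses are handled without matrix computations.\<close>

definition lin_hom :: "(('n::finite, 'k::field) pring \<Rightarrow> ('n, 'k) pring) \<Rightarrow> bool" where
  "lin_hom \<sigma> \<longleftrightarrow> (\<forall>p q. \<sigma> (p + q) = \<sigma> p + \<sigma> q) \<and> (\<forall>p q. \<sigma> (p * q) = \<sigma> p * \<sigma> q) \<and>
     (\<forall>c. \<sigma> (mon 0 c) = mon 0 c) \<and> (\<forall>t. \<forall>p\<in>forms t. \<sigma> p \<in> forms t)"

definition lin_aut :: "(('n::finite, 'k::field) pring \<Rightarrow> ('n, 'k) pring) \<Rightarrow> bool" where
  "lin_aut \<sigma> \<longleftrightarrow> lin_hom \<sigma> \<and> bij \<sigma>"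

lemma lin_hom_subst: assumes "\<And>i. y i \<in> forms 1" shows "lin_hom (subst y)"
proof -
  have "subst y p \<in> forms t" if "p \<in> forms t" for t p
    unfolding subst_as_sum[of y p]
    using that subst_mon_form[OF assms] by (intro forms_sum) (auto simp: forms_iff)
  then show ?thesis by (simp add: lin_hom_def subst_add subst_mult)
qed

lemma lin_autD:
  assumes "lin_aut \<sigma>"
  shows "\<sigma> (p + q) = \<sigma> p + \<sigma> q" "\<sigma> (p * q) = \<sigma> p * \<sigma> q" "\<sigma> (mon 0 c) = mon 0 c"
    "p \<in> forms t \<Longrightarrow> \<sigma> p \<in> forms t" "bij \<sigma>" "\<sigma> p = \<sigma> q \<longleftrightarrow> p = q" "\<exists>r. s = \<sigma> r"
  using assms by (auto simp: lin_aut_def lin_hom_def bij_def inj_eq surj_def)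

lemma lin_aut_zero: assumes "lin_aut \<sigma>" shows "\<sigma> 0 = 0" "\<sigma> 1 = 1" "\<sigma> p = 0 \<longleftrightarrow> p = 0"
proof -
  show z: "\<sigma> 0 = 0" and "\<sigma> 1 = 1" using lin_autD(3)[OF assms, of 0] lin_autD(3)[OF assms, of 1] by simp_all
  show "\<sigma> p = 0 \<longleftrightarrow> p = 0" using lin_autD(6)[OF assms, of p 0] z by simp
qed

lemma lin_aut_comp: assumes "lin_aut \<sigma>" "lin_aut \<tau>" shows "lin_aut (\<lambda>p. \<sigma> (\<tau> p))"
  using assms bij_comp[of \<tau> \<sigma>] by (simp add: lin_aut_def lin_hom_def comp_def)

lemma prime_image: assumes s: "lin_aut \<sigma>" and P: "is_prime P" shows "is_prime (\<sigma> ` P)"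
proof -
  have mem: "\<sigma> p \<in> \<sigma> ` P \<longleftrightarrow> p \<in> P" for p using lin_autD(6)[OF s] by auto
  note iP = prime_ideal[OF P]
  show ?thesis unfolding is_prime_def
  proof (intro conjI allI impI)
    show "is_ideal (\<sigma> ` P)"
    proof (rule idl.subspaceI)
      show "0 \<in> \<sigma> ` P" using mem[of 0] idl.subspace_0[OF iP] lin_aut_zero[OF s] by simp
    next
      fix a b assume "a \<in> \<sigma> ` P" "b \<in> \<sigma> ` P"
      then obtain a' b' where "a = \<sigma> a'" "b = \<sigma> b'" "a' \<in> P" "b' \<in> P" by blast
      then show "a + b \<in> \<sigma> ` P"
        using mem[of "a' + b'"] idl.subspace_add[OF iP, of a' b'] lin_autD(1)[OF s] by simp
    next
      fix c a assume "a \<in> \<sigma> ` P"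
      then obtain a' where a: "a = \<sigma> a'" "a' \<in> P" by blast
      obtain c' where c: "c = \<sigma> c'" using lin_autD(7)[OF s] by blast
      show "c * a \<in> \<sigma> ` P"
        using mem[of "c' * a'"] idl.subspace_scale[OF iP a(2), of c'] lin_autD(2)[OF s] a c by simp
    qed
    have "\<sigma> 1 \<notin> \<sigma> ` P" using mem prime_proper[OF P] by simp
    then show "\<sigma> ` P \<noteq> UNIV" by blast
    fix a b assume ab: "a * b \<in> \<sigma> ` P"
    obtain a' b' where a: "a = \<sigma> a'" and b: "b = \<sigma> b'" using lin_autD(7)[OF s] by metis
    have "a' * b' \<in> P" using ab mem[of "a' * b'"] lin_autD(2)[OF s] a b by simp
    then show "a \<in> \<sigma> ` P \<or> b \<in> \<sigma> ` P" using primeD[OF P] mem a b by simp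
  qed
qed

lemma prime_chain_image:
  assumes s: "lin_aut \<sigma>" and c: "prime_chain c m" shows "prime_chain (\<lambda>i. \<sigma> ` c i) m"
  unfolding prime_chain_def
proof (intro conjI allI impI)
  fix i assume "i \<le> m"
  then show "is_prime (\<sigma> ` c i)" using c prime_image[OF s] by (simp add: prime_chain_def)
next
  fix i assume "i < m"
  then have "c i \<subset> c (Suc i)" using c by (simp add: prime_chain_def)
  moreover have "inj \<sigma>" using lin_autD(5)[OF s] by (rule bij_is_inj)
  ultimately show "\<sigma> ` c i \<subset> \<sigma> ` c (Suc i)" by (simp add: inj_image_subset_iff psubset_eq inj_image_eq_iff)
qed

section \<open>Substitutions, supports and monic polynomials\<close>

lemma polys_in_add: "p \<in> polys_in B \<Longrightarrow> q \<in> polys_in B \<Longrightarrow> p + q \<in> polys_in B"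
  using keys_add[of p q] by (force simp: polys_in_def)

lemma polys_in_mult: "p \<in> polys_in B \<Longrightarrow> q \<in> polys_in B \<Longrightarrow> p * q \<in> polys_in B"
  by (auto simp: polys_in_def lookup_add elim!: keys_multE)

lemma polys_in_const: "mon 0 c \<in> polys_in B" and polys_in_one: "1 \<in> polys_in B" and polys_in_zero: "0 \<in> polys_in B"
  by (auto simp: polys_in_def split: if_splits)

lemma polys_in_var: "i \<in> B \<Longrightarrow> var i \<in> polys_in B"
  by (auto simp: polys_in_def var_def lookup_single when_def)

lemma polys_in_power: "p \<in> polys_in B \<Longrightarrow> p ^ k \<in> polys_in B"
  by (induction k) (auto simp: polys_in_mult polys_in_one)

lemma polys_in_prod: "(\<And>i. i \<in> A \<Longrightarrow> f i \<in> polys_in B) \<Longrightarrow> (\<Prod>i\<in>A. f i) \<in> polys_in B"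
  by (induction A rule: infinite_finite_induct) (auto simp: polys_in_mult polys_in_one)

lemma polys_in_sum: "(\<And>i. i \<in> A \<Longrightarrow> f i \<in> polys_in B) \<Longrightarrow> (\<Sum>i\<in>A. f i) \<in> polys_in B"
  by (induction A rule: infinite_finite_induct) (auto simp: polys_in_add polys_in_zero)

lemma subst_polys_in:
  assumes p: "p \<in> polys_in B" and y: "\<And>i. i \<in> B \<Longrightarrow> y i \<in> polys_in B"
  shows "subst y p \<in> polys_in B"
  unfolding subst_def
proof (intro polys_in_sum polys_in_mult polys_in_const polys_in_prod)
  fix m i assume m: "m \<in> mono_keys p"
  show "y i ^ coef m i \<in> polys_in B"
  proof (cases "i \<in> B")
    case True then show ?thesis by (intro polys_in_power y)
  next
    case False
    then have "coef m i = 0" using p m by (simp add: polys_in_def)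
    then show ?thesis by (simp add: polys_in_one)
  qed
qed

lemma coef_subst: "coef (subst y p) l = (\<Sum>m\<in>mono_keys p. coef (subst y (mon m (coef p m))) l)"
  by (subst subst_as_sum) (rule lookup_sum)

lemma keys_substE:
  assumes "l \<in> mono_keys (subst y p)"
  obtains m where "m \<in> mono_keys p" "l \<in> mono_keys (subst y (mon m (coef p m)))"
  using assms unfolding in_keys_iff coef_subst[of y p]
  by (metis (no_types, lifting) in_keys_iff sum.neutral)

lemma keys_subst_coord:
  assumes y: "y i = var i" "\<And>j. j \<noteq> i \<Longrightarrow> y j \<in> polys_in (- {i})"
    and l: "l \<in> mono_keys (subst y (mon m c))"
  shows "coef l i = coef m i"
proof -
  define q where "q = (\<Prod>j\<in>UNIV - {i}. y j ^ coef m j)"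
  have "(\<Prod>j\<in>UNIV. y j ^ coef m j) = y i ^ coef m i * q"
    unfolding q_def by (rule prod.remove) auto
  then have eq: "subst y (mon m c) = mon (mon i (coef m i)) 1 * (mon 0 c * q)"
    by (simp add: subst_mon y(1) var_power mult_ac)
  have q: "mon 0 c * q \<in> polys_in (- {i})" unfolding q_def
    using y(2) by (intro polys_in_mult polys_in_const polys_in_prod polys_in_power) auto
  obtain a b where ab: "l = a + b" "a \<in> mono_keys (mon (mon i (coef m i)) 1 :: ('a, 'b) pring)"
      "b \<in> mono_keys (mon 0 c * q)"
    using l unfolding eq by (rule keys_multE)
  have "a = mon i (coef m i)" using ab(2) by simp
  moreover have "coef b i = 0" using ab(3) q by (simp add: polys_in_def)
  ultimately show ?thesis using ab(1) by (simp add: lookup_add)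
qed

text \<open>Such a substitution preserves the degree in \<open>i\<close> of every monomial. A later
  change in other variables therefore does not spoil a polynomial already made monic in
  \<open>i\<close>.\<close>

lemma monic_subst_other:
  assumes y: "y i = var i" "\<And>j. j \<noteq> i \<Longrightarrow> y j \<in> polys_in (- {i})" and u: "monic_in i a u"
  shows "monic_in i a (subst y u)"
proof -
  let ?m = "mon i a"
  have top: "subst y (mon ?m c) = mon ?m c" for c
  proof -
    have "(\<Prod>j\<in>UNIV. y j ^ coef ?m j) = (\<Prod>j\<in>UNIV. if j = i then y j ^ a else 1)"
      by (intro prod.cong) (auto simp: lookup_single when_def)
    then show ?thesis by (simp add: subst_mon y(1) var_power mult_single)
  qed
  have uk: "coef m i \<le> a" "coef m i = a \<Longrightarrow> m = ?m" if "m \<in> mono_keys u" for m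
    using u that by (auto simp: monic_in_def)
  have u0: "coef u ?m \<noteq> 0" using u by (simp add: monic_in_def)
  have "coef (subst y (mon m (coef u m))) ?m = (if m = ?m then coef u ?m else 0)" if m: "m \<in> mono_keys u" for m
  proof (cases "m = ?m")
    case True then show ?thesis by (simp add: top)
  next
    case False
    then have "coef m i \<noteq> coef ?m i" using uk(2)[OF m] by auto
    then have "?m \<notin> mono_keys (subst y (mon m (coef u m)))" using keys_subst_coord[of y i, OF y] by metis
    then show ?thesis using False by (simp add: coef_notin_keys)
  qed
  then have "coef (subst y u) ?m = (\<Sum>m\<in>mono_keys u. if m = ?m then coef u ?m else 0)"
    unfolding coef_subst[of y u] by (intro sum.cong refl)
  then have c: "coef (subst y u) ?m = coef u ?m" using u0 by (simp add: sum.delta' in_keys_iff)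
  show ?thesis unfolding monic_in_def
  proof (intro conjI ballI impI)
    show "coef (subst y u) ?m \<noteq> 0" using c u0 by simp
    fix l assume "l \<in> mono_keys (subst y u)"
    then obtain m where m: "m \<in> mono_keys u" "l \<in> mono_keys (subst y (mon m (coef u m)))"
      by (rule keys_substE)
    have li: "coef l i = coef m i" by (rule keys_subst_coord[of y i, OF y m(2)])
    then show "coef l i \<le> a" using uk(1)[OF m(1)] by simp
    assume "coef l i = a"
    then have "m = ?m" using uk(2)[OF m(1)] li by simp
    then show "l = ?m" using m(2) by (simp add: top split: if_splits)
  qed
qed

text \<open>On forms, the coefficient of the pure power of the variable \<open>j\<close> is the
  value at the \<open>j\<close>-th coordinate point, hence multiplicative.\<close>

lemma coef_power_top:
  assumes p: "p \<in> forms (int s)" and q: "q \<in> forms (int t)"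
  shows "coef (p * q) (mon j (s + t)) = coef p (mon j s) * coef q (mon j t)"
proof -
  have "l = mon j s \<and> r = mon j t"
    if lr: "l \<in> mono_keys p" "r \<in> mono_keys q" "l + r = mon j s + mon j t" for l r
  proof -
    have d: "mdeg l = s" "mdeg r = t" using p q lr by (auto simp: forms_iff)
    have "coef (l + r) j = s + t" using lr(3) by (simp add: lookup_add)
    then have "coef l j = s" "coef r j = t"
      using coef_le_mdeg[of l j] coef_le_mdeg[of r j] d by (auto simp: lookup_add)
    then show ?thesis using mdeg_eq_coef[of l j] mdeg_eq_coef[of r j] d by simp
  qed
  then have "coef (p * q) (mon j s + mon j t) = coef p (mon j s) * coef q (mon j t)"
    by (rule coef_mult_unique)
  then show ?thesis by (simp add: single_add)
qed

lemma coef_power_top_pow: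
  assumes "p \<in> forms 1" shows "coef (p ^ k) (mon j k) = coef p (mon j 1) ^ k"
proof (induction k)
  case (Suc k)
  have "p ^ k \<in> forms (int k)" using forms_power[OF assms, of k] by simp
  then show ?case using coef_power_top[of p 1 "p ^ k" k j] assms Suc by simp
qed simp

lemma coef_power_top_prod:
  assumes "finite A" "\<And>i. i \<in> A \<Longrightarrow> y i \<in> forms 1"
  shows "coef (\<Prod>i\<in>A. y i ^ e i) (mon j (\<Sum>i\<in>A. e i)) = (\<Prod>i\<in>A. coef (y i) (mon j 1) ^ e i)"
  using assms
proof (induction A)
  case (insert x A)
  have x: "y x ^ e x \<in> forms (int (e x))" using forms_power[of "y x" 1 "e x"] insert by simp
  have "(\<Prod>i\<in>A. y i ^ e i) \<in> forms (\<Sum>i\<in>A. int (e i) * 1)"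
    using insert by (intro forms_prod forms_power) auto
  then have "(\<Prod>i\<in>A. y i ^ e i) \<in> forms (int (\<Sum>i\<in>A. e i))" by simp
  from coef_power_top[OF x this, of j] show ?case
    using insert by (simp add: coef_power_top_pow)
qed simp

text \<open>In characteristic zero the nodes \<open>of_nat (mval m)\<close> are pairwise distinct,
  so this is the Vandermonde argument. The sum is the value of a polynomial with coefficients
  \<open>w\<close> at the point whose coordinates are the \<open>k\<close>-th powers of the primes
  \<open>prime_var i\<close>.\<close>

lemma exists_nonvanishing_power:
  fixes w :: "('n::finite \<Rightarrow>\<^sub>0 nat) \<Rightarrow> 'k::field_char_0"
  assumes T: "finite T" "m0 \<in> T" "w m0 \<noteq> 0"
  shows "\<exists>k. (\<Sum>m\<in>T. w m * of_nat (mval m) ^ k) \<noteq> 0"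
proof (rule ccontr)
  assume no: "\<not> ?thesis"
  let ?z = "\<lambda>m. of_nat (mval m) :: 'k"
  \<comment> \<open>This polynomial vanishes at all nodes except that of \<open>m0\<close>;
    combining the power sums with its coefficients isolates \<open>w m0\<close>.\<close>
  define q where "q = (\<Prod>m\<in>T - {m0}. [:- ?z m, 1:])"
  have "(\<Sum>m\<in>T. w m * poly q (?z m)) = (\<Sum>m\<in>T. \<Sum>k\<le>degree q. w m * (coeff q k * ?z m ^ k))"
    by (simp add: poly_altdef sum_distrib_left)
  also have "\<dots> = (\<Sum>k\<le>degree q. \<Sum>m\<in>T. w m * (coeff q k * ?z m ^ k))" by (rule sum.swap)
  also have "\<dots> = (\<Sum>k\<le>degree q. coeff q k * (\<Sum>m\<in>T. w m * ?z m ^ k))"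
    by (simp add: sum_distrib_left mult_ac)
  also have "\<dots> = 0" using no by simp
  finally have sum0: "(\<Sum>m\<in>T. w m * poly q (?z m)) = 0" .
  have "poly q (?z m) = 0" if "m \<in> T - {m0}" for m
    unfolding q_def poly_prod using T that by (intro prod_zero) auto
  then have "(\<Sum>m\<in>T. w m * poly q (?z m)) = w m0 * poly q (?z m0)"
    using T by (simp add: sum.remove[of T m0])
  moreover have "poly q (?z m0) \<noteq> 0"
    unfolding q_def poly_prod using T by (auto simp: mval_inj)
  ultimately show False using sum0 T(3) by simp
qed

text \<open>Adding multiples \<open>c i\<close> of the variable \<open>j\<close> to the other
  variables of \<open>X\<close> makes the coefficient of the highest power of \<open>j\<close> the
  value at \<open>c\<close> of the top form of \<open>w\<close>. The last two conclusions allow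
  several changes in succession.\<close>

lemma exists_monic_change:
  fixes w :: "('n::finite, 'k::field_char_0) pring"
  assumes w: "w \<noteq> 0" "w \<in> polys_in X" and j: "j \<in> X"
  obtains \<sigma> a where "lin_aut \<sigma>" "monic_in j a (\<sigma> w)"
    "\<And>i b u. i \<notin> X \<Longrightarrow> monic_in i b u \<Longrightarrow> monic_in i b (\<sigma> u)"
    "\<And>Y p. X \<subseteq> Y \<Longrightarrow> p \<in> polys_in Y \<Longrightarrow> \<sigma> p \<in> polys_in Y"
proof -
  define a where "a = Max (mdeg ` mono_keys w)"
  have ne: "mono_keys w \<noteq> {}" using w by simp
  have le: "mdeg m \<le> a" if "m \<in> mono_keys w" for m using that by (simp add: a_def)
  have "a \<in> mdeg ` mono_keys w" unfolding a_def using ne by (intro Max_in) auto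
  then obtain m0 where m0: "m0 \<in> mono_keys w" "mdeg m0 = a" by blast
  let ?T = "{m\<in>mono_keys w. mdeg m = a}"
  obtain k where k: "(\<Sum>m\<in>?T. coef w m * of_nat (mval m) ^ k) \<noteq> 0"
    using exists_nonvanishing_power[of ?T m0 "coef w"] m0 by (auto simp: in_keys_iff)
  \<comment> \<open>The point supplied by the Vandermonde argument. Its \<open>j\<close>-th
    coordinate is a power of a prime, hence nonzero, which makes the substitution invertible with
    inverse \<open>z\<close>.\<close>
  define c :: "'n \<Rightarrow> 'k" where "c = (\<lambda>i. of_nat (prime_var i) ^ k)"
  have cj: "c j \<noteq> 0" using prime_gt_0_nat[OF prime_var(2)[of j]] by (simp add: c_def)
  define y :: "'n \<Rightarrow> ('n, 'k) pring" where
    "y = (\<lambda>i. if i = j then mon 0 (c j) * var j else if i \<in> X then var i + mon 0 (c i) * var j else var i)"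
  define z :: "'n \<Rightarrow> ('n, 'k) pring" where
    "z = (\<lambda>i. if i = j then mon 0 (1 / c j) * var j else if i \<in> X then var i + mon 0 (- c i / c j) * var j else var i)"
  have cf: "mon 0 e * var j \<in> forms 1" for e :: 'k
    using forms_mult[OF const_form var_form, of e j] by simp
  have yf: "y i \<in> forms 1" for i by (simp add: y_def cf var_form forms_add)
  have mm: "mon 0 e * (mon 0 e' * p) = mon 0 (e * e') * p" for e e' :: 'k and p :: "('n, 'k) pring"
    by (simp add: mult_single flip: mult.assoc)
  have "subst y (z i) = var i" for i
    using cj j by (auto simp: z_def subst_mult subst_add y_def mm add.assoc
        distrib_right[symmetric] single_add[symmetric])
  then have yz: "subst y (subst z p) = p" for p by (simp add: subst_subst subst_id)
  have "subst z (y i) = var i" for i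
    using cj j by (auto simp: y_def subst_mult subst_add z_def mm add.assoc
        distrib_right[symmetric] single_add[symmetric])
  then have zy: "subst z (subst y p) = p" for p by (simp add: subst_subst subst_id)
  have "bij (subst y)" by (rule bij_betw_byWitness[of _ "subst z"]) (auto simp: yz zy)
  then have aut: "lin_aut (subst y)" using lin_hom_subst[of y, OF yf] by (simp add: lin_aut_def)
  have "coef (subst y (mon m (coef w m))) (mon j a) =
      (if mdeg m = a then coef w m * of_nat (mval m) ^ k else 0)" if m: "m \<in> mono_keys w" for m
  proof (cases "mdeg m = a")
    case True
    have pf: "(\<Prod>i\<in>UNIV. y i ^ coef m i) \<in> forms (\<Sum>i\<in>UNIV. int (coef m i) * 1)"
      by (intro forms_prod forms_power yf)
    then have pf: "(\<Prod>i\<in>UNIV. y i ^ coef m i) \<in> forms (int a)"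
      using True by (simp add: mdeg_def flip: of_nat_sum)
    have "coef (\<Prod>i\<in>UNIV. y i ^ coef m i) (mon j a) = (\<Prod>i\<in>UNIV. coef (y i) (mon j 1) ^ coef m i)"
      using coef_power_top_prod[of UNIV y "coef m" j] yf True by (simp add: mdeg_def)
    also have "\<dots> = (\<Prod>i\<in>UNIV. c i ^ coef m i)"
    proof (rule prod.cong)
      fix i
      have v: "coef (var i' :: ('n, 'k) pring) (mon j 1) = (if i' = j then 1 else 0)" for i'
        by (auto simp: var_def lookup_single when_def dest!: arg_cong[where f = mono_keys])
      have mv: "coef (mon 0 e * p) l = e * coef p l" for e :: 'k and p :: "('n, 'k) pring" and l
        using coef_mono_mult[of 0 e p l] by simp
      show "coef (y i) (mon j 1) ^ coef m i = c i ^ coef m i"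
      proof (cases "i \<in> X")
        case True
        then have "coef (y i) (mon j 1) = c i" by (simp add: y_def lookup_add mv v del: One_nat_def)
        then show ?thesis by simp
      next
        case False
        then have "coef m i = 0" using w(2) m by (simp add: polys_in_def)
        then show ?thesis by simp
      qed
    qed simp
    also have "\<dots> = of_nat (mval m) ^ k"
      by (simp add: c_def mval_def prod_power_distrib power_mult[symmetric] mult.commute)
    finally have "coef (\<Prod>i\<in>UNIV. y i ^ coef m i) (mon j a) = of_nat (mval m) ^ k" .
    then show ?thesis using True coef_mono_mult[of 0 "coef w m" "\<Prod>i\<in>UNIV. y i ^ coef m i" "mon j a"]
      by (simp add: subst_mon)
  next
    case False
    have "subst y (mon m (coef w m)) \<in> forms (int (mdeg m))" by (rule subst_mon_form[OF yf])
    then have "mon j a \<notin> mono_keys (subst y (mon m (coef w m)))" using False by (auto simp: forms_iff)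
    then show ?thesis using False by (simp add: coef_notin_keys)
  qed
  then have "coef (subst y w) (mon j a) = (\<Sum>m\<in>mono_keys w. if mdeg m = a then coef w m * of_nat (mval m) ^ k else 0)"
    unfolding coef_subst[of y w] by (intro sum.cong refl)
  also have "\<dots> = (\<Sum>m\<in>?T. coef w m * of_nat (mval m) ^ k)"
    by (rule sum.inter_filter[symmetric]) simp
  finally have top: "coef (subst y w) (mon j a) \<noteq> 0" using k by simp
  have "coef l j \<le> a \<and> (coef l j = a \<longrightarrow> l = mon j a)" if l: "l \<in> mono_keys (subst y w)" for l
  proof -
    obtain m where m: "m \<in> mono_keys w" "l \<in> mono_keys (subst y (mon m (coef w m)))"
      using l by (rule keys_substE)
    have "mdeg l = mdeg m" using subst_mon_form[of y m "coef w m", OF yf] m(2) by (auto simp: forms_iff)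
    then have la: "mdeg l \<le> a" using le[OF m(1)] by simp
    have lj: "coef l j \<le> mdeg l" by (rule coef_le_mdeg)
    have "l = mon j a" if "coef l j = a"
    proof -
      have "mdeg l = a" using la lj that by simp
      then show ?thesis using mdeg_eq_coef[of l j] that by simp
    qed
    then show ?thesis using la lj by simp
  qed
  then have monic: "monic_in j a (subst y w)" using top by (simp add: monic_in_def)
  have other: "monic_in i b (subst y u)" if i: "i \<notin> X" "monic_in i b u" for i b u
  proof (rule monic_subst_other)
    show "y i = var i" using i j by (auto simp: y_def)
    fix i' assume "i' \<noteq> i"
    moreover have "j \<noteq> i" using i j by auto
    ultimately show "y i' \<in> polys_in (- {i})"
      by (simp add: y_def polys_in_add polys_in_mult polys_in_const polys_in_var)
  qed (rule i)
  have pin: "subst y p \<in> polys_in Y" if Y: "X \<subseteq> Y" "p \<in> polys_in Y" for Y p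
  proof (rule subst_polys_in[OF Y(2)])
    fix i assume "i \<in> Y"
    moreover have "j \<in> Y" using j Y by auto
    ultimately show "y i \<in> polys_in Y"
      by (simp add: y_def polys_in_add polys_in_mult polys_in_const polys_in_var)
  qed
  show ?thesis using aut monic other pin by (rule that)
qed

section \<open>Heights of associated primes\<close>

lemma lin_aut_sum: "lin_aut \<sigma> \<Longrightarrow> \<sigma> (\<Sum>i\<in>A. f i) = (\<Sum>i\<in>A. \<sigma> (f i))"
  by (induction A rule: infinite_finite_induct) (auto simp: lin_aut_zero lin_autD(1))

lemma lin_aut_hcomp: assumes "lin_aut \<sigma>" shows "hcomp s (\<sigma> q) = \<sigma> (hcomp s q)"
proof -
  let ?T = "insert s ((\<lambda>m. int (mdeg m)) ` mono_keys q)"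
  have "q = (\<Sum>t\<in>?T. hcomp t q)" by (rule hcomp_sum_self) auto
  then have "\<sigma> q = \<sigma> (\<Sum>t\<in>?T. hcomp t q)" by simp
  then have "hcomp s (\<sigma> q) = (\<Sum>t\<in>?T. hcomp s (\<sigma> (hcomp t q)))"
    by (simp only: lin_aut_sum[OF assms] hcomp_sum)
  also have "\<dots> = (\<Sum>t\<in>?T. if t = s then \<sigma> (hcomp s q) else 0)"
    using hcomp_form[OF lin_autD(4)[OF assms hcomp_in_forms]] by (intro sum.cong refl) auto
  also have "\<dots> = \<sigma> (hcomp s q)" by (simp add: sum.delta)
  finally show ?thesis .
qed

text \<open>That the inverse also preserves degrees follows because \<open>\<sigma>\<close> commutes
  with taking homogeneous components.\<close>

lemma lin_aut_inv:
  fixes \<sigma> :: "('n::finite, 'k::field) pring \<Rightarrow> ('n, 'k) pring"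
  assumes a: "lin_aut \<sigma>" shows "lin_aut (inv \<sigma>)" "inv \<sigma> (\<sigma> p) = p" "\<sigma> (inv \<sigma> p) = p"
proof -
  have b: "bij \<sigma>" using lin_autD(5)[OF a] .
  show "inv \<sigma> (\<sigma> p) = p" and rr: "\<sigma> (inv \<sigma> p) = p" for p
    using b by (simp_all add: bij_is_inj bij_is_surj inv_f_f surj_f_inv_f)
  have eqI: "\<sigma> x = \<sigma> y \<Longrightarrow> x = y" for x y using lin_autD(6)[OF a] by blast
  show "lin_aut (inv \<sigma>)" unfolding lin_aut_def lin_hom_def
  proof (intro conjI allI ballI)
    show "inv \<sigma> (p + q) = inv \<sigma> p + inv \<sigma> q" for p q by (rule eqI) (simp add: rr lin_autD(1)[OF a])
    show "inv \<sigma> (p * q) = inv \<sigma> p * inv \<sigma> q" for p q by (rule eqI) (simp add: rr lin_autD(2)[OF a])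
    show "inv \<sigma> (mon 0 c) = mon 0 c" for c by (rule eqI) (simp add: rr lin_autD(3)[OF a])
    show "bij (inv \<sigma>)" using b by (rule bij_imp_bij_inv)
    fix t and p :: "('n, 'k) pring" assume "p \<in> forms t"
    then have "\<sigma> (hcomp t (inv \<sigma> p)) = \<sigma> (inv \<sigma> p)"
      using lin_aut_hcomp[OF a, of t "inv \<sigma> p"] by (simp add: rr form_iff_hcomp)
    then show "inv \<sigma> p \<in> forms t" unfolding form_iff_hcomp by (rule eqI)
  qed
qed

lemma card_compl_single: "card (- {i :: 'n::finite}) = CARD('n) - 1"
  and card_compl_pair: "i \<noteq> j \<Longrightarrow> card (- {i, j :: 'n::finite}) = CARD('n) - 2"
  by (simp_all add: Compl_eq_Diff_UNIV card_Diff_subset)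

lemma zero_cancel: "u \<noteq> 0 \<Longrightarrow> u * g = 0 \<Longrightarrow> g = 0" for u :: "('n::finite, 'k::field) pring"
  by (simp add: pring_mult_eq_0_iff)

text \<open>With \<open>h\<close> monic in one variable, R/(\<open>h\<close>) is torsion-free over
  the other variables. The annihilator of a nonzero class then contains no nonzero polynomial in
  them, and the chain count applies.\<close>

lemma principal_associated_prime:
  fixes h :: "('n::finite, 'k::field_char_0) pring"
  assumes h: "h \<noteq> 0" and P: "is_prime (colon (adjoin {0} h) g)" and c: "prime_chain c m" "c m = colon (adjoin {0} h) g"
  shows "m \<le> 1"
proof -
  obtain j :: 'n where True by simp
  have "h \<in> polys_in UNIV" by (simp add: polys_in_def)
  from exists_monic_change[OF h this UNIV_I, of j] obtain \<sigma> a
    where s: "lin_aut \<sigma>" and mo: "monic_in j a (\<sigma> h)" by metis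
  note hom = lin_autD(2)[OF s]
  have g: "g \<notin> adjoin {0} h" using prime_proper[OF P] by simp
  have "\<sigma> ` c m \<inter> polys_in (- {j}) \<subseteq> {0}"
  proof
    fix x assume x: "x \<in> \<sigma> ` c m \<inter> polys_in (- {j})"
    then obtain p where p: "x = \<sigma> p" "p * g \<in> adjoin {0} h" using c(2) by auto
    then obtain k where "p * g = h * k" by (auto simp: in_adjoin_zero)
    then have e: "x * \<sigma> g = \<sigma> h * \<sigma> k" using p(1) hom by metis
    show "x \<in> {0}"
    proof (rule ccontr)
      assume "x \<notin> {0}"
      then obtain q where "\<sigma> g = \<sigma> h * q" using monic_torsion_free[OF mo _ _ e] x by blast
      then have "\<sigma> g = \<sigma> (h * q')" if "q = \<sigma> q'" for q' using that hom by simp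
      then have "g \<in> adjoin {0} h"
        using lin_autD(7)[OF s, of q] lin_autD(6)[OF s] by (auto simp: in_adjoin_zero)
      then show False using g by simp
    qed
  qed
  from prime_chain_bound[OF prime_chain_image[OF s c(1)] this]
  show ?thesis by (simp add: card_compl_single)
qed

section \<open>Regular sequences of length two\<close>

definition regular_pair :: "('n::finite, 'k::field) pring \<Rightarrow> ('n, 'k) pring \<Rightarrow> bool" where
  "regular_pair u v \<longleftrightarrow> u \<noteq> 0 \<and> (\<forall>g k. v * g = u * k \<longrightarrow> (\<exists>q. g = u * q))"

lemma regular_pairD:
  assumes "regular_pair u v"
  shows "u \<noteq> 0" "v * g = u * k \<Longrightarrow> \<exists>q. g = u * q" "v * g \<in> adjoin {0} u \<Longrightarrow> g \<in> adjoin {0} u"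
  using assms by (auto simp: regular_pair_def in_adjoin_zero)

lemma regular_pair_chain:
  fixes u v :: "('n::finite, 'k::field) pring"
  assumes "regular_pair u v" "is_prime P" "u \<in> P" "v \<in> P"
  shows "\<exists>c. prime_chain c 2 \<and> c 2 = P"
  by (rule prime_chain_regular_pair[OF noetherian_pring assms(2-4)])
    (use regular_pairD[OF assms(1)] zero_cancel in auto)

lemma regular_pair_image:
  assumes s: "lin_aut \<sigma>" and r: "regular_pair u v" shows "regular_pair (\<sigma> u) (\<sigma> v)"
  unfolding regular_pair_def
proof (intro conjI allI impI)
  show "\<sigma> u \<noteq> 0" using regular_pairD(1)[OF r] lin_aut_zero(3)[OF s] by simp
  fix g k assume e: "\<sigma> v * g = \<sigma> u * k"
  obtain g' k' where gk: "g = \<sigma> g'" "k = \<sigma> k'" using lin_autD(7)[OF s] by metis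
  have "\<sigma> (v * g') = \<sigma> (u * k')" using e gk lin_autD(2)[OF s] by simp
  then have "v * g' = u * k'" using lin_autD(6)[OF s] by blast
  then obtain q where "g' = u * q" using regular_pairD(2)[OF r] by blast
  then show "\<exists>q. g = \<sigma> u * q" using gk lin_autD(2)[OF s] by blast
qed

text \<open>This takes the place of a resultant. Without such a \<open>D\<close>, some prime over
  \<open>u\<close> and \<open>v\<close> would avoid all nonzero polynomials in one variable fewer;
  the chain of length two below it would then be too long.\<close>

lemma elimination_exists:
  fixes u v :: "('n::finite, 'k::field_char_0) pring"
  assumes r: "regular_pair u v"
  shows "\<exists>D. D \<noteq> 0 \<and> D \<in> polys_in (- {i}) \<and> (\<exists>k l. D = u * k + v * l)"
proof (rule ccontr)
  assume no: "\<not> ?thesis"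
  let ?I = "adjoin (adjoin {0} u) v" and ?S = "polys_in (- {i}) - {0}"
  have iI: "is_ideal ?I" by (intro ideal_adjoin ideal_zero)
  have dis: "?I \<inter> ?S = {}" using no by (auto simp: in_adjoin_pair)
  have "(1 :: ('n, 'k) pring) \<in> ?S" by (simp add: polys_in_one)
  moreover have "a * b \<in> ?S" if "a \<in> ?S" "b \<in> ?S" for a b
    using that by (simp add: polys_in_mult pring_mult_eq_0_iff)
  ultimately obtain P where P: "is_prime P" "?I \<subseteq> P" "P \<inter> ?S = {}"
    using exists_prime_disjoint[OF noetherian_pring iI dis] by metis
  have "u * 1 + v * 0 \<in> ?I" "u * 0 + v * 1 \<in> ?I" unfolding in_adjoin_pair by blast+
  then have "u \<in> P" "v \<in> P" using P(2) by auto
  then obtain c where c: "prime_chain c 2" "c 2 = P" using regular_pair_chain[OF r P(1)] by blast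
  have "c 2 \<inter> polys_in (- {i}) \<subseteq> {0}" using P(3) c(2) by blast
  from prime_chain_bound[OF c(1) this] show False
    by (simp add: card_compl_single)
qed

text \<open>Since \<open>v\<close> cannot be made monic modulo \<open>u\<close> directly, it is
  replaced by an eliminant \<open>D'\<close> made monic in a second variable. Multiplication by
  \<open>w\<close>, the cofactor of \<open>\<rho> v\<close> in \<open>D'\<close>, embeds
  R/(\<open>\<rho> u\<close>, \<open>\<rho> v\<close>) into R/(\<open>\<rho> u\<close>,
  \<open>D'\<close>), which is torsion-free over the remaining variables.\<close>

lemma pair_associated_prime:
  fixes u v :: "('n::finite, 'k::field_char_0) pring"
  assumes n: "CARD('n) \<ge> 2" and r: "regular_pair u v"
    and P: "is_prime (colon (adjoin (adjoin {0} u) v) g)"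
    and c: "prime_chain c m" "c m = colon (adjoin (adjoin {0} u) v) g"
  shows "m \<le> 2"
proof -
  obtain i j :: 'n where ij: "i \<noteq> j"
    using n by (metis One_nat_def card_1_singleton_iff card_le_Suc0_iff_eq finite_class.finite_UNIV
        iso_tuple_UNIV_I not_less_eq_eq numeral_2_eq_2)
  have u0: "u \<noteq> 0" using regular_pairD(1)[OF r] .
  have "u \<in> polys_in UNIV" by (simp add: polys_in_def)
  from exists_monic_change[OF u0 this UNIV_I, of i] obtain \<sigma> a
    where s: "lin_aut \<sigma>" and mo: "monic_in i a (\<sigma> u)" by metis
  obtain D k l where D: "D \<noteq> 0" "D \<in> polys_in (- {i})" "D = \<sigma> u * k + \<sigma> v * l"
    using elimination_exists[OF regular_pair_image[OF s r]] by metis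
  have jc: "j \<in> - {i}" using ij by simp
  obtain \<tau> b where t: "lin_aut \<tau>" and tm: "monic_in j b (\<tau> D)"
    and to: "\<And>i' b u. i' \<notin> - {i} \<Longrightarrow> monic_in i' b u \<Longrightarrow> monic_in i' b (\<tau> u)"
    and tp: "\<And>Y p. - {i} \<subseteq> Y \<Longrightarrow> p \<in> polys_in Y \<Longrightarrow> \<tau> p \<in> polys_in Y"
    using exists_monic_change[OF D(1,2) jc] by metis
  define \<rho> where "\<rho> = (\<lambda>p. \<tau> (\<sigma> p))"
  have ra: "lin_aut \<rho>" unfolding \<rho>_def by (rule lin_aut_comp[OF t s])
  have um: "monic_in i a (\<rho> u)" unfolding \<rho>_def using mo by (intro to) simp
  define D' where "D' = \<tau> D"
  have D': "D' \<noteq> 0" "monic_in j b D'" "D' \<in> polys_in (- {i})"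
    using monic_nonzero[OF tm] tm tp[OF subset_refl D(2)] by (simp_all add: D'_def)
  define w where "w = \<tau> l"
  have Deq: "D' = \<rho> u * \<tau> k + \<rho> v * w"
    unfolding D'_def \<rho>_def w_def by (simp add: D(3) lin_autD(1,2)[OF t])
  have g: "g \<notin> adjoin (adjoin {0} u) v" using prime_proper[OF P] by simp
  have "\<rho> ` c m \<inter> polys_in (- {i, j}) \<subseteq> {0}"
  proof
    fix x assume x: "x \<in> \<rho> ` c m \<inter> polys_in (- {i, j})"
    then obtain p where p: "x = \<rho> p" "p * g \<in> adjoin (adjoin {0} u) v" using c(2) by auto
    then obtain y z where "p * g = u * y + v * z" by (auto simp: in_adjoin_pair)
    then have e: "x * \<rho> g = \<rho> u * \<rho> y + \<rho> v * \<rho> z"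
      using p(1) lin_autD(1,2)[OF ra] by metis
    show "x \<in> {0}"
    proof (rule ccontr)
      assume x0: "x \<notin> {0}"
      \<comment> \<open>Multiplying by \<open>w\<close> turns membership in the ideal of
        \<open>\<rho> u\<close> and \<open>\<rho> v\<close> into membership in that of
        \<open>\<rho> u\<close> and \<open>D'\<close>, from which \<open>x\<close> can be
        cancelled.\<close>
      have "x * (\<rho> g * w) = (x * \<rho> g) * w" by (simp add: mult.assoc)
      also have "\<dots> = \<rho> u * (\<rho> y * w - \<tau> k * \<rho> z) + D' * \<rho> z"
        unfolding e Deq by (simp add: algebra_simps)
      finally obtain k1 l1 where kl: "\<rho> g * w = \<rho> u * k1 + D' * l1"
        using monic_pair_torsion_free[OF um D'(2,3) _ _] x x0 by blast
      \<comment> \<open>Injectivity of the embedding: modulo \<open>\<rho> u\<close>,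
        \<open>D'\<close> equals \<open>\<rho> v * w\<close>, so \<open>D' * \<rho> g\<close> and
        \<open>D' * \<rho> v * l1\<close> agree. The factor \<open>D'\<close> can then be
        cancelled.\<close>
      have "D' * (\<rho> g - \<rho> v * l1) = \<rho> u * (\<tau> k * (\<rho> g - \<rho> v * l1)) + \<rho> v * (\<rho> g * w) - \<rho> v * \<rho> v * l1 * w"
        by (subst Deq) (simp add: algebra_simps)
      also have "\<dots> = \<rho> u * (\<tau> k * (\<rho> g - \<rho> v * l1) + \<rho> v * k1 + \<rho> v * (\<tau> k * l1))"
        unfolding kl by (simp add: Deq algebra_simps)
      finally obtain q where q: "\<rho> g - \<rho> v * l1 = \<rho> u * q"
        using monic_torsion_free[OF um D'(3,1)] by blast
      obtain q' l' where "q = \<rho> q'" "l1 = \<rho> l'" using lin_autD(7)[OF ra] by metis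
      then have "\<rho> g = \<rho> (u * q' + v * l')"
        using q lin_autD(1,2)[OF ra] by (simp add: algebra_simps)
      then have "g = u * q' + v * l'" using lin_autD(6)[OF ra] by blast
      then show False using g by (auto simp: in_adjoin_pair)
    qed
  qed
  from prime_chain_bound[OF prime_chain_image[OF ra c(1)] this]
  show ?thesis using n by (simp add: card_compl_pair[OF ij])
qed

text \<open>Krull's principal ideal theorem, obtained from an associated prime of the ideal.\<close>

lemma height_principal:
  fixes h :: "('n::finite, 'k::field_char_0) pring"
  assumes h: "h \<noteq> 0" "1 \<notin> adjoin {0} h" shows "height (adjoin {0} h) \<le> 1"
proof -
  let ?I = "adjoin {0} h"
  have iI: "is_ideal ?I" by (intro ideal_adjoin ideal_zero)
  obtain M where M: "is_prime M" "?I \<subseteq> M"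
    using exists_prime_disjoint[OF noetherian_pring iI, of "{1}"] h(2) by auto
  have "colon ?I 1 \<subseteq> M" using M by auto
  then obtain r where r: "is_prime (colon ?I (r * 1))"
    using exists_prime_colon[OF noetherian_pring iI M(1)] by blast
  have "height ?I \<le> prime_height_over {0} (colon ?I (r * 1))"
    by (rule height_le[OF r subset_colon[OF iI]])
  also have "\<dots> \<le> enat 1"
    by (rule prime_height_over_le) (rule principal_associated_prime[OF h(1) r])
  finally show ?thesis by (simp add: one_enat_def)
qed

lemma height_zero_ideal: "height ({0} :: ('n::finite, 'k::field) pring set) \<le> 1"
proof -
  have "height ({0} :: ('n, 'k) pring set) \<le> prime_height_over {0} ({0} :: ('n, 'k) pring set)"
    by (rule height_le[OF prime_zero_ideal]) simp
  also have "\<dots> \<le> enat 1"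
  proof (rule prime_height_over_le)
    fix c :: "nat \<Rightarrow> ('n, 'k) pring set" and m
    assume c: "prime_chain c m" "c m = {0}"
    show "m \<le> 1"
    proof (rule ccontr)
      assume "\<not> m \<le> 1"
      then have "m - 1 < m" "Suc (m - 1) = m" by auto
      then have "c (m - 1) \<subset> {0}" "is_prime (c (m - 1))"
        using c unfolding prime_chain_def by (metis, simp)
      then show False using prime_contains_zero[of "c (m - 1)"] by blast
    qed
  qed
  finally show ?thesis by (simp add: one_enat_def)
qed

lemma height_pair_prime:
  fixes u v :: "('n::finite, 'k::field_char_0) pring"
  assumes n: "CARD('n) \<ge> 2" and r: "regular_pair u v"
    and P: "is_prime (colon (adjoin (adjoin {0} u) v) g)"
  shows "height (colon (adjoin (adjoin {0} u) v) g) = 2"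
    and "height (adjoin (adjoin {0} u) v) = 2"
proof -
  let ?I = "adjoin (adjoin {0} u) v"
  let ?P = "colon ?I g"
  have iI: "is_ideal ?I" by (intro ideal_adjoin ideal_zero)
  have IP: "?I \<subseteq> ?P" by (rule subset_colon[OF iI])
  have "u * 1 + v * 0 \<in> ?I" "u * 0 + v * 1 \<in> ?I" unfolding in_adjoin_pair by blast+
  then have uv: "u \<in> ?I" "v \<in> ?I" by simp_all
  have ge: "enat 2 \<le> height K" if "?I \<subseteq> K" for K
  proof (rule height_ge)
    fix Q assume "is_prime Q" "K \<subseteq> Q"
    then show "\<exists>c. prime_chain c 2 \<and> c 2 = Q" using regular_pair_chain[OF r] uv that by blast
  qed
  have "prime_height_over {0} ?P \<le> enat 2"
    by (rule prime_height_over_le) (rule pair_associated_prime[OF n r P])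
  then have "height ?P \<le> enat 2" "height ?I \<le> enat 2"
    using height_le[OF P subset_refl] height_le[OF P IP] by (auto intro: order_trans)
  then show "height ?P = 2" "height ?I = 2"
    using ge[OF IP] ge[OF subset_refl] by (auto simp: numeral_eq_enat)
qed

lemma height_unmixed_pair:
  fixes u v :: "('n::finite, 'k::field_char_0) pring"
  assumes n: "CARD('n) \<ge> 2" and r: "regular_pair u v" and irr: "u \<in> irrelevant" "v \<in> irrelevant"
  shows "height (adjoin (adjoin {0} u) v) = 2" "unmixed (adjoin (adjoin {0} u) v)"
proof -
  let ?I = "adjoin (adjoin {0} u) v"
  have iI: "is_ideal ?I" by (intro ideal_adjoin ideal_zero)
  have "?I \<subseteq> irrelevant"
    using irr ideal_irrelevant prime_contains_zero[OF prime_irrelevant]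
    by (intro adjoin_least) auto
  then have "colon ?I 1 \<subseteq> irrelevant" by auto
  then obtain q where "is_prime (colon ?I (q * 1))"
    using exists_prime_colon[OF noetherian_pring iI prime_irrelevant] by blast
  then show h: "height ?I = 2" by (rule height_pair_prime(2)[OF n r])
  show "unmixed ?I" unfolding unmixed_def associated_primes_def
  proof clarify
    fix g assume "is_prime {r. r * g \<in> ?I}"
    then show "height {r. r * g \<in> ?I} = height ?I"
      using height_pair_prime(1)[OF n r, of g] h by (simp add: colon_def)
  qed
qed

text \<open>Otherwise two successive coordinate changes produce a regular sequence of length three in \<open>Q\<close>.\<close>

lemma height_two_independent_variables:
  fixes Q :: "('n::finite, 'k::field_char_0) pring set"
  assumes n: "CARD('n) \<ge> 3" and Q: "is_prime Q" and ht: "\<And>c m. prime_chain c m \<Longrightarrow> c m = Q \<Longrightarrow> m \<le> 2"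
  shows "\<exists>\<sigma> B. lin_aut \<sigma> \<and> card B = CARD('n) - 2 \<and> \<sigma> ` Q \<inter> polys_in B \<subseteq> {0}"
proof (rule ccontr)
  assume no: "\<not> ?thesis"
  obtain T :: "'n set" where "card T = 3" using n by (metis obtain_subset_with_card_n)
  then obtain x y z :: 'n where xyz: "x \<noteq> y" "x \<noteq> z" "y \<noteq> z" by (metis card_3_iff)
  have ex: "\<exists>w\<in>Q. \<sigma> w \<in> polys_in (- {i, j}) \<and> \<sigma> w \<noteq> 0"
    if s: "lin_aut \<sigma>" and ij: "i \<noteq> j" for \<sigma> and i j :: 'n
    using no s card_compl_pair[OF ij] by blast
  have idaut: "lin_aut (\<lambda>p. p)" by (auto simp: lin_aut_def lin_hom_def bij_def)
  \<comment> \<open>Each element is chosen after the previous coordinate change. \<open>w1\<close>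
    becomes monic in \<open>z\<close>; \<open>w2\<close>, free of \<open>z\<close>, becomes monic in
    \<open>y\<close> without disturbing \<open>w1\<close>; \<open>w3\<close> is free of both. The
    torsion-freeness lemmas make the images a regular sequence.\<close>
  obtain w1 where w1: "w1 \<in> Q" "w1 \<in> polys_in (- {x, y})" "w1 \<noteq> 0" using ex[OF idaut xyz(1)] by blast
  have zX: "z \<in> - {x, y}" using xyz by simp
  obtain \<sigma> a where s: "lin_aut \<sigma>" and sm: "monic_in z a (\<sigma> w1)"
    and sp: "\<And>Y p. - {x, y} \<subseteq> Y \<Longrightarrow> p \<in> polys_in Y \<Longrightarrow> \<sigma> p \<in> polys_in Y"
    using exists_monic_change[OF w1(3,2) zX] by metis
  obtain w2 where w2: "w2 \<in> Q" "\<sigma> w2 \<in> polys_in (- {x, z})" "\<sigma> w2 \<noteq> 0" using ex[OF s xyz(2)] by blast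
  have yX: "y \<in> - {x, z}" using xyz by simp
  obtain \<tau> b where t: "lin_aut \<tau>" and tm: "monic_in y b (\<tau> (\<sigma> w2))"
    and to: "\<And>i b u. i \<notin> - {x, z} \<Longrightarrow> monic_in i b u \<Longrightarrow> monic_in i b (\<tau> u)"
    and tp: "\<And>Y p. - {x, z} \<subseteq> Y \<Longrightarrow> p \<in> polys_in Y \<Longrightarrow> \<tau> p \<in> polys_in Y"
    using exists_monic_change[OF w2(3,2) yX] by metis
  define \<rho> where "\<rho> = (\<lambda>p. \<tau> (\<sigma> p))"
  have ra: "lin_aut \<rho>" unfolding \<rho>_def by (rule lin_aut_comp[OF t s])
  obtain w3 where w3: "w3 \<in> Q" "\<rho> w3 \<in> polys_in (- {z, y})" "\<rho> w3 \<noteq> 0"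
    using ex[OF ra, of z y] xyz by blast
  have m1: "monic_in z a (\<rho> w1)" unfolding \<rho>_def by (rule to[OF _ sm]) simp
  have m2: "monic_in y b (\<rho> w2)" using tm by (simp add: \<rho>_def)
  have p2: "\<rho> w2 \<in> polys_in (- {z})"
    using tp[OF subset_refl w2(2)] polys_in_mono[of "- {x, z}" "- {z}"] by (auto simp: \<rho>_def)
  have "is_prime (\<rho> ` Q)" by (rule prime_image[OF ra Q])
  have "\<exists>c. prime_chain c 3 \<and> c 3 = \<rho> ` Q"
  proof (rule prime_chain_regular_triple[OF noetherian_pring])
    show "\<rho> w1 \<in> \<rho> ` Q" "\<rho> w2 \<in> \<rho> ` Q" "\<rho> w3 \<in> \<rho> ` Q" using w1 w2 w3 by auto
    show "\<rho> w1 * g = 0 \<Longrightarrow> g = 0" for g using zero_cancel monic_nonzero[OF m1] by blast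
    show "\<rho> w2 * g \<in> adjoin {0} (\<rho> w1) \<Longrightarrow> g \<in> adjoin {0} (\<rho> w1)" for g
      unfolding in_adjoin_zero using monic_torsion_free[OF m1 p2 monic_nonzero[OF m2]] by blast
    show "\<rho> w3 * g \<in> adjoin (adjoin {0} (\<rho> w1)) (\<rho> w2) \<Longrightarrow> g \<in> adjoin (adjoin {0} (\<rho> w1)) (\<rho> w2)" for g
      unfolding in_adjoin_pair using monic_pair_torsion_free[OF m1 m2 p2 w3(2,3)] by blast
  qed fact
  then obtain c where c: "prime_chain c 3" "c 3 = \<rho> ` Q" by blast
  \<comment> \<open>The bound \<open>ht\<close> concerns \<open>Q\<close> itself, so the chain is
    carried back by the inverse automorphism.\<close>
  have "prime_chain (\<lambda>i. inv \<rho> ` c i) 3" by (rule prime_chain_image[OF lin_aut_inv(1)[OF ra] c(1)])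
  moreover have "inv \<rho> ` c 3 = Q" unfolding c(2) image_image lin_aut_inv(2)[OF ra] by simp
  ultimately have "(3::nat) \<le> 2" by (rule ht)
  then show False by simp
qed

section \<open>Hilbert functions\<close>

lemma forms_supported: "forms (int t) = supported {m. mdeg m = t}"
  by (auto simp: forms_iff supported_def)

lemma finite_mdeg: "finite {m. mdeg m = t}"
  by (rule finite_subset[OF _ finite_box[of t]]) (auto simp: box_def intro: order_trans[OF coef_le_mdeg])

lemma fin_span_forms: "psc.fin_span (forms (int t))"
  unfolding forms_supported by (rule fin_span_supported[OF finite_mdeg])

lemma subspace_forms: "psc.subspace (forms (int t))"
  unfolding forms_supported by (rule subspace_supported)

definition hilb :: "('n::finite, 'k::field) pring set \<Rightarrow> nat \<Rightarrow> int" where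
  "hilb K t = codim_in (forms (int t)) K"

lemma hilb_nonneg: "hilb K t \<ge> 0"
  unfolding hilb_def by (rule codim_in_nonneg[OF fin_span_forms])

lemma hilbert_function_hilb: "int (hilbert_function K t) = hilb K t"
  using hilb_nonneg[of K t] by (simp add: hilbert_function_def hilb_def codim_in_def Int_commute)

lemma hilb_antimono: assumes "K \<subseteq> L" shows "hilb L t \<le> hilb K t"
proof -
  have "forms (int t) \<inter> K \<subseteq> forms (int t) \<inter> L" using assms by blast
  then have "psc.dim (forms (int t) \<inter> K) \<le> psc.dim (forms (int t) \<inter> L)"
    by (rule psc.fin_span_dim_mono) (rule psc.fin_span_subset[OF Int_lower1 fin_span_forms])
  then show ?thesis by (simp add: hilb_def codim_in_def)
qed

lemma hilb_full: "forms (int t) \<subseteq> K \<Longrightarrow> hilb K t = 0"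
  by (simp add: hilb_def codim_in_def Int_absorb2)

lemma hilb_adjoin_low:
  assumes K: "graded K" and a: "a \<in> forms (int e)" and t: "t < e"
  shows "hilb (adjoin K a) t = hilb K t"
proof -
  have "p \<in> K" if p: "p \<in> forms (int t)" "p \<in> adjoin K a" for p
  proof -
    obtain k where "p - k * a \<in> K" using p(2) by (rule adjoinE)
    then have "hcomp (int t) (p - a * k) \<in> K" using gradedD(2)[OF K] by (simp add: mult.commute)
    moreover have "hcomp (int t - int e) k = 0"
      using forms_negative[OF hcomp_in_forms] t by (intro forms_negative[OF hcomp_in_forms]) simp
    ultimately show ?thesis using p(1) by (simp add: hcomp_diff hcomp_mult_form[OF a] form_iff_hcomp)
  qed
  then have "forms (int t) \<inter> adjoin K a = forms (int t) \<inter> K" using subset_adjoin[of K a] by blast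
  then show ?thesis by (simp add: hilb_def codim_in_def)
qed

text \<open>Degree \<open>t + e\<close> of the exact sequence given by multiplication by the form
  \<open>a\<close>. Taking components of a representation \<open>z - k * a\<close> shows that the
  multiplier can be chosen homogeneous.\<close>

lemma hilb_adjoin_colon:
  fixes K :: "('n::finite, 'k::field) pring set"
  assumes K: "graded K" and a: "a \<in> forms (int e)" "a \<noteq> 0"
  shows "hilb K (t + e) = hilb (adjoin K a) (t + e) + hilb (colon K a) t"
proof -
  let ?W = "forms (int t) :: ('n, 'k) pring set" and ?W' = "forms (int (t + e)) :: ('n, 'k) pring set"
  let ?S = "(\<lambda>x. a * x) ` ?W" and ?T = "?W' \<inter> K"
  note iK = gradedD(1)[OF K]
  have aW: "a * x \<in> ?W'" if "x \<in> ?W" for x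
    using forms_mult[OF a(1) that] by (simp add: add.commute)
  let ?U = "{x + y |x y. x \<in> ?S \<and> y \<in> ?T}"
  have U: "?U = ?W' \<inter> adjoin K a"
  proof (intro equalityI subsetI)
    fix z assume "z \<in> ?U"
    then obtain x y where xy: "z = a * x + y" "x \<in> ?W" "y \<in> ?W'" "y \<in> K" by blast
    have "z - x * a \<in> K" using xy by (simp add: mult.commute)
    moreover have "z \<in> ?W'" unfolding xy(1) by (rule forms_add[OF aW[OF xy(2)] xy(3)])
    ultimately show "z \<in> ?W' \<inter> adjoin K a" using adjoinI[of z x a K] by simp
  next
    fix z assume z: "z \<in> ?W' \<inter> adjoin K a"
    then obtain k where "z - k * a \<in> K" by (auto elim: adjoinE)
    then have "hcomp (int (t + e)) (z - a * k) \<in> K" using gradedD(2)[OF K] by (simp add: mult.commute)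
    then have y: "z - a * hcomp (int t) k \<in> K"
      using z by (simp add: hcomp_diff hcomp_mult_form[OF a(1)] form_iff_hcomp)
    have "z - a * hcomp (int t) k \<in> ?W'"
      using z aW[OF hcomp_in_forms[of "int t" k]] by (intro forms_diff) auto
    then show "z \<in> ?U" using y hcomp_in_forms[of "int t" k]
      by (intro CollectI exI[of _ "a * hcomp (int t) k"] exI[of _ "z - a * hcomp (int t) k"]) auto
  qed
  have "psc.dim ?U + psc.dim (?W \<inter> colon K a) = psc.dim ?W + psc.dim (?W' \<inter> K)"
    by (rule dim_sum_times[OF a(2) iK subspace_forms subspace_forms fin_span_forms aW])
  then show ?thesis unfolding U by (simp add: hilb_def codim_in_def)
qed

section \<open>Dimension and chains of homogeneous primes\<close>

definition hsum :: "('n::finite, 'k::field) pring set \<Rightarrow> nat \<Rightarrow> int" where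
  "hsum K t = (\<Sum>s\<le>t. hilb K s)"

text \<open>For graded \<open>K\<close> this says that R/\<open>K\<close> has dimension at most
  \<open>b\<close>: summing over degrees makes the order of growth equal to the dimension, without
  the usual shift by one.\<close>

definition hbounded :: "nat \<Rightarrow> ('n::finite, 'k::field) pring set \<Rightarrow> bool" where
  "hbounded b K \<longleftrightarrow> (\<exists>C. \<forall>t. hsum K t \<le> C * (int t + 1) ^ b)"

lemma hsum_nonneg: "hsum K t \<ge> 0"
  unfolding hsum_def by (intro sum_nonneg hilb_nonneg)

lemma hsum_mono: "s \<le> t \<Longrightarrow> hsum K s \<le> hsum K t"
  unfolding hsum_def by (intro sum_mono2) (auto simp: hilb_nonneg)

lemma hsum_adjoin_colon:
  assumes K: "graded K" and a: "a \<in> forms (int e)" "a \<noteq> 0"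
  shows "hsum K (t + e) = hsum (adjoin K a) (t + e) + hsum (colon K a) t"
proof (induction t)
  case 0
  have low: "(\<Sum>s<e. hilb K s) = (\<Sum>s<e. hilb (adjoin K a) s)"
    using hilb_adjoin_low[OF K a(1)] by (intro sum.cong) auto
  have "{..e} = insert e {..<e}" by auto
  then show ?case using hilb_adjoin_colon[OF K a, of 0] low by (simp add: hsum_def)
next
  case (Suc t)
  then show ?case using hilb_adjoin_colon[OF K a, of "Suc t"] by (simp add: hsum_def)
qed

lemma hbounded_adjoin_colon:
  assumes K: "graded K" and a: "a \<in> forms (int e)" "a \<noteq> 0"
    and b: "hbounded b (adjoin K a)" "hbounded b (colon K a)"
  shows "hbounded b K"
proof -
  obtain C1 C2 where C: "\<And>t. hsum (adjoin K a) t \<le> C1 * (int t + 1) ^ b"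
      "\<And>t. hsum (colon K a) t \<le> C2 * (int t + 1) ^ b"
    using b by (auto simp: hbounded_def)
  have C0: "C1 \<ge> 0" using C(1)[of 0] hsum_nonneg[of "adjoin K a" 0] by simp
  have "hsum K t \<le> (C1 * (int e + 1) ^ b + C2) * (int t + 1) ^ b" for t
  proof -
    have "(int (t + e) + 1) ^ b \<le> ((int e + 1) * (int t + 1)) ^ b"
      by (intro power_mono) (auto simp: algebra_simps)
    then have "C1 * (int (t + e) + 1) ^ b \<le> C1 * ((int e + 1) * (int t + 1)) ^ b"
      using C0 by (rule mult_left_mono)
    then have "hsum (adjoin K a) (t + e) \<le> C1 * (int e + 1) ^ b * (int t + 1) ^ b"
      using C(1)[of "t + e"] unfolding power_mult_distrib mult.assoc by linarith
    moreover have "hsum K t \<le> hsum K (t + e)" by (rule hsum_mono) simp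
    ultimately have "hsum K t \<le> C1 * (int e + 1) ^ b * (int t + 1) ^ b + C2 * (int t + 1) ^ b"
      using hsum_adjoin_colon[OF K a, of t] C(2)[of t] by linarith
    then show ?thesis by (simp only: distrib_right)
  qed
  then show ?thesis unfolding hbounded_def by blast
qed

text \<open>For \<open>p\<close> and \<open>q\<close> outside \<open>Q\<close>, take their highest
  components outside \<open>Q\<close>. In the corresponding component of \<open>p * q\<close> every
  other product has a factor in \<open>Q\<close>.\<close>

lemma graded_primeI:
  assumes Q: "graded Q" "1 \<notin> Q"
    and hom: "\<And>s t a b. a \<in> forms s \<Longrightarrow> b \<in> forms t \<Longrightarrow> a * b \<in> Q \<Longrightarrow> a \<in> Q \<or> b \<in> Q"
  shows "is_prime Q"
  unfolding is_prime_def
proof (intro conjI allI impI)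
  note iQ = gradedD(1)[OF Q(1)]
  show "is_ideal Q" by (rule iQ)
  show "Q \<noteq> UNIV" using Q(2) by blast
  fix p q assume pq: "p * q \<in> Q"
  have top: "\<exists>i. hcomp i p \<notin> Q \<and> (\<forall>s>i. hcomp s p \<in> Q)" if "p \<notin> Q" for p
  proof -
    let ?A = "{s. hcomp s p \<notin> Q}"
    have "hcomp s p = 0" if "s \<notin> (\<lambda>m. int (mdeg m)) ` mono_keys p" for s
      using that by (intro poly_mapping_eqI) (auto simp: coef_hcomp in_keys_iff image_iff)
    then have "?A \<subseteq> (\<lambda>m. int (mdeg m)) ` mono_keys p" using idl.subspace_0[OF iQ] by force
    then have fin: "finite ?A" by (rule finite_subset) simp
    have ne: "?A \<noteq> {}" using that graded_mem_iff[OF Q(1)] by blast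
    have "Max ?A \<in> ?A" using fin ne by (rule Max_in)
    moreover have "hcomp s p \<in> Q" if "s > Max ?A" for s using Max_ge[OF fin, of s] that by force
    ultimately show ?thesis by blast
  qed
  show "p \<in> Q \<or> q \<in> Q"
  proof (rule ccontr)
    assume "\<not> (p \<in> Q \<or> q \<in> Q)"
    then obtain i j where i: "hcomp i p \<notin> Q" "\<And>s. s > i \<Longrightarrow> hcomp s p \<in> Q"
      and j: "hcomp j q \<notin> Q" "\<And>s. s > j \<Longrightarrow> hcomp s q \<in> Q" using top by metis
    let ?T = "insert i ((\<lambda>m. int (mdeg m)) ` mono_keys p)"
    have "p = (\<Sum>s\<in>?T. hcomp s p)" by (rule hcomp_sum_self) auto
    then have "p * q = (\<Sum>s\<in>?T. hcomp s p) * q" by simp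
    then have "hcomp (i + j) (p * q) = (\<Sum>s\<in>?T. hcomp s p * hcomp (i + j - s) q)"
      by (simp only: sum_distrib_right hcomp_sum hcomp_mult_form[OF hcomp_in_forms])
    also have "\<dots> = hcomp i p * hcomp j q + (\<Sum>s\<in>?T - {i}. hcomp s p * hcomp (i + j - s) q)"
      by (subst sum.remove[of _ i]) auto
    finally have eq: "hcomp i p * hcomp j q =
        hcomp (i + j) (p * q) - (\<Sum>s\<in>?T - {i}. hcomp s p * hcomp (i + j - s) q)" by simp
    have "hcomp s p * hcomp (i + j - s) q \<in> Q" if "s \<in> ?T - {i}" for s
    proof (cases "s > i")
      case True
      then show ?thesis using ideal_mult_right[OF iQ i(2)] by simp
    next
      case False
      then have "i + j - s > j" using that by auto
      from idl.subspace_scale[OF iQ j(2)[OF this]] show ?thesis .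
    qed
    then have "hcomp i p * hcomp j q \<in> Q" unfolding eq
      by (intro idl.subspace_diff[OF iQ] idl.subspace_sum[OF iQ] gradedD(2)[OF Q(1) pq])
    then show False using hom[OF hcomp_in_forms hcomp_in_forms] i(1) j(1) by blast
  qed
qed

lemma hbounded_one: assumes "is_ideal K" "1 \<in> K" shows "hbounded b K"
proof -
  have "K = UNIV" using ideal_eq_UNIV_iff assms by blast
  then have "hsum K t = 0" for t by (simp add: hsum_def hilb_full)
  then show ?thesis unfolding hbounded_def by (intro exI[of _ 0]) simp
qed

text \<open>A graded ideal maximal with growth beyond \<open>b\<close> is prime: if
  \<open>a * c\<close> lay in it and neither form did, the sum with and the colon by
  \<open>a\<close> would both be strictly larger, hence bounded, and so would the ideal.\<close>

lemma exists_graded_prime: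
  fixes K :: "('n::finite, 'k::field) pring set"
  assumes K: "graded K" and nb: "\<not> hbounded b K"
  shows "\<exists>Q. is_prime Q \<and> graded Q \<and> K \<subseteq> Q \<and> \<not> hbounded b Q"
proof -
  let ?F = "{L. graded L \<and> K \<subseteq> L \<and> \<not> hbounded b L}"
  have "K \<in> ?F" using assms by blast
  moreover have "\<And>I. I \<in> ?F \<Longrightarrow> is_ideal I" using gradedD(1) by blast
  ultimately have "\<exists>Q\<in>?F. \<forall>L\<in>?F. Q \<subseteq> L \<longrightarrow> L = Q" by (rule noetherian_max[OF noetherian_pring])
  then obtain Q where QF: "Q \<in> ?F" and m: "\<forall>L\<in>?F. Q \<subseteq> L \<longrightarrow> L = Q" ..
  from QF have Q: "graded Q" "K \<subseteq> Q" "\<not> hbounded b Q" by blast+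
  have max: "L = Q" if "graded L" "Q \<subseteq> L" "\<not> hbounded b L" for L
  proof -
    have "L \<in> ?F" using that Q(2) by blast
    then show ?thesis using m that(2) by blast
  qed
  note iQ = gradedD(1)[OF Q(1)]
  have "is_prime Q"
  proof (rule graded_primeI[OF Q(1)])
    show "1 \<notin> Q" using hbounded_one[OF iQ] Q(3) by blast
    fix s t a c assume a: "a \<in> forms s" and c: "c \<in> forms t" and ac: "a * c \<in> Q"
    show "a \<in> Q \<or> c \<in> Q"
    proof (rule ccontr)
      assume no: "\<not> (a \<in> Q \<or> c \<in> Q)"
      have a0: "a \<noteq> 0" using no idl.subspace_0[OF iQ] by blast
      then have "s \<ge> 0" using forms_negative[OF a] by force
      then obtain e where e: "s = int e" using zero_le_imp_eq_int by blast
      have "adjoin Q a \<noteq> Q" using self_in_adjoin[OF iQ, of a] no by blast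
      then have 1: "hbounded b (adjoin Q a)"
        using max[OF graded_adjoin[OF Q(1) a] subset_adjoin] by blast
      have "c \<in> colon Q a" using ac by (simp add: mult.commute)
      then have "colon Q a \<noteq> Q" using no by blast
      then have "hbounded b (colon Q a)"
        using max[OF graded_colon[OF Q(1) a] subset_colon[OF iQ]] by blast
      then show False using hbounded_adjoin_colon[OF Q(1) a[unfolded e] a0 1] Q(3) by blast
    qed
  qed
  then show ?thesis using Q by blast
qed

lemma irrelevant_subset:
  fixes Q :: "('n::finite, 'k::field) pring set"
  assumes Q: "is_ideal Q" and v: "\<And>i. var i \<in> Q" shows "irrelevant \<subseteq> Q"
proof
  fix p :: "('n, 'k) pring" assume p: "p \<in> irrelevant"
  have "mon m (coef p m) \<in> Q" if m: "m \<in> mono_keys p" for m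
  proof -
    have "m \<noteq> 0" using p m by (auto simp: irrelevant_def in_keys_iff)
    then obtain i where i: "coef m i \<noteq> 0" by (metis lookup_zero poly_mapping_eqI)
    have "m = (m - mon i 1) + mon i 1"
      using i by (intro poly_mapping_eqI) (auto simp: lookup_add lookup_minus lookup_single when_def)
    then have "mon m (coef p m) = mon (m - mon i 1) (coef p m) * var i"
      by (simp add: var_def mult_single)
    then show ?thesis using idl.subspace_scale[OF Q v] by simp
  qed
  then have "(\<Sum>m\<in>mono_keys p. mon m (coef p m)) \<in> Q" by (intro idl.subspace_sum[OF Q])
  then show "p \<in> Q" using poly_as_sum[of "mono_keys p" p] by simp
qed

text \<open>In the exact sequence the colon contributes at most the Hilbert function one degree
  lower, so the inequalities telescope. A linear form therefore lowers the dimension by at most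
  one.\<close>

lemma hilb_le_hsum_adjoin:
  assumes K: "graded K" and y: "y \<in> forms (int 1)" "y \<noteq> 0"
  shows "hilb K t \<le> hsum (adjoin K y) t"
proof (induction t)
  case 0
  then show ?case using hilb_adjoin_low[OF K y(1), of 0] by (simp add: hsum_def)
next
  case (Suc t)
  have "hilb K (t + 1) = hilb (adjoin K y) (t + 1) + hilb (colon K y) t"
    by (rule hilb_adjoin_colon[OF K y])
  moreover have "hilb (colon K y) t \<le> hilb K t"
    by (rule hilb_antimono[OF subset_colon[OF gradedD(1)[OF K]]])
  ultimately show ?case using Suc by (simp add: hsum_def)
qed

text \<open>Growth is converted into a chain: pass to a graded prime without losing the growth, add
  a variable outside it, and continue above. For \<open>m = 0\<close> the growth condition
  degenerates to properness.\<close>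

lemma graded_prime_chain:
  fixes K :: "('n::finite, 'k::field) pring set"
  assumes K: "graded K" and big: "if m = 0 then 1 \<notin> K else \<not> hbounded (m - 1) K"
  shows "\<exists>c. prime_chain c m \<and> K \<subseteq> c 0 \<and> c m = irrelevant"
  using assms
proof (induction m arbitrary: K)
  case 0
  then have "K \<subseteq> irrelevant" using graded_proper_subset by simp
  then show ?case
    by (intro exI[of _ "\<lambda>_. irrelevant"]) (simp add: prime_chain_def prime_irrelevant)
next
  case (Suc m)
  then have "\<not> hbounded m K" by simp
  then obtain Q where Q: "is_prime Q" "graded Q" "K \<subseteq> Q" "\<not> hbounded m Q"
    using exists_graded_prime[OF Suc.prems(1)] by blast
  note iQ = prime_ideal[OF Q(1)]
  \<comment> \<open>If \<open>Q\<close> contained every variable, the quotient would live in degree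
    zero and its cumulative Hilbert function would be constant.\<close>
  have "\<exists>i. var i \<notin> Q"
  proof (rule ccontr)
    assume "\<not> ?thesis"
    then have irr: "irrelevant \<subseteq> Q" using irrelevant_subset[OF iQ] by blast
    have "hilb Q s = 0" if "s > 0" for s
      using that irr forms_pos_irrelevant[of _ "int s"] by (intro hilb_full) auto
    then have "(\<Sum>s\<in>{..t} - {0}. hilb Q s) = 0" for t by (intro sum.neutral) auto
    then have "hsum Q t = hilb Q 0" for t unfolding hsum_def by (subst sum.remove[of _ 0]) auto
    then have "hsum Q t \<le> hilb Q 0 * (int t + 1) ^ m" for t
      using mult_left_mono[OF one_le_power[of "int t + 1" m] hilb_nonneg[of Q 0]] by simp
    then show False using Q(4) unfolding hbounded_def by blast
  qed
  then obtain i where i: "var i \<notin> Q" ..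
  let ?y = "var i :: ('n, 'k) pring"
  have y: "?y \<in> forms (int 1)" "?y \<noteq> 0"
    using var_form[of i] i idl.subspace_0[OF iQ] by auto
  have "if m = 0 then 1 \<notin> adjoin Q ?y else \<not> hbounded (m - 1) (adjoin Q ?y)"
  proof (cases m)
    case 0
    have "Q \<subseteq> irrelevant" by (rule graded_proper_subset[OF Q(2) prime_proper[OF Q(1)]])
    moreover have "?y \<in> irrelevant" using forms_pos_irrelevant[OF y(1)] by simp
    ultimately have "adjoin Q ?y \<subseteq> irrelevant" by (intro adjoin_least ideal_irrelevant)
    then show ?thesis using 0 one_notin_irrelevant by auto
  next
    case (Suc b)
    have "\<not> hbounded b (adjoin Q ?y)"
    proof
      assume "hbounded b (adjoin Q ?y)"
      then obtain C where C: "\<And>t. hsum (adjoin Q ?y) t \<le> C * (int t + 1) ^ b" by (auto simp: hbounded_def)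
      have C0: "C \<ge> 0" using C[of 0] hsum_nonneg[of "adjoin Q ?y" 0] by simp
      have "hsum Q t \<le> C * (int t + 1) ^ m" for t
      proof -
        have "hilb Q s \<le> C * (int t + 1) ^ b" if "s \<le> t" for s
        proof -
          have "hilb Q s \<le> C * (int s + 1) ^ b"
            using hilb_le_hsum_adjoin[OF Q(2) y, of s] C[of s] by linarith
          also have "\<dots> \<le> C * (int t + 1) ^ b" using C0 that by (intro mult_left_mono power_mono) auto
          finally show ?thesis .
        qed
        then have "hsum Q t \<le> (\<Sum>s\<le>t. C * (int t + 1) ^ b)" unfolding hsum_def by (intro sum_mono) simp
        then show ?thesis by (simp add: Suc algebra_simps)
      qed
      then show False using Q(4) unfolding hbounded_def by blast
    qed
    then show ?thesis using Suc by simp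
  qed
  from Suc.IH[OF graded_adjoin[OF Q(2) y(1)] this] obtain c
    where c: "prime_chain c m" "adjoin Q ?y \<subseteq> c 0" "c m = irrelevant" by blast
  have "Q \<subset> c 0" using c(2) subset_adjoin[of Q ?y] self_in_adjoin[OF iQ, of ?y] i by blast
  have one: "prime_chain (\<lambda>j. if j = 0 then Q else c 0) 1"
    using Q(1) c(1) \<open>Q \<subset> c 0\<close> by (simp add: prime_chain_def)
  from prime_chain_append[OF one c(1)]
  have "prime_chain (\<lambda>j. if j \<le> 1 then if j = 0 then Q else c 0 else c (j - 1)) (1 + m)" by simp
  then show ?case using Q(3) c(3)
    by (intro exI[of _ "\<lambda>j. if j \<le> 1 then if j = 0 then Q else c 0 else c (j - 1)"]) auto
qed

text \<open>Monomials in the variables of \<open>B\<close>, pulled back by \<open>\<sigma>\<close>,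
  are independent modulo \<open>Q\<close> and hence modulo \<open>J\<close>. \<open>Q\<close> need
  not be homogeneous; only the smaller \<open>J\<close> enters the Hilbert function.\<close>

lemma independent_variables_unbounded:
  fixes J Q :: "('n::finite, 'k::field) pring set"
  assumes s: "lin_aut \<sigma>" and Q: "\<sigma> ` Q \<inter> polys_in B \<subseteq> {0}" and J: "is_ideal J" "J \<subseteq> Q" and B: "card B = Suc b"
  shows "\<not> hbounded b J"
proof
  assume "hbounded b J"
  then obtain C where C: "\<And>t. hsum J t \<le> C * (int t + 1) ^ b" by (auto simp: hbounded_def)
  have C0: "C \<ge> 0" using C[of 0] hsum_nonneg[of J 0] by simp
  let ?X = "\<lambda>s. {m :: 'n \<Rightarrow>\<^sub>0 nat. mdeg m = s \<and> (\<forall>j. j \<notin> B \<longrightarrow> coef m j = 0)}"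
  have finX: "finite (?X s)" for s by (rule finite_subset[OF _ finite_mdeg[of s]]) auto
  note inv = lin_aut_inv[OF s]
  have hilb: "hilb J s \<ge> int (card (?X s))" for s
  proof -
    let ?W = "supported (?X s) :: ('n, 'k) pring set"
    interpret f: Vector_Spaces.linear pscale pscale "inv \<sigma>"
      by (rule linear_pscaleI) (simp_all add: pscale_def lin_autD(1,2,3)[OF inv(1)])
    have sW: "psc.subspace (inv \<sigma> ` ?W)" by (rule f.subspace_image[OF subspace_supported])
    have WF: "inv \<sigma> ` ?W \<subseteq> forms (int s)"
    proof clarify
      fix p :: "('n, 'k) pring" assume "p \<in> ?W"
      then have "p \<in> forms (int s)" by (auto simp: forms_iff supported_def)
      then show "inv \<sigma> p \<in> forms (int s)" by (rule lin_autD(4)[OF inv(1)])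
    qed
    have W0: "inv \<sigma> ` ?W \<inter> J \<subseteq> {0}"
    proof
      fix x assume x: "x \<in> inv \<sigma> ` ?W \<inter> J"
      then obtain p where p: "p \<in> ?W" "x = inv \<sigma> p" by blast
      have "p \<in> polys_in B" using p(1) by (auto simp: supported_def polys_in_def)
      moreover have "p = \<sigma> x" using p(2) inv(3) by simp
      moreover have "x \<in> Q" using x J(2) by blast
      ultimately have "p = 0" using Q by blast
      then show "x \<in> {0}" using p(2) lin_aut_zero(1)[OF inv(1)] by simp
    qed
    have "inj_on (inv \<sigma>) ?W" using lin_autD(6)[OF inv(1)] by (simp add: inj_on_def)
    then have "psc.dim (inv \<sigma> ` ?W) = psc.dim ?W"
      by (rule psc.dim_injective_image[OF f.linear_axioms subspace_supported])
    moreover have "psc.dim ?W = card (?X s)" by (rule dim_supported[OF finX])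
    ultimately have "int (card (?X s)) = int (psc.dim (inv \<sigma> ` ?W))" by simp
    also have "\<dots> \<le> hilb J s" unfolding hilb_def
      by (rule codim_in_ge[OF sW WF W0 fin_span_forms subspace_forms ideal_psc[OF J(1)]])
    finally show ?thesis .
  qed
  \<comment> \<open>A box of side \<open>k\<close> in \<open>Suc b\<close> variables contains only
    monomials of degree at most \<open>Suc b * k\<close>, which compares the box count with the
    cumulative Hilbert function.\<close>
  have bound: "(int k + 1) ^ Suc b \<le> C * (int (Suc b) * int k + 1) ^ b" for k
  proof -
    let ?t = "Suc b * k"
    let ?Y = "{m :: 'n \<Rightarrow>\<^sub>0 nat. m \<in> box k \<and> (\<forall>j. j \<notin> B \<longrightarrow> coef m j = 0)}"
    have "?Y \<subseteq> (\<Union>s\<le>?t. ?X s)"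
    proof
      fix m assume m: "m \<in> ?Y"
      have "mdeg m = (\<Sum>j\<in>B. coef m j)"
        unfolding mdeg_def using m by (intro sum.mono_neutral_right) auto
      also have "\<dots> \<le> (\<Sum>j\<in>B. k)" using m by (intro sum_mono) (auto simp: box_def)
      finally have "mdeg m \<le> ?t" using B by simp
      then show "m \<in> (\<Union>s\<le>?t. ?X s)" using m by auto
    qed
    then have "card ?Y \<le> card (\<Union>s\<le>?t. ?X s)" using finX by (intro card_mono) auto
    also have "\<dots> = (\<Sum>s\<le>?t. card (?X s))" using finX by (intro card_UN_disjoint) auto
    finally have "int (card ?Y) \<le> (\<Sum>s\<le>?t. int (card (?X s)))" 
      by (simp only: of_nat_sum[symmetric] of_nat_le_iff)
    also have "\<dots> \<le> hsum J ?t" unfolding hsum_def by (intro sum_mono hilb)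
    also have "\<dots> \<le> C * (int ?t + 1) ^ b" by (rule C)
    also have "int (card ?Y) = (int k + 1) ^ Suc b"
      by (simp only: card_box_sub B of_nat_power of_nat_add of_nat_1)
    finally show ?thesis by (simp only: of_nat_mult)
  qed
  \<comment> \<open>This value turns the upper bound into at most \<open>k\<close> times the
    \<open>b\<close>-th power of \<open>k + 1\<close>, just below the lower bound.\<close>
  define k where "k = nat (C * int (Suc b) ^ b)"
  have k: "int k = C * int (Suc b) ^ b" using C0 by (simp add: k_def)
  have "C * (int (Suc b) * int k + 1) ^ b \<le> C * (int (Suc b) * (int k + 1)) ^ b"
    using C0 by (intro mult_left_mono power_mono) (auto simp: algebra_simps)
  also have "\<dots> = int k * (int k + 1) ^ b" unfolding k by (simp add: power_mult_distrib)
  also have "\<dots> < (int k + 1) * (int k + 1) ^ b" by (intro mult_strict_right_mono) auto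
  finally show False using bound[of k] by simp
qed

text \<open>The inequality dim R/\<open>J\<close> \<ge> n - 2 in the form needed at the irrelevant
  ideal. A prime of height at most two over \<open>J\<close> provides independent variables, these
  provide growth, and growth provides a chain through homogeneous primes.\<close>

lemma dimension_irrelevant_ge:
  fixes J :: "('n::finite, 'k::field_char_0) pring set"
  assumes n: "CARD('n) \<ge> 3" and J: "graded J" and ht: "height J = 2"
  shows "\<exists>c. prime_chain c (CARD('n) - 2) \<and> J \<subseteq> c 0 \<and> c (CARD('n) - 2) = irrelevant"
proof -
  have "height J < enat 3" using ht by (simp add: numeral_eq_enat)
  then obtain Q where Q: "is_prime Q" "J \<subseteq> Q" "prime_height_over {0} Q < enat 3"
    unfolding height_def Inf_less_iff by blast
  have "m \<le> 2" if c: "prime_chain c m" "c m = Q" for c m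
  proof -
    have "{0} \<subseteq> c 0" using c(1) by (intro prime_contains_zero) (simp add: prime_chain_def)
    from prime_height_over_ge[OF c(1) this] have "enat m < enat 3"
      by (rule le_less_trans) (use Q(3) c(2) in simp)
    then show ?thesis by simp
  qed
  then obtain \<sigma> B where B: "lin_aut \<sigma>" "card B = CARD('n) - 2" "\<sigma> ` Q \<inter> polys_in B \<subseteq> {0}"
    using height_two_independent_variables[OF n Q(1)] by blast
  have eq: "CARD('n) - 2 = Suc (CARD('n) - 3)" using n by simp
  have "\<not> hbounded (CARD('n) - 3) J"
    by (rule independent_variables_unbounded[OF B(1,3) gradedD(1)[OF J] Q(2)]) (simp add: B(2) eq)
  then show ?thesis using graded_prime_chain[OF J, of "CARD('n) - 2"] eq by simp
qed

section \<open>The multiplicity of a complete intersection\<close>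

lemma card_mdeg: "card {m :: 'n::finite \<Rightarrow>\<^sub>0 nat. mdeg m = t} = (t + (CARD('n) - 1)) choose (CARD('n) - 1)"
proof -
  let ?n = "CARD('n)"
  obtain e :: "nat \<Rightarrow> 'n" where e: "bij_betw e {0..<?n} UNIV" using ex_bij_betw_nat_finite[of "UNIV :: 'n set"] by auto
  let ?e' = "inv_into {0..<?n} e"
  have e': "?e' i < ?n" "e (?e' i) = i" for i
    using bij_betw_imp_surj_on[OF e] inv_into_into[of i e "{0..<?n}"] f_inv_into_f[of i e "{0..<?n}"] by auto
  have e'': "?e' (e k) = k" if "k < ?n" for k
    using inv_into_f_f[OF bij_betw_imp_inj_on[OF e], of k] that by simp
  let ?f = "\<lambda>m :: 'n \<Rightarrow>\<^sub>0 nat. map (\<lambda>k. coef m (e k)) [0..<?n]"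
  have sum: "sum_list (?f m) = mdeg m" for m
    using sum.reindex_bij_betw[OF e, of "coef m"] by (simp add: mdeg_def interv_sum_list_conv_sum_set_nat)
  have "bij_betw ?f {m. mdeg m = t} {l. size l = ?n \<and> sum_list l = t}"
  proof (rule bij_betwI')
    fix a b :: "'n \<Rightarrow>\<^sub>0 nat"
    show "?f a = ?f b \<longleftrightarrow> a = b"
    proof
      assume *: "?f a = ?f b"
      show "a = b"
      proof (rule poly_mapping_eqI)
        fix i
        have "?f a ! ?e' i = ?f b ! ?e' i" by (simp only: *)
        then show "coef a i = coef b i" using e'[of i] by simp
      qed
    qed simp
  next
    fix m :: "'n \<Rightarrow>\<^sub>0 nat" assume "m \<in> {m. mdeg m = t}"
    then show "?f m \<in> {l. size l = ?n \<and> sum_list l = t}" using sum[of m] by simp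
  next
    fix l assume l: "l \<in> {l :: nat list. size l = ?n \<and> sum_list l = t}"
    define m :: "'n \<Rightarrow>\<^sub>0 nat" where "m = Abs_poly_mapping (\<lambda>i. l ! ?e' i)"
    have "coef m i = l ! ?e' i" for i unfolding m_def by (simp add: lookup_Abs_poly_mapping)
    then have fm: "?f m = l" using l e'' by (intro nth_equalityI) auto
    then show "\<exists>m\<in>{m. mdeg m = t}. l = ?f m" using l sum[of m] by (intro bexI[of _ m]) auto
  qed
  then have "card {m :: 'n \<Rightarrow>\<^sub>0 nat. mdeg m = t} = (t + ?n - 1) choose t"
    using card_length_sum_list[of ?n t] by (simp add: bij_betw_same_card)
  also have "t + ?n - 1 = t + (?n - 1)" using zero_less_card_finite[where 'a = 'n] by simp
  also have "(t + (?n - 1)) choose t = (t + (?n - 1)) choose (?n - 1)"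
    using binomial_symmetric[OF le_add1, of t "?n - 1"] by (simp only: add_diff_cancel_left')
  finally show ?thesis .
qed

lemma hilb_zero:
  "hilb ({0} :: ('n::finite, 'k::field) pring set) t = int ((t + (CARD('n) - 1)) choose (CARD('n) - 1))"
proof -
  have "forms (int t) \<inter> {0} = {0 :: ('n, 'k) pring}" by auto
  moreover have "psc.dim {0 :: ('n, 'k) pring} = 0"
    using psc.basis_card_eq_dim[of "{}" "{0}"] psc.independent_empty by simp
  ultimately show ?thesis
    by (simp add: hilb_def codim_in_def forms_supported dim_supported[OF finite_mdeg] card_mdeg)
qed

lemma hilb_pair:
  fixes u v :: "('n::finite, 'k::field) pring"
  assumes r: "regular_pair u v" and u: "u \<in> forms (int a)" and v: "v \<in> forms (int b)" and v0: "v \<noteq> 0"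
    and t: "t \<ge> a + b"
  defines "h \<equiv> \<lambda>t. int ((t + (CARD('n) - 1)) choose (CARD('n) - 1))"
  shows "hilb (adjoin (adjoin {0} u) v) t = (h t - h (t - a)) - (h (t - b) - h (t - b - a))"
proof -
  note u0 = regular_pairD(1)[OF r]
  have gu: "graded (adjoin {0} u)" by (rule graded_adjoin[OF graded_zero u])
  have c0: "colon {0} u = {0}" using u0 by (auto simp: pring_mult_eq_0_iff)
  have cu: "colon (adjoin {0} u) v = adjoin {0} u"
    using subset_colon[OF gradedD(1)[OF gu], of v] regular_pairD(3)[OF r]
    by (auto simp: mult.commute)
  have one: "hilb (adjoin {0} u) s = h s - h (s - a)" if "s \<ge> a" for s
    using hilb_adjoin_colon[OF graded_zero u u0, of "s - a"] that by (simp add: c0 hilb_zero h_def)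
  show ?thesis
    using hilb_adjoin_colon[OF gu v v0, of "t - b"] t one[of t] one[of "t - b"] by (simp add: cu)
qed

text \<open>Pascal's rule, telescoped. As a sum of \<open>a\<close> terms, the difference shows its
  leading coefficient without any cancellation.\<close>

lemma binomial_difference:
  assumes "t \<ge> a" shows "int ((t + Suc N) choose Suc N) - int ((t - a + Suc N) choose Suc N) =
    (\<Sum>i<a. int ((t - i + N) choose N))"
  using assms
proof (induction a)
  case (Suc a)
  then obtain s where s: "t - a = Suc s" by (metis Suc_diff_Suc Suc_le_lessD)
  then have "t - Suc a = s" by simp
  then have "int ((t - a + Suc N) choose Suc N) - int ((t - Suc a + Suc N) choose Suc N) = int ((t - a + N) choose N)"
    using s by simp
  then show ?case using Suc by simp
qed simp

text \<open>The polynomial in t whose value is the binomial coefficient of t + \<open>N\<close> over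
  \<open>N\<close>.\<close>

primrec binp :: "nat \<Rightarrow> rat poly" where
  "binp 0 = 1"
| "binp (Suc N) = smult (1 / of_nat (Suc N)) ([:of_nat (Suc N), 1:] * binp N)"

lemma poly_binp: "poly (binp N) (of_nat t) = of_nat ((t + N) choose N)"
proof (induction N)
  case (Suc N)
  have "Suc N * ((t + Suc N) choose Suc N) = (t + Suc N) * ((t + N) choose N)"
    using Suc_times_binomial[of N "t + N"] by simp
  then have "of_nat (Suc N) * (of_nat ((t + Suc N) choose Suc N) :: rat) =
      of_nat (t + Suc N) * of_nat ((t + N) choose N)" by (metis of_nat_mult)
  moreover have "poly [:of_nat (Suc N), 1:] (of_nat t :: rat) = of_nat (t + Suc N)" by simp
  ultimately show ?case unfolding binp.simps poly_smult poly_mult Suc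
    by (simp add: field_simps del: of_nat_Suc of_nat_add binomial_Suc_Suc poly_pCons)
qed simp

lemma binp_degree: "degree (binp N) = N" and binp_lead: "lead_coeff (binp N) = 1 / fact N"
proof (induction N)
  case (Suc N)
  have n0: "binp N \<noteq> 0" using Suc by (metis fact_nonzero leading_coeff_0_iff one_divide_eq_0_iff)
  { case 1 show ?case using Suc n0 by (simp add: degree_mult_eq del: of_nat_Suc mult_pCons_left) }
  { case 2 have "lead_coeff [:of_nat (Suc N), 1 :: rat:] = 1" by simp
    then show ?case using Suc(2) by (simp only: binp.simps lead_coeff_smult lead_coeff_mult) simp }
qed simp_all

lemma hilbert_polynomialI:
  assumes "\<And>t. t \<ge> t0 \<Longrightarrow> of_nat (hilbert_function I t) = poly P (of_nat t)"
  shows "hilbert_polynomial I = P"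
  unfolding hilbert_polynomial_def
proof (rule the_equality)
  show "\<exists>t0. \<forall>t\<ge>t0. of_nat (hilbert_function I t) = poly P (of_nat t)" using assms by blast
  fix Q :: "rat poly"
  assume "\<exists>t0. \<forall>t\<ge>t0. of_nat (hilbert_function I t) = poly Q (of_nat t)"
  then obtain t1 where t1: "\<And>t. t \<ge> t1 \<Longrightarrow> of_nat (hilbert_function I t) = poly Q (of_nat t)" by blast
  show "Q = P"
  proof (rule ccontr)
    assume "Q \<noteq> P"
    then have "finite {x. poly (Q - P) x = 0}" by (intro poly_roots_finite) simp
    moreover have "poly (Q - P) (of_nat t) = 0" if "t \<ge> max t0 t1" for t
      using assms[of t] t1[of t] that by simp
    then have "of_nat ` {max t0 t1..} \<subseteq> {x. poly (Q - P) x = 0}" by blast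
    ultimately have "finite (of_nat ` {max t0 t1..} :: rat set)" by (rule finite_subset[rotated])
    then have "finite {max t0 t1..}" by (rule finite_imageD) (simp add: inj_on_def)
    then show False using infinite_Ici by blast
  qed
qed

lemma multiplicity_pair:
  fixes u v :: "('n::finite, 'k::field) pring"
  assumes n: "CARD('n) \<ge> 3" and r: "regular_pair u v" and u: "u \<in> forms (int a)" and v: "v \<in> forms (int b)"
    and v0: "v \<noteq> 0" and ab: "a > 0" "b > 0"
  shows "multiplicity_quotient (adjoin (adjoin {0} u) v) = of_nat (a * b)"
proof -
  let ?I = "adjoin (adjoin {0} u) v"
  \<comment> \<open>\<open>N\<close> is n - 3, the degree of the Hilbert polynomial of the quotient
    by two equations; the two successors are spent on the two differences.\<close>
  obtain N where N: "CARD('n) - 1 = Suc (Suc N)"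
  proof
    show "CARD('n) - 1 = Suc (Suc (CARD('n) - 3))" using n by simp
  qed
  \<comment> \<open>The shift of \<open>binp N\<close> by \<open>c\<close>. The Hilbert polynomial
    is a sum of \<open>a * b\<close> such shifts, all with leading coefficient
    \<open>1 / fact N\<close>, whence the multiplicity.\<close>
  define q where "q = (\<lambda>c :: nat. pcompose (binp N) [:- of_nat c, 1:])"
  define P where "P = (\<Sum>i<a. \<Sum>j<b. q (i + j))"
  have "of_nat (hilbert_function ?I t) = poly P (of_nat t)" if t: "t \<ge> a + b" for t
  proof -
    have "int (hilbert_function ?I t) =
        (\<Sum>i<a. int ((t - i + Suc N) choose Suc N)) - (\<Sum>i<a. int ((t - b - i + Suc N) choose Suc N))"
      unfolding hilbert_function_hilb hilb_pair[OF r u v v0 t] N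
      using t by (simp only: binomial_difference[of a t] binomial_difference[of a "t - b"])
    also have "\<dots> = (\<Sum>i<a. int ((t - i + Suc N) choose Suc N) - int ((t - i - b + Suc N) choose Suc N))"
      by (simp add: sum_subtractf add.commute)
    also have "\<dots> = (\<Sum>i<a. \<Sum>j<b. int ((t - i - j + N) choose N))"
      using t by (intro sum.cong refl binomial_difference) auto
    finally have "hilbert_function ?I t = (\<Sum>i<a. \<Sum>j<b. (t - i - j + N) choose N)"
      by (simp only: of_nat_sum[symmetric] of_nat_eq_iff)
    then have "(of_nat (hilbert_function ?I t) :: rat) = (\<Sum>i<a. \<Sum>j<b. of_nat ((t - i - j + N) choose N))"
      by simp
    also have "\<dots> = (\<Sum>i<a. \<Sum>j<b. poly (q (i + j)) (of_nat t))"
    proof (intro sum.cong refl)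
      fix i j assume "i \<in> {..<a}" "j \<in> {..<b}"
      then have le: "i + j \<le> t" using t by auto
      then have "poly (q (i + j)) (of_nat t) = poly (binp N) (of_nat (t - (i + j)))"
        by (simp add: q_def poly_pcompose of_nat_diff algebra_simps)
      then show "of_nat ((t - i - j + N) choose N) = poly (q (i + j)) (of_nat t)"
        by (simp add: poly_binp)
    qed
    finally show ?thesis by (simp add: P_def poly_sum)
  qed
  then have hp: "hilbert_polynomial ?I = P" by (rule hilbert_polynomialI)
  have dq: "degree (q c) = N" for c by (simp add: q_def degree_pcompose binp_degree)
  have lq: "coeff (q c) N = 1 / fact N" for c
    using lead_coeff_comp[of "[:- of_nat c, 1:]" "binp N"] binp_lead[of N] dq[of c] by (simp add: q_def)
  have cP: "coeff P N = of_nat (a * b) / fact N" by (simp add: P_def coeff_sum lq)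
  have "coeff P N \<noteq> 0" using ab by (simp add: cP)
  moreover have "degree P \<le> N" unfolding P_def by (intro degree_sum_le) (auto simp: dq)
  ultimately have dP: "degree P = N" "P \<noteq> 0" using le_degree[of P N] by auto
  show ?thesis using dP cP by (simp add: multiplicity_quotient_def hp Let_def)
qed

section \<open>The Koszul complex of the last map\<close>

interpretation vmod: module "(*s) :: 'a::comm_ring_1 \<Rightarrow> 'a ^ 3 \<Rightarrow> 'a ^ 3"
  by unfold_locales (auto simp: vec_eq_iff algebra_simps)

text \<open>The cross product. For fixed \<open>p\<close>, the map taking \<open>y\<close> to
  \<open>kross y p\<close> is the middle differential of the Koszul complex of
  \<open>p\<close>.\<close>

definition kross :: "'a::comm_ring_1 ^ 3 \<Rightarrow> 'a ^ 3 \<Rightarrow> 'a ^ 3" where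
  "kross a b = (\<chi> i. if i = 1 then a $ 2 * b $ 3 - a $ 3 * b $ 2
     else if i = 2 then a $ 3 * b $ 1 - a $ 1 * b $ 3 else a $ 1 * b $ 2 - a $ 2 * b $ 1)"

lemma kross_nth [simp]:
  "kross a b $ 1 = a $ 2 * b $ 3 - a $ 3 * b $ 2"
  "kross a b $ 2 = a $ 3 * b $ 1 - a $ 1 * b $ 3"
  "kross a b $ 3 = a $ 1 * b $ 2 - a $ 2 * b $ 1"
  by (simp_all add: kross_def)

lemma vec3_eqI: "a $ 1 = b $ 1 \<Longrightarrow> a $ 2 = b $ 2 \<Longrightarrow> a $ 3 = b $ 3 \<Longrightarrow> a = (b :: 'a ^ 3)"
  by (simp add: vec_eq_iff forall_3)

lemma mem_ideal_of: "x \<in> ideal_of f \<longleftrightarrow> (\<exists>y :: 'a::comm_ring_1 ^ 3. x = (\<Sum>i\<in>UNIV. y $ i * f $ i))"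
proof
  let ?T = "{x. \<exists>y :: 'a ^ 3. x = (\<Sum>i\<in>UNIV. y $ i * f $ i)}"
  assume x: "x \<in> ideal_of f"
  have "is_ideal ?T"
  proof (rule idl.subspaceI)
    show "0 \<in> ?T" by (intro CollectI exI[of _ 0]) simp
  next
    fix a b assume "a \<in> ?T" "b \<in> ?T"
    then obtain y z :: "'a ^ 3" where "a = (\<Sum>i\<in>UNIV. y $ i * f $ i)" "b = (\<Sum>i\<in>UNIV. z $ i * f $ i)"
      by blast
    then show "a + b \<in> ?T"
      by (intro CollectI exI[of _ "y + z"]) (simp add: distrib_right sum.distrib)
  next
    fix c a assume "a \<in> ?T"
    then obtain y :: "'a ^ 3" where "a = (\<Sum>i\<in>UNIV. y $ i * f $ i)" by blast
    then show "c * a \<in> ?T"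
      by (intro CollectI exI[of _ "c *s y"]) (simp add: sum_distrib_left mult.assoc)
  qed
  moreover have "range (($) f) \<subseteq> ?T"
  proof
    fix a assume "a \<in> range (($) f)"
    then obtain j where j: "a = f $ j" by blast
    have "(\<Sum>i\<in>UNIV. axis j 1 $ i * f $ i) = (\<Sum>i\<in>UNIV. if i = j then f $ i else 0)"
      by (intro sum.cong) (auto simp: axis_def)
    then show "a \<in> ?T" using j by (intro CollectI exI[of _ "axis j 1"]) simp
  qed
  ultimately have "ideal_of f \<subseteq> ?T" unfolding ideal_of_def by (intro idl.span_minimal)
  then show "\<exists>y :: 'a ^ 3. x = (\<Sum>i\<in>UNIV. y $ i * f $ i)" using x by blast
next
  assume "\<exists>y :: 'a ^ 3. x = (\<Sum>i\<in>UNIV. y $ i * f $ i)"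
  then obtain y :: "'a ^ 3" where "x = (\<Sum>i\<in>UNIV. y $ i * f $ i)" ..
  then show "x \<in> ideal_of f" unfolding ideal_of_def
    by (simp only:) (intro idl.span_sum idl.span_scale idl.span_base rangeI)
qed

lemma ideal_ideal_of: "is_ideal (ideal_of f)"
  unfolding ideal_of_def by (rule idl.subspace_span)

lemma mult_vec_nth3: "(A *v x) $ i = A $ i $ 1 * x $ 1 + A $ i $ 2 * x $ 2 + A $ i $ 3 * x $ 3"
  for A :: "'a::comm_ring_1 ^ 3 ^ 3"
  by (simp add: matrix_vector_mult_def sum_3)

lemma mult_vec_add: "A *v (x + y) = A *v x + A *v y"
  and mult_vec_diff: "A *v (x - y) = A *v x - A *v y"
  and mult_vec_scale: "A *v (r *s x) = r *s (A *v x)"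
  for A :: "'a::comm_ring_1 ^ 3 ^ 3"
  by (simp_all add: vec_eq_iff mult_vec_nth3 algebra_simps)

lemma vec3_scale_zero: "r *s x = 0 \<Longrightarrow> r \<noteq> 0 \<Longrightarrow> x = 0" for x :: "('n::finite, 'k::field) pring ^ 3"
  by (auto simp: vec_eq_iff pring_mult_eq_0_iff)

locale free_resolution =
  fixes f p :: "('n::finite, 'k::field_char_0) pring ^ 3" and A :: "('n, 'k) pring ^ 3 ^ 3"
    and d c :: int and b :: "int ^ 3"
  assumes resolution: "minimal_resolution d b c (ideal_of f) f A p"
begin

abbreviation col :: "3 \<Rightarrow> ('n, 'k) pring ^ 3" where "col j \<equiv> \<chi> i. A $ i $ j"

lemma f_form: "f $ i \<in> forms d"
  and A_form: "A $ i $ j \<in> forms (b $ j - d)"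
  and A_irr: "A $ i $ j \<in> irrelevant"
  and p_form: "p $ j \<in> forms (c - b $ j)"
  and p_irr: "p $ j \<in> irrelevant"
  using resolution by (auto simp: minimal_resolution_def)

lemma syz_iff: "(\<Sum>i\<in>UNIV. a $ i * f $ i) = 0 \<longleftrightarrow> (\<exists>x. a = A *v x)"
proof -
  have "syz f = range (\<lambda>x. A *v x)" using resolution by (simp add: minimal_resolution_def)
  then show ?thesis by (auto simp: syz_def)
qed

lemma ker_iff: "A *v x = 0 \<longleftrightarrow> (\<exists>r. x = r *s p)"
proof -
  have "{x. A *v x = 0} = range (\<lambda>r. r *s p)" using resolution by (simp add: minimal_resolution_def)
  then show ?thesis by blast
qed

lemma p_inj: "r *s p = 0 \<Longrightarrow> r = 0"
  using resolution by (simp add: minimal_resolution_def)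

lemma A_p: "A *v p = 0"
  unfolding ker_iff by (intro exI[of _ 1]) simp

lemma p_nonzero: obtains j where "p $ j \<noteq> 0"
proof -
  have "p \<noteq> 0" using p_inj[of 1] by auto
  then show ?thesis using that by (auto simp: vec_eq_iff)
qed

lemma one_not_p_combination: "1 \<noteq> x * p $ i + y * p $ j"
proof
  assume "1 = x * p $ i + y * p $ j"
  moreover have "x * p $ i + y * p $ j \<in> irrelevant"
    by (intro idl.subspace_add[OF ideal_irrelevant] idl.subspace_scale[OF ideal_irrelevant] p_irr)
  ultimately show False using one_notin_irrelevant by metis
qed

text \<open>A vanishing cross product makes \<open>z\<close> proportional to \<open>p\<close> over
  the fraction field. Since \<open>A\<close> kills \<open>p\<close>, it also kills \<open>z\<close>
  after cancelling a nonzero entry, and exactness of the resolution removes the denominator.\<close>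

lemma koszul_two:
  assumes "kross z p = 0" shows "\<exists>w. z = w *s p"
proof -
  obtain j where j: "p $ j \<noteq> 0" by (rule p_nonzero)
  have sym: "p $ i * z $ k = p $ k * z $ i" for i k
  proof -
    have "z $ 2 * p $ 3 - z $ 3 * p $ 2 = 0" "z $ 3 * p $ 1 - z $ 1 * p $ 3 = 0"
      "z $ 1 * p $ 2 - z $ 2 * p $ 1 = 0"
      using assms kross_nth[of z p] by simp_all
    then show ?thesis using exhaust_3[of i] exhaust_3[of k] by (auto simp: mult.commute)
  qed
  have "p $ j *s z = z $ j *s p" by (simp add: vec_eq_iff sym[of j] mult.commute)
  then have "p $ j *s (A *v z) = z $ j *s (A *v p)" by (simp only: mult_vec_scale[symmetric])
  then have "A *v z = 0" using vec3_scale_zero[OF _ j] A_p by simp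
  then show ?thesis unfolding ker_iff .
qed

text \<open>Both the resolution and the Koszul complex of \<open>p\<close> enter: tensoring them gives a double complex in
  which the class of \<open>x\<close> is moved from \<open>R\<close> to \<open>R\<^sup>3\<close>, where multiplication by \<open>p\<close> kills it.\<close>

lemma koszul_one:
  assumes x: "(\<Sum>i\<in>UNIV. x $ i * p $ i) = 0" shows "\<exists>y. x = kross y p"
proof -
  have x0: "x $ 1 * p $ 1 + x $ 2 * p $ 2 + x $ 3 * p $ 3 = 0" using x by (simp add: sum_3)
  \<comment> \<open>As \<open>x\<close> is orthogonal to \<open>p\<close>, the vector
    \<open>Y j\<close> witnesses that \<open>p $ j *s x\<close> is a Koszul boundary; this is the
    usual homotopy for multiplication by \<open>p $ j\<close>.\<close>
  define Y where "Y = (\<lambda>j. kross (axis j 1) x)"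
  have Yp: "kross (Y j) p = p $ j *s x" for j
  proof -
    have "x $ 1 * p $ 1 = - x $ 2 * p $ 2 - x $ 3 * p $ 3" "x $ 2 * p $ 2 = - x $ 1 * p $ 1 - x $ 3 * p $ 3"
      "x $ 3 * p $ 3 = - x $ 1 * p $ 1 - x $ 2 * p $ 2"
      using x0 by (simp_all add: algebra_simps eq_neg_iff_add_eq_0)
    then show ?thesis using exhaust_3[of j]
      by (intro vec3_eqI) (auto simp: Y_def axis_def algebra_simps)
  qed
  \<comment> \<open>Applying \<open>A\<close> in the index \<open>j\<close> kills the boundary,
    because \<open>A\<close> kills \<open>p\<close>; by \<open>koszul_two\<close> each
    \<open>Z i\<close> is a multiple of \<open>p\<close>.\<close>
  define Z where "Z = (\<lambda>i. A $ i $ 1 *s Y 1 + A $ i $ 2 *s Y 2 + A $ i $ 3 *s Y 3)"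
  have "kross (Z i) p = 0" for i
  proof -
    have "kross (Z i) p = A $ i $ 1 *s kross (Y 1) p + A $ i $ 2 *s kross (Y 2) p + A $ i $ 3 *s kross (Y 3) p"
      by (rule vec3_eqI) (simp_all add: Z_def algebra_simps)
    also have "\<dots> = (A *v p) $ i *s x"
      unfolding Yp by (simp add: vec_eq_iff mult_vec_nth3 algebra_simps)
    finally show ?thesis using A_p by simp
  qed
  then have "\<forall>i. \<exists>w. Z i = w *s p" using koszul_two by blast
  then obtain w' where w': "\<And>i. Z i = w' i *s p" by metis
  define w where "w = (\<chi> i. w' i)"
  have w: "Z i = w $ i *s p" for i using w' by (simp add: w_def)
  have fA: "f $ 1 * A $ 1 $ j + f $ 2 * A $ 2 $ j + f $ 3 * A $ 3 $ j = 0" for j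
  proof -
    have "col j = A *v axis j 1" using exhaust_3[of j]
      by (auto simp: vec_eq_iff mult_vec_nth3 axis_def)
    then have "(\<Sum>i\<in>UNIV. col j $ i * f $ i) = 0" using syz_iff by blast
    then show ?thesis by (simp add: sum_3 mult.commute)
  qed
  have "(\<Sum>i\<in>UNIV. w $ i * f $ i) *s p = f $ 1 *s Z 1 + f $ 2 *s Z 2 + f $ 3 *s Z 3"
    unfolding w by (simp add: vec_eq_iff sum_3 algebra_simps)
  also have "\<dots> = (f $ 1 * A $ 1 $ 1 + f $ 2 * A $ 2 $ 1 + f $ 3 * A $ 3 $ 1) *s Y 1
      + (f $ 1 * A $ 1 $ 2 + f $ 2 * A $ 2 $ 2 + f $ 3 * A $ 3 $ 2) *s Y 2
      + (f $ 1 * A $ 1 $ 3 + f $ 2 * A $ 2 $ 3 + f $ 3 * A $ 3 $ 3) *s Y 3"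
    by (simp add: Z_def vec_eq_iff algebra_simps)
  also have "\<dots> = 0" unfolding fA by (simp add: vec_eq_iff)
  finally have "(\<Sum>i\<in>UNIV. w $ i * f $ i) = 0" by (rule p_inj)
  then obtain q where q: "w = A *v q" using syz_iff by blast
  \<comment> \<open>Correcting by \<open>q\<close> makes every coordinate of the family
    \<open>Y\<close> lie in the kernel of \<open>A\<close>, hence on the line through
    \<open>p\<close>.\<close>
  have "\<exists>y. (\<chi> j. Y j $ k - q $ j * p $ k) = y *s p" for k
  proof -
    have "A *v (\<chi> j. Y j $ k - q $ j * p $ k) = 0"
    proof (simp only: vec_eq_iff, intro allI)
      fix i
      have "(A *v (\<chi> j. Y j $ k - q $ j * p $ k)) $ i = Z i $ k - (A *v q) $ i * p $ k"
        by (simp add: mult_vec_nth3 Z_def algebra_simps)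
      also have "\<dots> = 0" using w[of i] q by simp
      finally show "(A *v (\<chi> j. Y j $ k - q $ j * p $ k)) $ i = 0 $ i" by simp
    qed
    then show ?thesis unfolding ker_iff .
  qed
  then obtain y' where y': "\<And>k. (\<chi> j. Y j $ k - q $ j * p $ k) = y' k *s p" by metis
  define y where "y = (\<chi> k. y' k)"
  have Yj: "Y j = q $ j *s p + p $ j *s y" for j
  proof (simp only: vec_eq_iff, intro allI)
    fix k
    have "(\<chi> j. Y j $ k - q $ j * p $ k) $ j = (y' k *s p) $ j" by (simp only: y')
    then show "Y j $ k = (q $ j *s p + p $ j *s y) $ k" by (simp add: y_def algebra_simps)
  qed
  \<comment> \<open>In the decomposition of \<open>Y j\<close> the first summand has zero cross
    product with \<open>p\<close>, so the second exhibits \<open>x\<close> as a boundary once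
    \<open>p $ j\<close> is cancelled.\<close>
  obtain j where j: "p $ j \<noteq> 0" by (rule p_nonzero)
  have "p $ j *s x = p $ j *s kross y p"
    unfolding Yp[symmetric] Yj by (rule vec3_eqI) (simp_all add: algebra_simps)
  then have "x = kross y p" using pring_mult_left_cancel[OF j] by (simp add: vec_eq_iff)
  then show ?thesis ..
qed

text \<open>Vanishing of the first Koszul homology reproduces the same relation with
  \<open>g\<close> replaced by a cofactor of \<open>p $ 1\<close>. Iterating places \<open>g\<close>
  in (\<open>p $ 2\<close>) up to terms of arbitrarily high order, and comparing homogeneous
  components replaces Krull's intersection theorem.\<close>

lemma regular_p23: "regular_pair (p $ 2) (p $ 3)"
  unfolding regular_pair_def
proof (intro conjI allI impI)
  show "p $ 2 \<noteq> 0"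
  proof
    assume "p $ 2 = 0"
    then have "(\<Sum>i\<in>UNIV. axis 2 1 $ i * p $ i) = 0" by (simp add: sum_3 axis_def)
    then obtain y where "axis 2 1 = kross y p" using koszul_one by blast
    then have "(axis 2 1 :: ('n, 'k) pring ^ 3) $ 2 = kross y p $ 2" by simp
    then have "1 = y $ 3 * p $ 1 + (- y $ 1) * p $ 3" by simp
    then show False using one_not_p_combination by blast
  qed
  fix g k assume gk: "p $ 3 * g = p $ 2 * k"
  have "\<exists>q m. g = p $ 2 * q + m \<and> (\<forall>l\<in>mono_keys m. N \<le> mdeg l)" for N
    using gk
  proof (induction N arbitrary: g k)
    case 0 then show ?case by (intro exI[of _ 0] exI[of _ g]) simp
  next
    case (Suc N)
    \<comment> \<open>The first coordinate of \<open>x = kross y p\<close> is zero, which is the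
      original relation for \<open>y $ 2\<close> and \<open>y $ 3\<close>; the third expresses
      \<open>g\<close>.\<close>
    define x :: "('n, 'k) pring ^ 3" where "x = (\<chi> i. if i = 1 then 0 else if i = 2 then - k else g)"
    have "(\<Sum>i\<in>UNIV. x $ i * p $ i) = 0" using Suc.prems by (simp add: sum_3 x_def mult.commute)
    then obtain y where y: "x = kross y p" using koszul_one by blast
    have "x $ 1 = kross y p $ 1" "x $ 3 = kross y p $ 3" using y by simp_all
    then have 1: "p $ 3 * y $ 2 = p $ 2 * y $ 3" and g: "g = y $ 1 * p $ 2 - y $ 2 * p $ 1"
      by (simp_all add: x_def mult.commute)
    from Suc.IH[OF 1] obtain q m where qm: "y $ 2 = p $ 2 * q + m" "\<forall>l\<in>mono_keys m. N \<le> mdeg l" by blast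
    have "g = p $ 2 * (y $ 1 - q * p $ 1) + - (m * p $ 1)"
      by (simp add: g qm(1) algebra_simps)
    moreover have "Suc N \<le> mdeg l" if l: "l \<in> mono_keys (- (m * p $ 1))" for l
    proof -
      have "l \<in> mono_keys (m * p $ 1)" using l unfolding keys_uminus' .
      then obtain a e where ae: "l = a + e" "a \<in> mono_keys m" "e \<in> mono_keys (p $ 1)" by (rule keys_multE)
      have "e \<noteq> 0" using ae(3) p_irr[of 1] by (auto simp: irrelevant_def in_keys_iff)
      then have "mdeg e \<noteq> 0" by (simp add: mdeg_eq_0_iff)
      moreover have "N \<le> mdeg a" using qm(2) ae(2) by blast
      ultimately show ?thesis using ae(1) by (simp add: mdeg_add)
    qed
    ultimately show ?case by blast
  qed
  note approx = this
  have gr: "graded (adjoin {0} (p $ 2))" by (rule graded_adjoin[OF graded_zero p_form])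
  have "hcomp t g \<in> adjoin {0} (p $ 2)" for t
  proof -
    \<comment> \<open>Order \<open>t + 1\<close> suffices, since the error then has no component of
      degree \<open>t\<close>.\<close>
    obtain q m where qm: "g = p $ 2 * q + m" "\<forall>l\<in>mono_keys m. nat (t + 1) \<le> mdeg l" using approx by blast
    have "hcomp t m = 0"
    proof (rule poly_mapping_eqI)
      fix l
      have "l \<notin> mono_keys m" if "int (mdeg l) = t" using qm(2)[rule_format, of l] that by auto
      then show "coef (hcomp t m) l = coef 0 l" by (simp add: coef_hcomp coef_notin_keys)
    qed
    then have "hcomp t g = p $ 2 * hcomp (t - (c - b $ 2)) q"
      by (simp add: qm(1) hcomp_add hcomp_mult_form[OF p_form])
    then show ?thesis by (auto simp: in_adjoin_zero)
  qed
  then have "g \<in> adjoin {0} (p $ 2)" using graded_mem_iff[OF gr] by blast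
  then show "\<exists>q. g = p $ 2 * q" by (simp add: in_adjoin_zero)
qed

lemma regular_p1: 
  assumes "p $ 1 * g \<in> adjoin (adjoin {0} (p $ 2)) (p $ 3)" shows "g \<in> adjoin (adjoin {0} (p $ 2)) (p $ 3)"
proof -
  obtain k l where kl: "p $ 1 * g = p $ 2 * k + p $ 3 * l" using assms by (auto simp: in_adjoin_pair)
  define x :: "('n, 'k) pring ^ 3" where "x = (\<chi> i. if i = 1 then g else if i = 2 then - k else - l)"
  have "(\<Sum>i\<in>UNIV. x $ i * p $ i) = 0" using kl by (simp add: sum_3 x_def mult.commute)
  then obtain y where y: "x = kross y p" using koszul_one by blast
  have "x $ 1 = kross y p $ 1" using y by simp
  then have "g = p $ 2 * (- y $ 3) + p $ 3 * y $ 2" by (simp add: x_def algebra_simps)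
  then show ?thesis unfolding in_adjoin_pair by blast
qed

lemma p3_nonzero: "p $ 3 \<noteq> 0"
proof
  assume "p $ 3 = 0"
  then have "p $ 3 * 1 = p $ 2 * 0" by simp
  then obtain q where "1 = p $ 2 * q" using regular_pairD(2)[OF regular_p23] by blast
  then have "1 = q * p $ 2 + 0 * p $ 2" by (simp add: mult.commute)
  then show False using one_not_p_combination by blast
qed

text \<open>The comparison map from the Koszul complex of \<open>p\<close> to the resolution that is the identity at
  the left end has components \<open>B\<close> and \<open>h\<close> at the right end.\<close>

lemma exists_socle_generator:
  "\<exists>h. colon (ideal_of f) h = adjoin (adjoin (adjoin {0} (p $ 2)) (p $ 3)) (p $ 1)"
proof -
  \<comment> \<open>The rows of \<open>A\<close> are orthogonal to \<open>p\<close>, so Koszul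
    exactness lifts them; this is the first step of the comparison map.\<close>
  have "\<forall>i. \<exists>y. A $ i = kross y p"
  proof
    fix i
    have "(\<Sum>j\<in>UNIV. A $ i $ j * p $ j) = 0" using A_p by (simp add: vec_eq_iff matrix_vector_mult_def)
    then show "\<exists>y. A $ i = kross y p" by (rule koszul_one)
  qed
  then obtain B where B: "\<And>i. A $ i = kross (B i) p" by metis
  have "kross (f $ 1 *s B 1 + f $ 2 *s B 2 + f $ 3 *s B 3) p =
      f $ 1 *s kross (B 1) p + f $ 2 *s kross (B 2) p + f $ 3 *s kross (B 3) p"
    by (rule vec3_eqI) (simp_all add: algebra_simps)
  also have "\<dots> = 0" unfolding B[symmetric]
  proof (simp only: vec_eq_iff, intro allI)
    fix j
    have "col j = A *v axis j 1" using exhaust_3[of j]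
      by (auto simp: vec_eq_iff mult_vec_nth3 axis_def)
    then have "(\<Sum>i\<in>UNIV. col j $ i * f $ i) = 0" using syz_iff by blast
    then show "(f $ 1 *s A $ 1 + f $ 2 *s A $ 2 + f $ 3 *s A $ 3) $ j = 0 $ j"
      by (simp add: sum_3 mult.commute)
  qed
  finally obtain h where h: "f $ 1 *s B 1 + f $ 2 *s B 2 + f $ 3 *s B 3 = h *s p"
    using koszul_two by blast
  have hp: "f $ 1 * B 1 $ j + f $ 2 * B 2 $ j + f $ 3 * B 3 $ j = h * p $ j" for j
  proof -
    have "(f $ 1 *s B 1 + f $ 2 *s B 2 + f $ 3 *s B 3) $ j = (h *s p) $ j" by (simp only: h)
    then show ?thesis by simp
  qed
  let ?P = "adjoin (adjoin (adjoin {0} (p $ 2)) (p $ 3)) (p $ 1)"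
  have "r \<in> ?P" if rh: "r * h \<in> ideal_of f" for r
  proof -
    obtain y where y: "r * h = (\<Sum>i\<in>UNIV. y $ i * f $ i)" using rh unfolding mem_ideal_of ..
    \<comment> \<open>\<open>r * h * p $ j\<close> is written once through the rows of
      \<open>B\<close> and once through \<open>y\<close>; the difference of coefficients is a syzygy
      of \<open>f\<close> and lifts through \<open>A\<close>.\<close>
    have "\<forall>j. \<exists>z. (\<chi> i. r * B i $ j - y $ i * p $ j) = A *v z"
    proof
      fix j
      have "(\<Sum>i\<in>UNIV. (\<chi> i. r * B i $ j - y $ i * p $ j) $ i * f $ i) =
          r * (f $ 1 * B 1 $ j + f $ 2 * B 2 $ j + f $ 3 * B 3 $ j) - (\<Sum>i\<in>UNIV. y $ i * f $ i) * p $ j"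
        by (simp add: sum_3 algebra_simps)
      also have "\<dots> = 0" unfolding hp y[symmetric] by (simp add: mult.assoc)
      finally show "\<exists>z. (\<chi> i. r * B i $ j - y $ i * p $ j) = A *v z" unfolding syz_iff .
    qed
    then obtain z where z: "\<And>j. (\<chi> i. r * B i $ j - y $ i * p $ j) = A *v z j" by metis
    define W where "W = (\<lambda>k :: 3. \<chi> j. z j $ k)"
    have rB: "r *s B i = y $ i *s p + (A $ i $ 1 *s W 1 + A $ i $ 2 *s W 2 + A $ i $ 3 *s W 3)" for i
    proof (simp only: vec_eq_iff, intro allI)
      fix j
      have "(\<chi> i. r * B i $ j - y $ i * p $ j) $ i = (A *v z j) $ i" by (simp only: z)
      then show "(r *s B i) $ j = (y $ i *s p + (A $ i $ 1 *s W 1 + A $ i $ 2 *s W 2 + A $ i $ 3 *s W 3)) $ j"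
        by (simp add: W_def mult_vec_nth3 algebra_simps)
    qed
    have rA: "r *s A $ i = A $ i $ 1 *s kross (W 1) p + A $ i $ 2 *s kross (W 2) p + A $ i $ 3 *s kross (W 3) p" for i
    proof -
      have "r *s A $ i = kross (r *s B i) p" unfolding B by (rule vec3_eqI) (simp_all add: algebra_simps)
      also have "\<dots> = A $ i $ 1 *s kross (W 1) p + A $ i $ 2 *s kross (W 2) p + A $ i $ 3 *s kross (W 3) p"
        unfolding rB by (rule vec3_eqI) (simp_all add: algebra_simps)
      finally show ?thesis .
    qed
    \<comment> \<open>The first columns of the two expressions for \<open>r *s A $ i\<close> differ
      by a vector killed by \<open>A\<close>. It is a multiple of \<open>p\<close>, and its first
      entry expresses \<open>r\<close> through \<open>p\<close>.\<close>
    define v where "v = (\<chi> k. (if k = 1 then r else 0) - kross (W k) p $ 1)"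
    have "A *v v = 0"
    proof (simp only: vec_eq_iff, intro allI)
      fix i
      have "(r *s A $ i) $ 1 = (A $ i $ 1 *s kross (W 1) p + A $ i $ 2 *s kross (W 2) p + A $ i $ 3 *s kross (W 3) p) $ 1"
        by (simp only: rA)
      then show "(A *v v) $ i = 0 $ i" by (simp add: v_def mult_vec_nth3 algebra_simps)
    qed
    then obtain s where "v = s *s p" using ker_iff by blast
    then have "v $ 1 = s * p $ 1" by simp
    then have "r = s * p $ 1 + (W 1 $ 2 * p $ 3 - W 1 $ 3 * p $ 2)" by (simp add: v_def algebra_simps)
    then have "r - s * p $ 1 = p $ 2 * (- W 1 $ 3) + p $ 3 * W 1 $ 2" by (simp add: algebra_simps)
    then have "r - s * p $ 1 \<in> adjoin (adjoin {0} (p $ 2)) (p $ 3)" unfolding in_adjoin_pair by blast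
    then show ?thesis by (rule adjoinI)
  qed
  then have "colon (ideal_of f) h \<subseteq> ?P" by auto
  moreover have "p $ j \<in> colon (ideal_of f) h" for j
  proof -
    have "p $ j * h = (\<Sum>i\<in>UNIV. (\<chi> i. B i $ j) $ i * f $ i)"
      using hp[of j] by (simp add: sum_3 mult.commute)
    then show ?thesis unfolding in_colon_iff mem_ideal_of by blast
  qed
  then have "?P \<subseteq> colon (ideal_of f) h"
    using idl.subspace_0[OF ideal_colon[OF ideal_ideal_of[of f], of h]]
    by (intro adjoin_least ideal_colon ideal_ideal_of) simp_all
  ultimately show ?thesis by blast
qed

end

lemma prime_no_constants: assumes "is_prime Q" shows "Q \<inter> polys_in {} \<subseteq> {0}"
proof
  fix q assume q: "q \<in> Q \<inter> polys_in {}"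
  have "mdeg m = 0" if "m \<in> mono_keys q" for m
    using q that unfolding mdeg_eq_0_iff by (intro poly_mapping_eqI) (simp add: polys_in_def)
  then have "q \<in> forms 0" by (simp add: forms_iff)
  then obtain c where c: "q = mon 0 c" by (rule forms_0E)
  show "q \<in> {0}"
  proof (rule ccontr)
    assume "q \<notin> {0}"
    then have "mon 0 (1 / c) * q = 1" using c by (auto simp: mult_single)
    moreover have "mon 0 (1 / c) * q \<in> Q" using q by (intro idl.subspace_scale[OF prime_ideal[OF assms]]) simp
    ultimately show False using prime_proper[OF assms] by simp
  qed
qed

lemma height_mono: "I \<subseteq> K \<Longrightarrow> height I \<le> height K"
  unfolding height_def by (rule Inf_superset_mono) auto

lemma graded_ideal_of:
  fixes f :: "('n::finite, 'k::field) pring ^ 3"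
  assumes f: "\<And>i. f $ i \<in> forms d" shows "graded (ideal_of f)"
  unfolding graded_def
proof (intro conjI ideal_ideal_of allI ballI)
  fix t x assume "x \<in> ideal_of f"
  then obtain y :: "('n, 'k) pring ^ 3" where y: "x = (\<Sum>i\<in>UNIV. y $ i * f $ i)" unfolding mem_ideal_of ..
  have "hcomp t x = (\<Sum>i\<in>UNIV. hcomp t (f $ i * y $ i))" by (simp add: y hcomp_sum mult.commute)
  also have "\<dots> = (\<Sum>i\<in>UNIV. (\<chi> i. hcomp (t - d) (y $ i)) $ i * f $ i)"
    by (simp add: hcomp_mult_form[OF f] mult.commute)
  finally show "hcomp t x \<in> ideal_of f" unfolding mem_ideal_of by blast
qed

context free_resolution
begin

lemma ideal_of_irrelevant: assumes "d > 0" shows "ideal_of f \<subseteq> irrelevant"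
proof -
  have "range (($) f) \<subseteq> irrelevant" using forms_pos_irrelevant[OF f_form] assms by auto
  then show ?thesis unfolding ideal_of_def by (rule idl.span_minimal) (rule ideal_irrelevant)
qed

text \<open>At an associated prime over all entries of \<open>p\<close>, a chain of length three
  below is spliced with a chain above that is as long as the regular sequence. The total length is
  at most the number of variables.\<close>

lemma grade_irrelevant_le: "grade_mod (ideal_of f) irrelevant \<le> enat (CARD('n) - 3)"
proof -
  let ?J = "ideal_of f" and ?P2 = "adjoin (adjoin {0} (p $ 2)) (p $ 3)"
  let ?P = "adjoin ?P2 (p $ 1)"
  have iP2: "is_ideal ?P2" by (intro ideal_adjoin ideal_zero)
  have iP: "is_ideal ?P" by (intro ideal_adjoin ideal_zero)
  obtain h where h: "colon ?J h = ?P" using exists_socle_generator by blast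
  have "?P \<subseteq> irrelevant"
    using prime_contains_zero[OF prime_irrelevant] p_irr by (intro adjoin_least ideal_irrelevant)
  then have "colon ?P 1 \<subseteq> irrelevant" by (simp add: colon_def)
  then obtain r where r: "is_prime (colon ?P (r * 1))" "colon ?P (r * 1) \<subseteq> irrelevant"
    using exists_prime_colon[OF noetherian_pring iP prime_irrelevant] by blast
  \<comment> \<open>An associated prime of the ideal generated by the entries of \<open>p\<close> is
    also one of J, because that ideal is itself a colon of J.\<close>
  have eq: "colon ?J (r * h) = colon ?P (r * 1)"
  proof (intro set_eqI)
    fix x
    have "x * r \<in> colon ?J h \<longleftrightarrow> x * r \<in> ?P" by (simp only: h)
    then show "x \<in> colon ?J (r * h) \<longleftrightarrow> x \<in> colon ?P (r * 1)" by (simp add: mult.assoc)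
  qed
  let ?Q = "colon ?J (r * h)"
  have Q: "is_prime ?Q" "?Q \<subseteq> irrelevant" using r eq by simp_all
  have PQ: "?P \<subseteq> ?Q" unfolding eq by (rule subset_colon[OF iP])
  have "p $ 2 * 1 + p $ 3 * 0 \<in> ?P2" "p $ 2 * 0 + p $ 3 * 1 \<in> ?P2" unfolding in_adjoin_pair by blast+
  then have p: "p $ 2 \<in> ?Q" "p $ 3 \<in> ?Q" "p $ 1 \<in> ?Q"
    using subset_adjoin[of ?P2 "p $ 1"] self_in_adjoin[OF iP2, of "p $ 1"] PQ by auto
  have "\<exists>c. prime_chain c 3 \<and> c 3 = ?Q"
    by (rule prime_chain_regular_triple[OF noetherian_pring Q(1) p
          zero_cancel[OF regular_pairD(1)[OF regular_p23]] regular_pairD(3)[OF regular_p23] regular_p1])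
  then obtain e where e: "prime_chain e 3" "e 3 = ?Q" by blast
  show ?thesis unfolding grade_mod_def
  proof (rule Sup_least, clarify)
    fix ys :: "('n, 'k) pring list" assume ys: "set ys \<subseteq> irrelevant" "regular_sequence_mod ?J ys"
    obtain e' where e': "prime_chain e' (length ys)" "e' 0 = ?Q"
      using regular_sequence_prime_chain[OF noetherian_pring ideal_ideal_of prime_irrelevant Q ys] by blast
    let ?c = "\<lambda>i. if i \<le> 3 then e i else e' (i - 3)"
    have c: "prime_chain ?c (3 + length ys)"
      using e(2) e'(2) by (intro prime_chain_append[OF e(1) e'(1)]) simp
    then have "is_prime (?c (3 + length ys))" unfolding prime_chain_def by blast
    from prime_chain_bound[OF c prime_no_constants[OF this]]
    show "enat (length ys) \<le> enat (CARD('n) - 3)" by simp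
  qed
qed

lemma not_perfect:
  assumes n: "CARD('n) \<ge> 3" and d: "d > 0" shows "\<not> perfect_height_two (ideal_of f)"
proof
  let ?J = "ideal_of f"
  assume "perfect_height_two ?J"
  then have ht: "height ?J = 2" and cm: "cohen_macaulay_quotient ?J" by (auto simp: perfect_height_two_def)
  have eq: "grade_mod ?J irrelevant = prime_height_over ?J irrelevant"
    using cm maximal_irrelevant ideal_of_irrelevant[OF d] unfolding cohen_macaulay_quotient_def by blast
  obtain c where c: "prime_chain c (CARD('n) - 2)" "?J \<subseteq> c 0" "c (CARD('n) - 2) = irrelevant"
    using dimension_irrelevant_ge[OF n graded_ideal_of[OF f_form] ht] by blast
  have "enat (CARD('n) - 2) \<le> enat (CARD('n) - 3)"
    using prime_height_over_ge[OF c(1,2)] grade_irrelevant_le unfolding c(3) eq by (rule order_trans)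
  then show False using n by simp
qed

section \<open>The Bourbaki ideal of the first syzygy\<close>

definition bour_ideal :: "('n, 'k) pring set" where
  "bour_ideal = adjoin (adjoin {0} (p $ 2)) (p $ 3)"

lemma col_axis: "col j = A *v axis j 1"
  using exhaust_3[of j] by (auto simp: vec_eq_iff mult_vec_nth3 axis_def)

lemma mult_as_cols: "A *v x = x $ 1 *s col 1 + x $ 2 *s col 2 + x $ 3 *s col 3"
  by (simp add: vec_eq_iff mult_vec_nth3 mult.commute)

lemma in_syz_iff: "a \<in> syz f \<longleftrightarrow> (\<exists>x. a = A *v x)"
  using syz_iff by (simp add: syz_def)

lemma syz_eq: "syz f = range (\<lambda>x. A *v x)"
  using resolution by (simp add: minimal_resolution_def)

lemma homogeneous_lift:
  assumes a: "a \<in> vforms t" "a = A *v x"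
  obtains x' where "a = A *v x'" "\<And>j. x' $ j \<in> forms (t - (b $ j - d))"
proof
  let ?x = "\<chi> j. hcomp (t - (b $ j - d)) (x $ j)"
  show "?x $ j \<in> forms (t - (b $ j - d))" for j by (simp add: hcomp_in_forms)
  show "a = A *v ?x"
  proof (simp only: vec_eq_iff, intro allI)
    fix i
    have "a $ i = hcomp t (a $ i)" using a(1) by (simp add: vforms_def form_iff_hcomp)
    also have "\<dots> = (A *v ?x) $ i"
      by (simp add: a(2) mult_vec_nth3 hcomp_add hcomp_mult_form[OF A_form])
    finally show "a $ i = (A *v ?x) $ i" .
  qed
qed

text \<open>Such a relation would give an element of the kernel of \<open>A\<close> with an entry 1,
  but kernel elements are multiples of \<open>p\<close> and have entries in the irrelevant
  ideal.\<close>

lemma col_not_combination: assumes "x $ j = 0" shows "col j \<noteq> A *v x"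
proof
  assume "col j = A *v x"
  then have "A *v (axis j 1 - x) = 0" unfolding mult_vec_diff by (simp add: col_axis)
  then obtain r where "axis j 1 - x = r *s p" using ker_iff by blast
  then have "(axis j 1 - x) $ j = (r *s p) $ j" by simp
  then have "1 = r * p $ j + 0 * p $ j" using assms by (simp add: axis_def)
  then show False using one_not_p_combination by blast
qed

lemma col_nonzero: "col j \<noteq> 0"
  using col_not_combination[of 0 j] by (simp add: vec_eq_iff mult_vec_nth3)

lemma col_vforms: "col j \<in> vforms (b $ j - d)"
  by (simp add: vforms_def A_form)

lemma minimal_generator_col: "minimal_generator (syz f) (col j)"
  unfolding minimal_generator_def
proof (intro exI[of _ "range col"] conjI ballI)
  have sub: "vmod.subspace (syz f)"
  proof (rule vmod.subspaceI)
    show "0 \<in> syz f" unfolding in_syz_iff by (intro exI[of _ 0]) (simp add: vec_eq_iff mult_vec_nth3)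
    show "a + a' \<in> syz f" if "a \<in> syz f" "a' \<in> syz f" for a a'
      using that unfolding in_syz_iff by (metis mult_vec_add)
    show "r *s a \<in> syz f" if "a \<in> syz f" for r a
      using that unfolding in_syz_iff by (metis mult_vec_scale)
  qed
  show "range col \<subseteq> (\<Union>t. vforms t)" using col_vforms by blast
  show "submodule_gen (range col) = syz f"
  proof
    show "submodule_gen (range col) \<subseteq> syz f"
      by (rule vmod.span_minimal[OF _ sub]) (use in_syz_iff col_axis in blast)
    show "syz f \<subseteq> submodule_gen (range col)"
    proof
      fix a assume "a \<in> syz f"
      then obtain x where "a = A *v x" unfolding in_syz_iff ..
      then show "a \<in> submodule_gen (range col)" unfolding mult_as_cols
        by (simp only:) (intro vmod.span_add vmod.span_scale vmod.span_base rangeI)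
    qed
  qed
  show "col j \<in> range col" by (rule rangeI)
  fix g assume "g \<in> range col"
  then obtain k where k: "g = col k" by blast
  show "submodule_gen (range col - {g}) \<noteq> syz f"
  proof
    assume eq: "submodule_gen (range col - {g}) = syz f"
    let ?T = "{a. \<exists>x. a = A *v x \<and> x $ k = 0}"
    have "vmod.subspace ?T"
    proof (rule vmod.subspaceI)
      show "0 \<in> ?T" by (intro CollectI exI[of _ 0]) (simp add: vec_eq_iff mult_vec_nth3)
    next
      fix a a' assume "a \<in> ?T" "a' \<in> ?T"
      then obtain x x' where "a = A *v x" "x $ k = 0" "a' = A *v x'" "x' $ k = 0" by blast
      then show "a + a' \<in> ?T" by (intro CollectI exI[of _ "x + x'"]) (simp add: mult_vec_add)
    next
      fix r a assume "a \<in> ?T"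
      then obtain x where "a = A *v x" "x $ k = 0" by blast
      then show "r *s a \<in> ?T" by (intro CollectI exI[of _ "r *s x"]) (simp add: mult_vec_scale)
    qed
    moreover have "range col - {g} \<subseteq> ?T"
    proof
      fix a assume "a \<in> range col - {g}"
      then obtain l where l: "a = col l" "l \<noteq> k" using k by blast
      then show "a \<in> ?T" by (intro CollectI exI[of _ "axis l 1"]) (simp add: col_axis[of l] axis_def)
    qed
    ultimately have "syz f \<subseteq> ?T" unfolding eq[symmetric] by (intro vmod.span_minimal)
    moreover have "col k \<in> syz f" unfolding in_syz_iff col_axis by blast
    ultimately obtain x where "col k = A *v x" "x $ k = 0" by blast
    then show False using col_not_combination by blast
  qed
qed

lemma indeg_eq:
  assumes b: "\<And>j. b $ 1 \<le> b $ j" and d: "d \<le> b $ 1" shows "int (indeg_syz f) = b $ 1 - d"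
proof -
  have "indeg_syz f = nat (b $ 1 - d)" unfolding indeg_syz_def
  proof (rule Least_equality)
    show "\<exists>a\<in>syz f \<inter> vforms (int (nat (b $ 1 - d))). a \<noteq> 0"
      using col_vforms[of 1] col_nonzero[of 1] d col_axis[of 1] in_syz_iff
      by (intro bexI[of _ "col 1"]) auto
    fix t assume "\<exists>a\<in>syz f \<inter> vforms (int t). a \<noteq> 0"
    then obtain a where a: "a \<in> syz f" "a \<in> vforms (int t)" "a \<noteq> 0" by blast
    obtain x where "a = A *v x" using a(1) unfolding in_syz_iff ..
    then obtain x' where x: "a = A *v x'" "\<And>j. x' $ j \<in> forms (int t - (b $ j - d))"
      using homogeneous_lift[OF a(2)] by blast
    show "nat (b $ 1 - d) \<le> t"
    proof (rule ccontr)
      assume "\<not> nat (b $ 1 - d) \<le> t"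
      then have "int t - (b $ j - d) < 0" for j using b[of j] by linarith
      then have "x' $ j = 0" for j using forms_negative[OF x(2)] by blast
      then have "a = 0" unfolding x(1) by (simp add: vec_eq_iff mult_vec_nth3)
      then show False using a(3) by simp
    qed
  qed
  then show ?thesis using d by simp
qed

text \<open>The map sends \<open>A *v x\<close> to the first coordinate of \<open>kross x p\<close>.
  That coordinate ignores multiples of \<open>p\<close>, so the value does not depend on
  \<open>x\<close>, and regularity of the pair determines the kernel.\<close>

lemma bourbaki_iso: "quotient_iso_up_to_shift f (col 1) bour_ideal"
proof -
  define \<phi> where "\<phi> = (\<lambda>a. let x = (SOME x. a = A *v x) in x $ 2 * p $ 3 - x $ 3 * p $ 2)"
  have \<phi>: "\<phi> (A *v x) = x $ 2 * p $ 3 - x $ 3 * p $ 2" for x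
  proof -
    define y where "y = (SOME y. A *v x = A *v y)"
    have "A *v x = A *v y" unfolding y_def by (rule someI[of _ x]) simp
    then have "A *v (y - x) = 0" by (simp add: mult_vec_diff)
    then obtain r where r: "y - x = r *s p" using ker_iff by blast
    have "y $ j = x $ j + r * p $ j" for j
    proof -
      have "(y - x) $ j = (r *s p) $ j" by (simp only: r)
      then show ?thesis by (simp add: algebra_simps)
    qed
    then have "y $ 2 * p $ 3 - y $ 3 * p $ 2 = x $ 2 * p $ 3 - x $ 3 * p $ 2" by (simp add: algebra_simps)
    then show ?thesis by (simp add: \<phi>_def Let_def y_def)
  qed
  show ?thesis unfolding quotient_iso_up_to_shift_def
  \<comment> \<open>The shift adds the degrees of the entries: coordinate 2 of a lift of degree t
    has degree t + \<open>d - b $ 2\<close>, and \<open>p $ 3\<close> has degree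
    \<open>c - b $ 3\<close>; the other product agrees.\<close>
  proof (intro exI[of _ \<phi>] exI[of _ "c + d - b $ 2 - b $ 3"] conjI ballI allI)
    fix a a' assume "a \<in> syz f" "a' \<in> syz f"
    then obtain x x' where x: "a = A *v x" "a' = A *v x'" unfolding in_syz_iff by blast
    show "\<phi> (a + a') = \<phi> a + \<phi> a'"
      unfolding x mult_vec_add[symmetric] \<phi> by (simp add: algebra_simps)
  next
    fix r a assume "a \<in> syz f"
    then obtain x where x: "a = A *v x" unfolding in_syz_iff ..
    show "\<phi> (r *s a) = r * \<phi> a"
      unfolding x mult_vec_scale[symmetric] \<phi> by (simp add: algebra_simps)
  next
    show "\<phi> ` syz f = bour_ideal"
    proof (intro equalityI subsetI)
      fix z assume "z \<in> \<phi> ` syz f"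
      then obtain x where "z = \<phi> (A *v x)" unfolding syz_eq by blast
      then have "z = p $ 2 * (- x $ 3) + p $ 3 * x $ 2" by (simp add: \<phi> algebra_simps)
      then show "z \<in> bour_ideal" unfolding bour_ideal_def in_adjoin_pair by blast
    next
      fix z assume "z \<in> bour_ideal"
      then obtain k l where kl: "z = p $ 2 * k + p $ 3 * l" unfolding bour_ideal_def in_adjoin_pair by blast
      define x :: "('n, 'k) pring ^ 3" where "x = (\<chi> i. if i = 2 then l else - k)"
      have "z = \<phi> (A *v x)" unfolding \<phi> kl by (simp add: x_def mult.commute)
      then show "z \<in> \<phi> ` syz f" unfolding syz_eq by blast
    qed
  next
    show "{a \<in> syz f. \<phi> a = 0} = range (\<lambda>r. r *s col 1)"
    proof (intro equalityI subsetI)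
      fix a assume a: "a \<in> {a \<in> syz f. \<phi> a = 0}"
      then obtain x where x: "a = A *v x" unfolding syz_eq by blast
      then have e: "p $ 3 * x $ 2 = p $ 2 * x $ 3" using a \<phi>[of x] by (simp add: mult.commute)
      obtain q where q: "x $ 2 = p $ 2 * q" using regular_pairD(2)[OF regular_p23 e] by blast
      have "p $ 2 * x $ 3 = p $ 2 * (p $ 3 * q)" using e q by (simp add: mult_ac)
      then have q3: "x $ 3 = p $ 3 * q"
        using pring_mult_left_cancel[OF regular_pairD(1)[OF regular_p23]] by simp
      \<comment> \<open>Outside the first coordinate \<open>x\<close> coincides with
        \<open>q *s p\<close>, which \<open>A\<close> kills, so only a multiple of the first column
        remains.\<close>
      have "x = q *s p + (x $ 1 - q * p $ 1) *s axis 1 1"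
        by (rule vec3_eqI) (simp_all add: q q3 axis_def mult.commute)
      then have "a = q *s (A *v p) + (x $ 1 - q * p $ 1) *s (A *v axis 1 1)"
        unfolding x by (metis mult_vec_add mult_vec_scale)
      then have "a = (x $ 1 - q * p $ 1) *s col 1" by (simp add: A_p col_axis[of 1])
      then show "a \<in> range (\<lambda>r. r *s col 1)" by blast
    next
      fix a assume "a \<in> range (\<lambda>r. r *s col 1)"
      then obtain r where "a = r *s col 1" by blast
      then have "a = A *v (r *s axis 1 1)" by (simp add: col_axis[of 1] mult_vec_scale)
      then show "a \<in> {a \<in> syz f. \<phi> a = 0}" by (simp add: \<phi> syz_eq axis_def)
    qed
  next
    fix t a assume a: "a \<in> syz f \<inter> vforms t"
    then obtain x where "a = A *v x" unfolding syz_eq by blast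
    then obtain x' where x: "a = A *v x'" "\<And>j. x' $ j \<in> forms (t - (b $ j - d))"
      using homogeneous_lift[of a t] a by blast
    have "x' $ 2 * p $ 3 \<in> forms (t + (c + d - b $ 2 - b $ 3))"
      using forms_mult[OF x(2)[of 2] p_form[of 3]] by (simp add: algebra_simps)
    moreover have "x' $ 3 * p $ 2 \<in> forms (t + (c + d - b $ 2 - b $ 3))"
      using forms_mult[OF x(2)[of 3] p_form[of 2]] by (simp add: algebra_simps)
    ultimately show "\<phi> a \<in> forms (t + (c + d - b $ 2 - b $ 3))"
      unfolding x(1) \<phi> by (rule forms_diff)
  qed
qed

lemma bourbaki_ideal_col:
  assumes n: "CARD('n) \<ge> 3" shows "bourbaki_ideal f (col 1) bour_ideal"
  unfolding bourbaki_ideal_def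
proof (intro conjI bourbaki_iso)
  have "bour_ideal = ideal_gen {p $ 3, p $ 2}" by (simp add: bour_ideal_def ideal_gen_insert)
  then show "homogeneous_ideal bour_ideal"
    unfolding homogeneous_ideal_def using p_form by (intro exI[of _ "{p $ 3, p $ 2}"]) auto
  show "unmixed bour_ideal" "height bour_ideal = 2"
    unfolding bour_ideal_def using n by (auto intro!: height_unmixed_pair regular_p23 p_irr)
qed

lemma bourbaki_ideal_unique:
  assumes I: "bourbaki_ideal f (col 1) I" shows "I = bour_ideal"
proof -
  have "quotient_iso_up_to_shift f (col 1) I" using I by (simp add: bourbaki_ideal_def)
  then obtain \<phi> t where iso:
      "(\<forall>a\<in>syz f. \<forall>b\<in>syz f. \<phi> (a + b) = \<phi> a + \<phi> b) \<and>
       (\<forall>r. \<forall>a\<in>syz f. \<phi> (r *s a) = r * \<phi> a) \<and> \<phi> ` syz f = I \<and>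
       {a \<in> syz f. \<phi> a = 0} = range (\<lambda>r. r *s col 1) \<and>
       (\<forall>s. \<forall>a \<in> syz f \<inter> vforms s. \<phi> a \<in> forms (s + t))"
    unfolding quotient_iso_up_to_shift_def by (elim exE)
  note add = iso[THEN conjunct1, rule_format]
    and scale = iso[THEN conjunct2, THEN conjunct1, rule_format]
    and im = iso[THEN conjunct2, THEN conjunct2, THEN conjunct1]
    and ker = iso[THEN conjunct2, THEN conjunct2, THEN conjunct2, THEN conjunct1]
  have hI: "height I = 2" using I by (simp add: bourbaki_ideal_def)
  have s: "A *v x \<in> syz f" for x unfolding syz_eq by (rule rangeI)
  have sc: "r *s col j \<in> syz f" for r j using s[of "r *s axis j 1"] by (simp add: mult_vec_scale col_axis)
  have sc': "col j \<in> syz f" for j using s[of "axis j 1"] by (simp add: col_axis)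
  have "1 *s col 1 \<in> range (\<lambda>r. r *s col 1)" by (rule rangeI)
  then have "1 *s col 1 \<in> {a \<in> syz f. \<phi> a = 0}" unfolding ker .
  then have z1: "\<phi> (col 1) = 0" by simp
  define u v where "u = \<phi> (col 2)" and "v = \<phi> (col 3)"
  have \<phi>: "\<phi> (A *v x) = x $ 2 * u + x $ 3 * v" for x
  proof -
    have two: "x $ 1 *s col 1 + x $ 2 *s col 2 = A *v (\<chi> i. if i = 3 then 0 else x $ i)"
      by (simp add: mult_as_cols)
    have "\<phi> (A *v x) = \<phi> (x $ 1 *s col 1 + x $ 2 *s col 2) + \<phi> (x $ 3 *s col 3)"
      unfolding mult_as_cols[of x] by (rule add) (simp_all only: two s sc)
    also have "\<dots> = \<phi> (x $ 1 *s col 1) + \<phi> (x $ 2 *s col 2) + \<phi> (x $ 3 *s col 3)"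
      by (simp only: add[OF sc sc])
    also have "\<dots> = x $ 2 * u + x $ 3 * v" by (simp only: scale[OF sc'] z1 u_def v_def) simp
    finally show ?thesis .
  qed
  \<comment> \<open>The only relation among the columns becomes a relation between \<open>u\<close>
    and \<open>v\<close>; by regularity its solutions are multiples \<open>h\<close> of the obvious
    one.\<close>
  have "\<phi> (A *v p) = \<phi> (0 *s (A *v p))" by (simp add: A_p)
  also have "\<dots> = 0" by (simp only: scale[OF s]) simp
  finally have rel: "p $ 3 * v = p $ 2 * (- u)" unfolding \<phi> by (simp add: algebra_simps eq_neg_iff_add_eq_0)
  obtain h where h: "v = p $ 2 * h" using regular_pairD(2)[OF regular_p23 rel] by blast
  have "p $ 2 * (- u) = p $ 2 * (p $ 3 * h)" using rel h by (simp add: mult_ac)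
  then have u: "- u = p $ 3 * h" using pring_mult_left_cancel[OF regular_pairD(1)[OF regular_p23]] by blast
  then have u: "u = - (p $ 3 * h)" by (metis minus_minus)
  have \<phi>h: "\<phi> (A *v x) = h * (p $ 2 * x $ 3 + p $ 3 * (- x $ 2))" for x
    unfolding \<phi> h u by (simp add: algebra_simps)
  have sub: "I \<subseteq> adjoin {0} h"
  proof
    fix z assume "z \<in> I"
    then obtain x where "z = \<phi> (A *v x)" unfolding im[symmetric] syz_eq by blast
    then show "z \<in> adjoin {0} h" unfolding in_adjoin_zero \<phi>h by blast
  qed
  \<comment> \<open>If \<open>h\<close> were zero or a non-unit, \<open>I\<close> would lie in an
    ideal of height at most one.\<close>
  have "\<not> height I \<le> 1" using hI by (simp add: numeral_eq_enat one_enat_def)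
  then have big: "\<not> height (adjoin {0} h) \<le> 1" using height_mono[OF sub] order_trans by blast
  have h0: "h \<noteq> 0"
  proof
    assume "h = 0"
    then have "adjoin {0} h = {0}" by (auto simp: in_adjoin_zero)
    then show False using big height_zero_ideal[where 'n = 'n and 'k = 'k] by simp
  qed
  have "1 \<in> adjoin {0} h" using height_principal[OF h0] big by blast
  then obtain k where k: "1 = h * k" unfolding in_adjoin_zero ..
  show ?thesis
  proof (intro equalityI subsetI)
    fix z assume "z \<in> I"
    then obtain x where "z = \<phi> (A *v x)" unfolding im[symmetric] syz_eq by blast
    then have "z = p $ 2 * (h * x $ 3) + p $ 3 * (h * (- x $ 2))" unfolding \<phi>h by (simp add: algebra_simps)
    then show "z \<in> bour_ideal" unfolding bour_ideal_def in_adjoin_pair by blast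
  next
    fix z assume "z \<in> bour_ideal"
    then obtain m l where ml: "z = p $ 2 * m + p $ 3 * l" unfolding bour_ideal_def in_adjoin_pair by blast
    define x :: "('n, 'k) pring ^ 3" where "x = (\<chi> i. if i = 3 then k * m else - (k * l))"
    have "\<phi> (A *v x) = (h * k) * z" unfolding \<phi>h ml by (simp add: x_def algebra_simps)
    then have "z = \<phi> (A *v x)" using k by simp
    then show "z \<in> I" unfolding im[symmetric] using s by blast
  qed
qed

lemma multiplicity_bour_ideal:
  assumes n: "CARD('n) \<ge> 3" and pos: "c > b $ 2" "c > b $ 3"
  shows "multiplicity_quotient bour_ideal = of_int ((c - b $ 2) * (c - b $ 3))"
proof -
  have p2: "p $ 2 \<in> forms (int (nat (c - b $ 2)))" and p3: "p $ 3 \<in> forms (int (nat (c - b $ 3)))"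
    using p_form pos by simp_all
  have "multiplicity_quotient bour_ideal = of_nat (nat (c - b $ 2) * nat (c - b $ 3))"
    unfolding bour_ideal_def
    by (rule multiplicity_pair[OF n regular_p23 p2 p3 p3_nonzero]) (use pos in auto)
  also have "\<dots> = of_int (int (nat (c - b $ 2)) * int (nat (c - b $ 3)))" by simp
  finally show ?thesis using pos by simp
qed

section \<open>Other choices of the first syzygy\<close>

lemma change_of_basis:
  assumes CD: "C ** D = mat 1" "D ** C = mat 1"
    and C: "\<And>s t. C $ s $ t \<in> forms (b $ t - b $ s)" and D: "\<And>s t. D $ s $ t \<in> forms (b $ t - b $ s)"
  shows "free_resolution f (D *v p) (A ** C) d c b"
proof -
  have CDx: "C *v (D *v x) = x" "D *v (C *v x) = x" for x
    using CD by (simp_all add: matrix_vector_mul_assoc)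
  have AC: "(A ** C) *v x = A *v (C *v x)" for x by (simp add: matrix_vector_mul_assoc)
  have "(A ** C) $ i $ j \<in> forms (b $ j - d) \<inter> irrelevant" for i j
  proof
    have "A $ i $ k * C $ k $ j \<in> forms (b $ j - d)" for k
      using forms_mult[OF A_form[of i k] C[of k j]] by simp
    then show "(A ** C) $ i $ j \<in> forms (b $ j - d)" by (simp add: matrix_matrix_mult_def forms_sum)
    have "A $ i $ k * C $ k $ j \<in> irrelevant" for k by (rule ideal_mult_right[OF ideal_irrelevant A_irr])
    then show "(A ** C) $ i $ j \<in> irrelevant"
      by (simp add: matrix_matrix_mult_def idl.subspace_sum[OF ideal_irrelevant])
  qed
  moreover have "(D *v p) $ j \<in> forms (c - b $ j) \<inter> irrelevant" for j
  proof
    have "D $ j $ k * p $ k \<in> forms (c - b $ j)" for k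
      using forms_mult[OF D[of j k] p_form[of k]] by simp
    then show "(D *v p) $ j \<in> forms (c - b $ j)" by (simp add: matrix_vector_mult_def forms_sum)
    have "D $ j $ k * p $ k \<in> irrelevant" for k by (rule idl.subspace_scale[OF ideal_irrelevant p_irr])
    then show "(D *v p) $ j \<in> irrelevant"
      by (simp add: matrix_vector_mult_def idl.subspace_sum[OF ideal_irrelevant])
  qed
  moreover have "syz f = range (\<lambda>x. (A ** C) *v x)"
  proof (intro equalityI subsetI)
    fix a assume "a \<in> syz f"
    then obtain x where "a = A *v x" unfolding in_syz_iff ..
    then have "a = (A ** C) *v (D *v x)" by (simp only: AC CDx)
    then show "a \<in> range (\<lambda>x. (A ** C) *v x)" by blast
  next
    fix a assume "a \<in> range (\<lambda>x. (A ** C) *v x)"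
    then show "a \<in> syz f" unfolding in_syz_iff AC by blast
  qed
  moreover have "{x. (A ** C) *v x = 0} = range (\<lambda>r. r *s (D *v p))"
  proof (intro equalityI subsetI)
    fix x assume "x \<in> {x. (A ** C) *v x = 0}"
    then have "A *v (C *v x) = 0" by (simp add: AC)
    then obtain r where "C *v x = r *s p" using ker_iff by blast
    then have "x = r *s (D *v p)" by (metis CDx(2) mult_vec_scale)
    then show "x \<in> range (\<lambda>r. r *s (D *v p))" by blast
  next
    fix x assume "x \<in> range (\<lambda>r. r *s (D *v p))"
    then obtain r where "x = r *s (D *v p)" by blast
    then have "(A ** C) *v x = r *s (A *v p)" by (simp only: AC mult_vec_scale CDx)
    then show "x \<in> {x. (A ** C) *v x = 0}" by (simp add: A_p)
  qed
  moreover have "r = 0" if "r *s (D *v p) = 0" for r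
  proof -
    have "C *v (r *s (D *v p)) = r *s p" by (simp only: mult_vec_scale CDx)
    then have "r *s p = 0" using that by (simp add: vec_eq_iff mult_vec_nth3)
    then show ?thesis by (rule p_inj)
  qed
  ultimately show ?thesis using f_form
    by unfold_locales (simp add: minimal_resolution_def)
qed

text \<open>For degree reasons the coordinates of \<open>\<nu>\<close> in the columns are constants,
  zero except at columns of least degree. One of them is invertible, so \<open>\<nu>\<close> can be
  exchanged for that column without changing degrees.\<close>

lemma resolution_with_first_column:
  assumes \<nu>: "\<nu> \<in> syz f" "\<nu> \<in> vforms (b $ 1 - d)" "\<nu> \<noteq> 0" and b: "\<And>j. b $ 1 \<le> b $ j"
  obtains A' p' where "free_resolution f p' A' d c b" "(\<chi> i. A' $ i $ 1) = \<nu>"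
proof -
  obtain x0 where "\<nu> = A *v x0" using \<nu>(1) unfolding in_syz_iff ..
  then obtain x where x: "\<nu> = A *v x" "\<And>j. x $ j \<in> forms (b $ 1 - d - (b $ j - d))"
    using homogeneous_lift[OF \<nu>(2)] by blast
  then have xf: "x $ j \<in> forms (b $ 1 - b $ j)" for j by (metis diff_diff_eq2 diff_add_cancel)
  have "x \<noteq> 0"
  proof
    assume "x = 0"
    then have "\<nu> = 0" unfolding x(1) by (simp add: vec_eq_iff mult_vec_nth3)
    then show False using \<nu>(3) by simp
  qed
  then obtain i where i: "x $ i \<noteq> 0" by (auto simp: vec_eq_iff)
  have bi: "b $ i = b $ 1" using forms_negative[OF xf[of i]] i b[of i] by force
  then obtain k where k: "x $ i = mon 0 k" using forms_0E[of "x $ i"] xf[of i] by auto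
  have k0: "k \<noteq> 0" using i k by auto
  define u :: "('n, 'k) pring" where "u = mon 0 (1 / k)"
  have xu: "x $ i * u = 1" "u * x $ i = 1" using k k0 by (simp_all add: u_def mult_single)
  have uf: "u \<in> forms 0" unfolding u_def by (rule const_form)
  have one: "(1 :: ('n, 'k) pring) \<in> forms 0" using const_form[of 1] by simp
  \<comment> \<open>The first basis vector is replaced by \<open>x\<close>; if \<open>i\<close> is
    not 1, the old first vector moves to position \<open>i\<close>. \<open>D\<close> is the inverse,
    obtained by solving for the \<open>i\<close>-th coordinate.\<close>
  define C :: "('n, 'k) pring ^ 3 ^ 3" where
    "C = (\<chi> s t. if t = 1 then x $ s else if s = (if t = i then 1 else t) then 1 else 0)"
  define D :: "('n, 'k) pring ^ 3 ^ 3" where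
    "D = (\<chi> t s. if t = 1 then if s = i then u else 0
       else (if s = (if t = i then 1 else t) then 1 else 0) - (if s = i then u * x $ (if t = i then 1 else t) else 0))"
  have i3: "i = 1 \<or> i = 2 \<or> i = 3" by (rule exhaust_3)
  have xuq: "u * (x $ i * x $ q) = x $ q" "u * (x $ q * x $ i) = x $ q" for q
  proof -
    show "u * (x $ i * x $ q) = x $ q" by (simp only: mult.assoc[symmetric] xu mult_1_left)
    then show "u * (x $ q * x $ i) = x $ q" by (simp only: mult.commute[of "x $ q"])
  qed
  have "C ** D = mat 1" "D ** C = mat 1"
    using i3 xu xuq[of 1] xuq[of 2] xuq[of 3] by (auto simp: vec_eq_iff forall_3 matrix_matrix_mult_def sum_3 C_def D_def mat_def algebra_simps)
  moreover have "C $ s $ t \<in> forms (b $ t - b $ s)" for s t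
    using xf[of s] one bi by (auto simp: C_def)
  moreover have "D $ t $ s \<in> forms (b $ s - b $ t)" for s t
  proof -
    have ux: "u * x $ q \<in> forms (b $ i - b $ q)" for q
      using forms_mult[OF uf xf[of q]] bi by simp
    have "(if s = (if t = i then 1 else t) then 1 else (0 :: ('n, 'k) pring)) \<in> forms (b $ s - b $ t)"
      using one bi by (auto split: if_splits)
    moreover have "(if s = i then u * x $ (if t = i then 1 else t) else 0) \<in> forms (b $ s - b $ t)"
      using ux[of t] ux[of 1] bi by auto
    moreover have "(if s = i then u else 0) \<in> forms (b $ s - b $ 1)" using uf bi by auto
    ultimately show ?thesis by (simp add: D_def forms_diff)
  qed
  ultimately have "free_resolution f (D *v p) (A ** C) d c b" by (rule change_of_basis)
  moreover have "(\<chi> r. (A ** C) $ r $ 1) = \<nu>"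
    unfolding x(1) by (simp add: vec_eq_iff matrix_matrix_mult_def mult_vec_nth3 sum_3 C_def)
  ultimately show ?thesis by (rule that)
qed

lemma minimal_generatorD:
  assumes "minimal_generator (syz f) \<nu>" shows "\<nu> \<in> syz f" "\<nu> \<noteq> 0"
proof -
  obtain G where G: "submodule_gen G = syz f" "\<And>g. g \<in> G \<Longrightarrow> submodule_gen (G - {g}) \<noteq> syz f" "\<nu> \<in> G"
    using assms unfolding minimal_generator_def by blast
  show "\<nu> \<in> syz f" using G vmod.span_base by blast
  show "\<nu> \<noteq> 0"
  proof
    assume "\<nu> = 0"
    have "G \<subseteq> submodule_gen (G - {\<nu>})"
    proof
      fix g assume "g \<in> G"
      then show "g \<in> submodule_gen (G - {\<nu>})"
        using \<open>\<nu> = 0\<close> vmod.span_zero by (cases "g = \<nu>") (auto intro: vmod.span_base)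
    qed
    then have "submodule_gen G \<subseteq> submodule_gen (G - {\<nu>})"
      by (rule vmod.span_minimal) (rule vmod.subspace_span)
    moreover have "submodule_gen (G - {\<nu>}) \<subseteq> submodule_gen G" by (rule vmod.span_mono) auto
    ultimately show False using G(1) G(2)[OF G(3)] by simp
  qed
qed

lemma bour_eq:
  assumes n: "CARD('n) \<ge> 3" and d: "d > 0" "d \<le> b $ 1" and b: "\<And>j. b $ 1 \<le> b $ j"
    and pos: "c > b $ 2" "c > b $ 3"
  shows "bour f = of_int ((c - b $ 2) * (c - b $ 3))"
proof -
  let ?Q = "\<lambda>v. \<exists>\<nu> I. minimal_generator (syz f) \<nu> \<and> \<nu> \<in> vforms (int (indeg_syz f)) \<and>
    bourbaki_ideal f \<nu> I \<and> v = multiplicity_quotient I"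
  note e = indeg_eq[OF b d(2)]
  have "(THE v. ?Q v) = of_int ((c - b $ 2) * (c - b $ 3))"
  proof (rule the_equality)
    show "?Q (of_int ((c - b $ 2) * (c - b $ 3)))"
      using minimal_generator_col[of 1] col_vforms[of 1] bourbaki_ideal_col[OF n]
        multiplicity_bour_ideal[OF n pos] unfolding e by metis
    fix v assume "?Q v"
    then obtain \<nu> I where \<nu>: "minimal_generator (syz f) \<nu>" "\<nu> \<in> vforms (b $ 1 - d)"
      and I: "bourbaki_ideal f \<nu> I" and v: "v = multiplicity_quotient I" unfolding e by blast
    obtain A' p' where R: "free_resolution f p' A' d c b" and col: "(\<chi> i. A' $ i $ 1) = \<nu>"
      using resolution_with_first_column[OF minimal_generatorD(1)[OF \<nu>(1)] \<nu>(2) minimal_generatorD(2)[OF \<nu>(1)] b]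
      by blast
    interpret R: free_resolution f p' A' d c b by (rule R)
    have "I = R.bour_ideal" using R.bourbaki_ideal_unique I unfolding col by blast
    then show "v = of_int ((c - b $ 2) * (c - b $ 3))"
      using R.multiplicity_bour_ideal[OF n pos] v by simp
  qed
  then show ?thesis using not_perfect[OF n d(1)] by (simp add: bour_def)
qed

end

theorem proposition3p11:
  fixes J :: "('n::finite, 'k::{alg_closed_field, field_char_0}) pring set"
    and f p :: "('n, 'k) pring ^ 3"
    and A :: "('n, 'k) pring ^ 3 ^ 3"
    and d :: nat
    and \<delta> :: "nat ^ 3"
  assumes "CARD('n) \<ge> 3"
    and "d \<ge> 2"
    and "height J = 2"
    and "minimal_resolution (int d) (\<chi> j. int d + int (\<delta> $ j)) (int (\<delta> $ 1) + int (\<delta> $ 2) + int (\<delta> $ 3)) J f A p"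
    and "\<delta> $ 1 \<le> \<delta> $ 2" and "\<delta> $ 2 \<le> \<delta> $ 3" and "\<delta> $ 3 \<le> d"
    and "\<And>i j. i \<noteq> j \<Longrightarrow> \<delta> $ i + \<delta> $ j \<ge> d + 1"
  shows "bour f = of_int ((int d - int (\<delta> $ 1) - int (\<delta> $ 2)) * (int d - int (\<delta> $ 1) - int (\<delta> $ 3)))"
proof -
  let ?b = "(\<chi> j. int d + int (\<delta> $ j)) :: int ^ 3"
  let ?c = "int (\<delta> $ 1) + int (\<delta> $ 2) + int (\<delta> $ 3)"
  have "ideal_of f = J" using assms(4) by (simp add: minimal_resolution_def)
  then interpret free_resolution f p A "int d" ?c ?b
    using assms(4) by unfold_locales simp
  have s: "\<delta> $ 1 + \<delta> $ 2 \<ge> d + 1" "\<delta> $ 1 + \<delta> $ 3 \<ge> d + 1" using assms(8)[of 1 2] assms(8)[of 1 3] by simp_all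
  have "bour f = of_int ((?c - ?b $ 2) * (?c - ?b $ 3))"
  proof (rule bour_eq[OF assms(1)])
    show "?b $ 1 \<le> ?b $ j" for j using exhaust_3[of j] assms(5,6) by auto
  qed (use assms(2) s in auto)
  \<comment> \<open>The degrees of \<open>p $ 2\<close> and \<open>p $ 3\<close> are the negatives
    of the factors in the statement; they occur in the opposite order, and the two signs
    cancel.\<close>
  also have "(?c - ?b $ 2) * (?c - ?b $ 3) =
      (int d - int (\<delta> $ 1) - int (\<delta> $ 2)) * (int d - int (\<delta> $ 1) - int (\<delta> $ 3))"
    by (simp add: algebra_simps)
  finally show ?thesis .
qed

end
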